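(* Let the setting be as in the context, with $W$ satisfying (i), (ii') and (iii'), $R_{\mathcal L}$ the rotation by angle $\phi\in[0,\pi/3)$, $a\ge0$ fixed, and $a_\varepsilon=\sqrt\varepsilon\,a$. Then for $\varepsilon$ small, $$\inf\{\mathcal E_\varepsilon(y):y\in\mathcal A(a_\varepsilon)\}=\min\Big\{\frac{\alpha l}{\sqrt3}a^2+\frac{[6\alpha+7\alpha'-2(3\alpha-\alpha')\cos(6\phi)]\,l}{27\sqrt3}\sqrt\varepsilon\,a^3,\ \frac{2\beta}{\gamma}\Big\}+O(\varepsilon).$$
   Context: Let $R_{\mathcal L}=\begin{pmatrix}\cos\phi&-\sin\phi\\ \sin\phi&\cos\phi\end{pmatrix}$, $\phi\in[0,\pi/3)$, $\mathcal{L}=R_{\mathcal L}\begin{pmatrix}1&1/2\\0&\sqrt3/2\end{pmatrix}\mathbb{Z}^2$, $\mathbf v_1=R_{\mathcal L}\mathbf e_1$, $\mathbf v_2=R_{\mathcal L}(\tfrac12,\tfrac{\sqrt3}{2})^T$, $\mathcal V=\{\mathbf v_1,\mathbf v_2,\mathbf v_2-\mathbf v_1\}$, and $\gamma=\max\{|\mathbf v\cdot\mathbf e_2|:\mathbf v\in\mathcal V\}=\sin(\phi+\pi/3)$. Let $l>1/\sqrt3$, $\Omega=(0,l)\times(0,1)$. $W:[0,\infty)\to[0,\infty]$ satisfies: (i) $W\ge0$, $W(r)=0$ iff $r=1$; (ii') $W$ is continuous on $[0,\infty)$ and $C^4$ near $1$ with $\alpha:=W''(1)>0$, and $\alpha':=W'''(1)$;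 (iii') $W(r)=\beta+O(r^{-2})$ as $r\to\infty$. For $y:\varepsilon\mathcal L\cap\Omega\to\mathbb R^2$, $E_\varepsilon(y)=\frac12\sum_{x,x'\in\varepsilon\mathcal L\cap\Omega,|x-x'|=\varepsilon}W(|y(x)-y(x')|/\varepsilon)$ and $\mathcal E_\varepsilon=\varepsilon E_\varepsilon$. $\mathcal A(a_\varepsilon)$ is the set of $y:\varepsilon\mathcal L\cap\Omega\to\mathbb R^2$ with $y_1(x)=(1+a_\varepsilon)x_1$ whenever $x_1\le\varepsilon$ or $x_1\ge l-\varepsilon$; if $\phi=0$ one additionally requires $|y(x)-y(x')|\le R_0\varepsilon$ whenever $x_1,x_1'\le\psi(\varepsilon)$ or $x_1,x_1'\ge l-\psi(\varepsilon)$, for a fixed constant $R_0$ and a fixed function $\psi$ with $\psi(\varepsilon)\to0$, $\psi(\varepsilon)/\varepsilon\to\infty$.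
   Formalization: For φ=0 the requirement |y(x)-y(x')| ≤ R_0 ε in the end strips is imposed only on nearest neighbours |x-x'|=ε (for all pairs the claim fails, e.g. a=0, ψ(ε)=√ε), and R_0>1 is assumed (for R_0<1 the infimum blows up). *)

theory Defs
  imports "HOL-Analysis.Analysis"
begin

text \<open>Points of the plane are represented as complex numbers: Re = first coordinate,
  Im = second coordinate. The rotated triangular lattice
  R_L [[1,1/2],[0,sqrt 3/2]] Z^2 = { e^(i phi) (m + n e^(i pi/3)) | m n integers }.\<close>

definition tri_lattice :: "real \<Rightarrow> complex set" where
  "tri_lattice \<phi> = {cis \<phi> * (of_int m + of_int n * cis (pi / 3)) | m n. True}"

definition sites :: "real \<Rightarrow> real \<Rightarrow> real \<Rightarrow> complex set" where
  "sites \<phi> l \<epsilon> = {x. x \<in> (\<lambda>z. complex_of_real \<epsilon> * z) ` tri_lattice \<phi>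
      \<and> 0 < Re x \<and> Re x < l \<and> 0 < Im x \<and> Im x < 1}"

definition energy :: "(real \<Rightarrow> ereal) \<Rightarrow> real \<Rightarrow> real \<Rightarrow> real \<Rightarrow> (complex \<Rightarrow> complex) \<Rightarrow> ereal" where
  "energy W \<phi> l \<epsilon> y = ereal (1/2) *
     (\<Sum>x\<in>sites \<phi> l \<epsilon>. \<Sum>x'\<in>sites \<phi> l \<epsilon>.
        if cmod (x - x') = \<epsilon> then W (cmod (y x - y x') / \<epsilon>) else 0)"

definition scaled_energy :: "(real \<Rightarrow> ereal) \<Rightarrow> real \<Rightarrow> real \<Rightarrow> real \<Rightarrow> (complex \<Rightarrow> complex) \<Rightarrow> ereal" where
  "scaled_energy W \<phi> l \<epsilon> y = ereal \<epsilon> * energy W \<phi> l \<epsilon> y"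

definition admissible ::
  "real \<Rightarrow> real \<Rightarrow> real \<Rightarrow> (real \<Rightarrow> real) \<Rightarrow> real \<Rightarrow> real \<Rightarrow> (complex \<Rightarrow> complex) set" where
  "admissible \<phi> l R0 \<psi> \<epsilon> a\<epsilon> = {y.
     (\<forall>x\<in>sites \<phi> l \<epsilon>. (Re x \<le> \<epsilon> \<or> Re x \<ge> l - \<epsilon>) \<longrightarrow> Re (y x) = (1 + a\<epsilon>) * Re x)
   \<and> (\<phi> = 0 \<longrightarrow> (\<forall>x\<in>sites \<phi> l \<epsilon>. \<forall>x'\<in>sites \<phi> l \<epsilon>.
        (cmod (x - x') = \<epsilon> \<and>
         ((Re x \<le> \<psi> \<epsilon> \<and> Re x' \<le> \<psi> \<epsilon>) \<or> (Re x \<ge> l - \<psi> \<epsilon> \<and> Re x' \<ge> l - \<psi> \<epsilon>)))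
        \<longrightarrow> cmod (y x - y x') \<le> R0 * \<epsilon>))}"

definition C4_on :: "real set \<Rightarrow> (real \<Rightarrow> real) \<Rightarrow> bool" where
  "C4_on U f \<longleftrightarrow>
     (\<forall>k<4. \<forall>x\<in>U. ((deriv ^^ k) f has_real_derivative (deriv ^^ Suc k) f x) (at x))
     \<and> continuous_on U ((deriv ^^ 4) f)"

end

theory Submission
  imports Defs
begin

text \<open>
  For the upper bound one compares the affine map \<open>diag(1 + e, 1 - e/3)\<close>, \<open>e = sqrt \<epsilon> a\<close>, with a
  configuration that is cleaved along a line parallel to \<open>v\<^sub>2\<close>.

  For the lower bound the energy is distributed over the lattice triangles, which are then collected
  along horizontal slices. On a slice the strains in direction \<open>e\<^sub>1\<close>, weighted by chord length,
  average to the imposed strain \<open>\<tau>\<close>. An unbroken triangle of strain \<open>t\<close> costs at least the tangent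
  \<open>F + A (t - \<tau>)\<close> of the Cauchy--Born energy, so a slice costs at least the elastic energy unless some
  triangle on it has strain of order \<open>1/sqrt \<epsilon>\<close>. In that case one of the two edges that the slice
  crosses is long, hence both triangles adjacent to this edge have two long edges, and together they
  cost \<open>2 \<beta> - O(\<epsilon>)\<close>. Each triangle projects vertically onto an interval of length \<open>\<epsilon> \<gamma>\<close>, which
  produces the value \<open>2 \<beta> / \<gamma>\<close>.
\<close>

section \<open>Geometry of the rotated lattice\<close>

text \<open>The term of order sqrt \<epsilon> has to survive with an error O(\<epsilon>), so the
  lower bound can lose nothing to compactness or rigidity. It controls only the stretch 1 + t of the
  first component in direction \<open>e\<^sub>1\<close>. This suffices because squared edge lengths
  are linear in the metric tensor: the weights \<open>p1\<close>, \<open>p2\<close>,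
  \<open>p3\<close> that express the squared stretch of \<open>e\<^sub>1\<close> through the three
  squared edge lengths are also, to first order, the relative edge strains of the affine competitor.
  Tangents to the pair potential at these strains therefore add up to a function of t alone, and
  rotations need no separate treatment.

  The tangent has slope of order \<tau> = sqrt \<epsilon> a, whereas a broken cell costs at least a
  fixed amount, so the tangent bound persists up to strains of order 1/\<tau>. Beyond that, edges
  have length of order 1/\<tau>, where the tail O(1/r^2) of W is O(\<tau>^2) = O(\<epsilon>). The
  two regimes meet without a gap, and each slice pays the smaller of the two costs.\<close>

locale lattice_angle =
  fixes \<phi> :: real
  assumes phi0: "0 \<le> \<phi>" and phi1: "\<phi> < pi / 3"
begin

text \<open>The vector \<open>v\<^sub>2\<close> is (\<open>\<nu>\<close>, \<open>\<gamma>\<close>),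
  and \<open>\<mu>\<close> is the height of \<open>v\<^sub>1\<close> in units of the height of
  \<open>v\<^sub>2\<close>. Hence \<open>v\<^sub>1 - \<mu> v\<^sub>2\<close> is horizontal; its
  length \<open>\<kappa>\<close> is the area sqrt 3 / 2 of a lattice parallelogram divided by the
  height \<open>\<gamma>\<close>.\<close>

definition "\<gamma> = sin (\<phi> + pi / 3)"
definition "\<nu> = cos (\<phi> + pi / 3)"
definition "\<mu> = sin \<phi> / \<gamma>"
definition "\<kappa> = sqrt 3 / 2 / \<gamma>"

text \<open>Two roles: coefficients of the three squared edge lengths in the squared stretch of
  \<open>e\<^sub>1\<close> (\<open>metric_identity\<close>), and, by \<open>p_cos\<close>, the
  values (4 c^2 - 1)/3 for c the first coordinate of a bond vector. The latter is the bond strain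
  per unit e under diag(1 + e, 1 - e/3), to first order.\<close>

definition "p1 = (1 - \<mu>) / \<kappa>\<^sup>2"
definition "p2 = (\<mu>\<^sup>2 - \<mu>) / \<kappa>\<^sup>2"
definition "p3 = \<mu> / \<kappa>\<^sup>2"

lemma gamma_expand: "\<gamma> = sin \<phi> / 2 + sqrt 3 / 2 * cos \<phi>"
  by (simp add: \<gamma>_def sin_add cos_60 sin_60)

lemma nu_expand: "\<nu> = cos \<phi> / 2 - sqrt 3 / 2 * sin \<phi>"
  by (simp add: \<nu>_def cos_add cos_60 sin_60)

lemma sin_phi_nonneg: "0 \<le> sin \<phi>"
  using phi0 phi1 by (intro sin_ge_zero) auto

lemma gamma_minus_sin: "\<gamma> - sin \<phi> = sin (pi / 3 - \<phi>)"
  by (simp add: gamma_expand sin_diff cos_60 sin_60)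

lemma gamma_minus_sin_pos: "\<gamma> - sin \<phi> > 0"
  unfolding gamma_minus_sin using phi0 phi1 by (intro sin_gt_zero) auto

lemma gamma_pos: "\<gamma> > 0"
  using gamma_minus_sin_pos sin_phi_nonneg by linarith

lemma gamma_le_1: "\<gamma> \<le> 1"
  by (simp add: \<gamma>_def)

lemma mu_nonneg: "0 \<le> \<mu>" and mu_less_1: "\<mu> < 1"
  using gamma_pos gamma_minus_sin_pos sin_phi_nonneg by (auto simp: \<mu>_def)

lemma kappa_pos: "\<kappa> > 0"
  using gamma_pos by (simp add: \<kappa>_def)

lemma gamma_mu: "\<gamma> * \<mu> = sin \<phi>" and gamma_kappa: "\<gamma> * \<kappa> = sqrt 3 / 2"
  using gamma_pos by (auto simp: \<mu>_def \<kappa>_def)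

lemma cos_phi_eq: "cos \<phi> = \<kappa> + \<mu> * \<nu>"
proof -
  have "\<gamma> * cos \<phi> - sin \<phi> * \<nu> = sin (pi / 3)"
    using sin_diff[of "\<phi> + pi/3" \<phi>] by (simp add: \<gamma>_def \<nu>_def algebra_simps)
  then show ?thesis
    using gamma_pos by (simp add: \<kappa>_def \<mu>_def field_simps sin_60)
qed

text \<open>Both sides are the squared length of \<open>v\<^sub>1 - \<mu> v\<^sub>2\<close>, because
  the scalar product of the two lattice vectors is 1/2.\<close>

lemma kappa_sq: "\<kappa>\<^sup>2 = 1 - \<mu> + \<mu>\<^sup>2"
proof -
  define C S where "C = cos \<phi>" and "S = sin \<phi>"
  have s: "C * C + S * S = 1" using sin_cos_squared_add3[of \<phi>] by (simp add: C_def S_def)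
  have "\<gamma>\<^sup>2 - \<gamma> * S + S\<^sup>2 = 3 / 4 * (C * C + S * S)"
    unfolding gamma_expand C_def[symmetric] S_def[symmetric]
    by (simp add: power2_eq_square field_simps)
  then have "\<gamma>\<^sup>2 - \<gamma> * S + S\<^sup>2 = 3 / 4" unfolding s by simp
  then have "\<gamma>\<^sup>2 - \<gamma> * sin \<phi> + (sin \<phi>)\<^sup>2 = 3 / 4" unfolding S_def .
  then have "3 / 4 / \<gamma>\<^sup>2 = (\<gamma>\<^sup>2 - \<gamma> * sin \<phi> + (sin \<phi>)\<^sup>2) / \<gamma>\<^sup>2" by (simp only:)
  also have "\<dots> = 1 - \<mu> + \<mu>\<^sup>2"
    using gamma_pos by (simp add: \<mu>_def power2_eq_square field_simps)
  finally show ?thesis by (simp add: \<kappa>_def power_divide)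
qed

lemma sum_p: "p1 + p2 + p3 = 1"
proof -
  have "p1 + p2 + p3 = (1 - \<mu> + \<mu>\<^sup>2) / \<kappa>\<^sup>2"
    by (simp add: p1_def p2_def p3_def add_divide_distrib diff_divide_distrib)
  then show ?thesis using kappa_pos unfolding kappa_sq[symmetric] by simp
qed

text \<open>This normalisation makes the quadratic part of the elastic energy independent of the
  lattice angle; only the cubes in \<open>sum_p_cube\<close> depend on it.\<close>

lemma sum_p_sq: "p1\<^sup>2 + p2\<^sup>2 + p3\<^sup>2 = 1"
proof -
  have "p1\<^sup>2 + p2\<^sup>2 + p3\<^sup>2 = ((1 - \<mu>)\<^sup>2 + (\<mu>\<^sup>2 - \<mu>)\<^sup>2 + \<mu>\<^sup>2) / (\<kappa>\<^sup>2)\<^sup>2"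
    by (simp add: p1_def p2_def p3_def power_divide add_divide_distrib)
  also have "(1 - \<mu>)\<^sup>2 + (\<mu>\<^sup>2 - \<mu>)\<^sup>2 + \<mu>\<^sup>2 = (\<kappa>\<^sup>2)\<^sup>2"
    unfolding kappa_sq by (simp add: power2_eq_square algebra_simps)
  finally show ?thesis using kappa_pos by simp
qed

lemma abs_p_le: "\<bar>p1\<bar> \<le> 1" "\<bar>p2\<bar> \<le> 1" "\<bar>p3\<bar> \<le> 1"
proof -
  have "p1\<^sup>2 \<le> 1\<^sup>2" "p2\<^sup>2 \<le> 1\<^sup>2" "p3\<^sup>2 \<le> 1\<^sup>2"
    using sum_p_sq zero_le_power2[of p1] zero_le_power2[of p2] zero_le_power2[of p3]
    unfolding one_power2 by linarith+
  then show "\<bar>p1\<bar> \<le> 1" "\<bar>p2\<bar> \<le> 1" "\<bar>p3\<bar> \<le> 1"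
    by (metis abs_le_square_iff abs_one)+
qed

lemma p_cos:
  "p1 = (4 * (cos \<phi>)\<^sup>2 - 1) / 3" "p2 = (4 * (cos (\<phi> + pi/3))\<^sup>2 - 1) / 3"
  "p3 = (4 * (cos \<phi> - cos (\<phi> + pi/3))\<^sup>2 - 1) / 3"
proof -
  define C S where "C = cos \<phi>" and "S = sin \<phi>"
  have s: "C * C = 1 - S * S" using sin_cos_squared_add3[of \<phi>] unfolding C_def S_def by linarith
  then have s': "C * (C * x) = x - S * S * x" for x
    by (metis left_diff_distrib mult.assoc mult_1)
  have three: "sqrt 3 * (sqrt 3 * x) = 3 * x" for x
    by (simp flip: mult.assoc)
  have k: "\<kappa>\<^sup>2 = 3 / 4 / \<gamma>\<^sup>2" by (simp add: \<kappa>_def power_divide)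
  have "p1 = 4/3 * \<gamma> * (\<gamma> - S)" "p2 = 4/3 * S * (S - \<gamma>)" "p3 = 4/3 * S * \<gamma>"
    unfolding p1_def p2_def p3_def k \<mu>_def S_def using gamma_pos
    by (auto simp: field_simps power2_eq_square)
  then show "p1 = (4 * (cos \<phi>)\<^sup>2 - 1) / 3" "p2 = (4 * (cos (\<phi> + pi/3))\<^sup>2 - 1) / 3"
    "p3 = (4 * (cos \<phi> - cos (\<phi> + pi/3))\<^sup>2 - 1) / 3"
    unfolding gamma_expand cos_add cos_60 sin_60 C_def[symmetric] S_def[symmetric]
    by (simp_all add: power2_eq_square field_simps s s' three)
qed

text \<open>Origin of the angle 6 \<phi>. Since \<open>p2\<close> and \<open>p3\<close> differ only
  by the sign of \<open>q\<close>, the sum contains \<open>q\<^sup>2\<close> alone and is a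
  polynomial in \<open>x\<close>, the squared cosine; the triple-angle formula at 2 \<phi>
  identifies it.\<close>

lemma sum_p_cube: "p1 ^ 3 + p2 ^ 3 + p3 ^ 3 = (7 + 2 * cos (6 * \<phi>)) / 9"
proof -
  define C S where "C = cos \<phi>" and "S = sin \<phi>"
  define x where "x = C\<^sup>2"
  have S2: "S\<^sup>2 = 1 - x" by (simp add: C_def S_def x_def sin_squared_eq)
  define q where "q = sqrt 3 * C * S"
  have q2: "q\<^sup>2 = 3 * x * (1 - x)"
    by (simp add: q_def power_mult_distrib S2 x_def)
  have a: "p1 = (4 * x - 1) / 3"
    by (simp add: p_cos x_def C_def)
  have xx: "C * C = x" "S * S = 1 - x" using S2 by (auto simp: x_def power2_eq_square)
  then have xx': "C * (C * u) = x * u" "S * (S * u) = u - x * u" for u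
    by (metis mult.assoc, metis left_diff_distrib mult.assoc mult_1)
  have b: "p2 = (2 - 2 * x - 2 * q) / 3"
    unfolding p_cos q_def cos_add cos_60 sin_60 C_def[symmetric] S_def[symmetric]
    by (simp add: power2_eq_square field_simps xx xx')
  have c: "p3 = (2 - 2 * x + 2 * q) / 3"
    unfolding p_cos q_def cos_add cos_60 sin_60 C_def[symmetric] S_def[symmetric]
    by (simp add: power2_eq_square field_simps xx xx')
  have c3: "cos (6 * \<phi>) = 4 * (2 * x - 1) ^ 3 - 3 * (2 * x - 1)"
  proof -
    have "cos (6 * \<phi>) = 4 * cos (2 * \<phi>) ^ 3 - 3 * cos (2 * \<phi>)"
      using cos_treble_cos[of "2 * \<phi>"] by simp
    then show ?thesis by (simp add: cos_double_cos x_def C_def)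
  qed
  have "p2 ^ 3 + p3 ^ 3 = (2 * (2 - 2*x)^3 + 6 * (2 - 2*x) * 4 * q\<^sup>2) / 27"
    unfolding b c by (simp add: power2_eq_square power3_eq_cube field_simps)
  then show ?thesis
    unfolding a c3 q2 by (simp add: power2_eq_square power3_eq_cube field_simps)
qed

text \<open>Polarisation: the cross term on the left is expressed by the three squared lengths. For
  \<open>z1\<close>, \<open>z2\<close> the images of \<open>v\<^sub>1\<close>,
  \<open>v\<^sub>2\<close> under a linear map, the left side is the squared length of the image of
  \<open>e\<^sub>1\<close>.\<close>

lemma metric_identity:
  fixes z1 z2 :: complex
  shows "(cmod (z1 - of_real \<mu> * z2))\<^sup>2 / \<kappa>\<^sup>2
    = p1 * (cmod z1)\<^sup>2 + p2 * (cmod z2)\<^sup>2 + p3 * (cmod (z2 - z1))\<^sup>2"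
proof -
  have "(cmod (z1 - of_real \<mu> * z2))\<^sup>2
    = (1 - \<mu>) * (cmod z1)\<^sup>2 + (\<mu>\<^sup>2 - \<mu>) * (cmod z2)\<^sup>2 + \<mu> * (cmod (z2 - z1))\<^sup>2"
    unfolding cmod_power2 by (simp add: power2_eq_square algebra_simps)
  then show ?thesis
    by (simp add: p1_def p2_def p3_def add_divide_distrib)
qed

lemma abs_nu_le: "\<bar>\<nu>\<bar> \<le> 1 / 2"
proof -
  have "\<nu> \<le> cos (pi / 3)" unfolding \<nu>_def using phi0 phi1
    by (intro cos_monotone_0_pi_le) auto
  moreover have "cos (pi - pi / 3) \<le> \<nu>" unfolding \<nu>_def using phi0 phi1
    by (intro cos_monotone_0_pi_le) auto
  moreover have "cos (pi - pi / 3) = - (1 / 2)"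
    unfolding cos_diff by (simp add: cos_60)
  ultimately show ?thesis by (simp add: cos_60)
qed

lemma gamma_sq: "\<gamma>\<^sup>2 = 1 - \<nu>\<^sup>2"
  by (simp add: \<gamma>_def \<nu>_def sin_squared_eq)

lemma gamma_ge: "\<gamma> \<ge> sqrt 3 / 2"
proof -
  have "\<nu>\<^sup>2 \<le> (1/2)\<^sup>2" using abs_nu_le by (metis abs_le_square_iff abs_of_nonneg zero_le_divide_1_iff zero_le_numeral)
  then have "(sqrt 3 / 2)\<^sup>2 \<le> \<gamma>\<^sup>2" by (simp add: gamma_sq power_divide)
  then show ?thesis using gamma_pos by (meson less_eq_real_def power2_le_imp_le)
qed

lemma kappa_le_1: "\<kappa> \<le> 1"
  unfolding \<kappa>_def using gamma_ge gamma_pos by (simp add: field_simps)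

text \<open>A line in direction \<open>v\<^sub>2\<close> moves sideways by this amount over the
  height 1 of the domain. With \<open>l\<close> above 1 / sqrt 3 such a line through the centre
  avoids the lateral sides.\<close>

lemma nu_over_gamma: "\<bar>\<nu>\<bar> / \<gamma> \<le> 1 / sqrt 3"
proof -
  have "\<bar>\<nu>\<bar> * sqrt 3 \<le> 1/2 * sqrt 3" using abs_nu_le by (intro mult_right_mono) auto
  also have "\<dots> \<le> \<gamma>" using gamma_ge by simp
  finally show ?thesis using gamma_pos by (simp add: field_simps)
qed

end

section \<open>Weights along a slice\<close>

text \<open>Length, relative to the longest one, of the horizontal chord at relative height
  \<open>x\<close> in a triangle whose middle vertex has relative height \<open>q\<close>. The cases
  \<open>q = 0\<close> and \<open>q = 1\<close>, which occur for \<phi> = 0, are covered on [0, 1]: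
  the first branch is then empty, or the second is reached only at \<open>x = 1\<close>, where
  division by zero gives 0.\<close>

definition hat :: "real \<Rightarrow> real \<Rightarrow> real" where
  "hat q x = (if x < q then x / q else (1 - x) / (1 - q))"

lemma hat_nonneg: "0 \<le> x \<Longrightarrow> x \<le> 1 \<Longrightarrow> 0 \<le> q \<Longrightarrow> q \<le> 1 \<Longrightarrow> 0 \<le> hat q x"
  by (auto simp: hat_def)

lemma hat_le_1: "0 \<le> x \<Longrightarrow> x \<le> 1 \<Longrightarrow> 0 \<le> q \<Longrightarrow> q \<le> 1 \<Longrightarrow> hat q x \<le> 1"
  by (auto simp: hat_def divide_le_eq_1)

lemma hat_has_integral:
  assumes "0 \<le> q" "q \<le> 1"
  shows "(hat q has_integral 1/2) {0..1}"
proof -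
  have a: "(hat q has_integral q/2) {0..q}"
  proof (cases "q = 0")
    case True
    then show ?thesis using has_integral_refl(1)[of "hat q" 0] by simp
  next
    case False
    have "((\<lambda>x. x / q) has_integral (q\<^sup>2 / (2 * q) - 0\<^sup>2 / (2 * q))) {0..q}"
      using assms False
      by (intro fundamental_theorem_of_calculus)
         (auto intro!: derivative_eq_intros simp: has_real_derivative_iff_has_vector_derivative[symmetric])
    then have "((\<lambda>x. x / q) has_integral q / 2) {0..q}"
      using False by (simp add: power2_eq_square)
    then show ?thesis
      by (rule has_integral_spike_finite[of "{q}", rotated 2]) (auto simp: hat_def)
  qed
  have b: "(hat q has_integral (1 - q)/2) {q..1}"
  proof (cases "q = 1")
    case True
    then show ?thesis using has_integral_refl(1)[of "hat q" 1] by simp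
  next
    case False
    have "((\<lambda>x. (1 - x) / (1 - q)) has_integral ((1 - 1\<^sup>2/2) / (1 - q) - (q - q\<^sup>2/2) / (1 - q))) {q..1}"
      using assms False
      by (intro fundamental_theorem_of_calculus)
         (auto intro!: derivative_eq_intros simp: has_real_derivative_iff_has_vector_derivative[symmetric])
    moreover have "(1 - 1\<^sup>2/2) / (1 - q) - (q - q\<^sup>2/2) / (1 - q) = (1 - q) / 2"
      using False by (simp add: power2_eq_square field_simps)
    ultimately have "((\<lambda>x. (1 - x) / (1 - q)) has_integral (1 - q) / 2) {q..1}"
      by (simp only:)
    then show ?thesis
      by (rule has_integral_spike_finite[of "{}", rotated 2]) (auto simp: hat_def)
  qed
  have "(hat q has_integral (q/2 + (1 - q)/2)) {0..1}"
    using has_integral_combine[OF assms a b] .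
  then show ?thesis by (simp add: field_simps)
qed

text \<open>A cell is counted with constant weight if it is broken and with its normalised chord
  length otherwise; both weights integrate to one, so the choice can be made cell by cell.\<close>

definition weight :: "bool \<Rightarrow> real \<Rightarrow> real \<Rightarrow> real" where
  "weight b q x = (if b then 1 else 2 * hat q x)"

definition cutoff :: "bool \<Rightarrow> real \<Rightarrow> real \<Rightarrow> real" where
  "cutoff b q x = (if 0 \<le> x \<and> x < 1 then weight b q x else 0)"

lemma weight_nonneg: "0 \<le> x \<Longrightarrow> x \<le> 1 \<Longrightarrow> 0 \<le> q \<Longrightarrow> q \<le> 1 \<Longrightarrow> 0 \<le> weight b q x"
  by (simp add: weight_def hat_nonneg)

lemma cutoff_nonneg: "0 \<le> q \<Longrightarrow> q \<le> 1 \<Longrightarrow> 0 \<le> cutoff b q x"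
  by (simp add: cutoff_def weight_nonneg)

lemma cutoff_has_integral:
  assumes "0 \<le> q" "q \<le> 1"
  shows "((\<lambda>x. cutoff b q (x - c)) has_integral 1) UNIV"
proof -
  have "(weight b q has_integral 1) {0..1}"
  proof (cases b)
    case True
    then show ?thesis using has_integral_const_real[of "1::real" 0 1] by (simp add: weight_def[abs_def])
  next
    case False
    then show ?thesis
      using has_integral_mult_right[OF hat_has_integral[OF assms], of 2] by (simp add: weight_def[abs_def])
  qed
  then have "((\<lambda>x. weight b q (x - c)) has_integral 1) {c..1 + c}"
    using has_integral_shift_real_ivl[of "weight b q" 1 0 1 "-c"] by simp
  then have "((\<lambda>x. if x \<in> {c..1 + c} then weight b q (x - c) else 0) has_integral 1) UNIV"
    by (simp only: has_integral_restrict_UNIV)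
  then show ?thesis
    by (rule has_integral_spike_finite[of "{1 + c}", rotated 2]) (auto simp: cutoff_def)
qed

text \<open>The support of \<open>cutoff\<close> is half-open, so exactly one integer translate is
  active at \<open>s\<close>. This turns a sum over all cells of a column into the contribution of
  the one cell that a slice meets.\<close>

lemma sum_cutoff_floor:
  fixes E :: "int \<Rightarrow> real" and B :: "int \<Rightarrow> bool"
  assumes "finite K" "\<lfloor>s\<rfloor> \<in> K"
  shows "(\<Sum>k\<in>K. E k * cutoff (B k) q (s - of_int k)) = E \<lfloor>s\<rfloor> * weight (B \<lfloor>s\<rfloor>) q (frac s)"
proof -
  have "(\<Sum>k\<in>K. E k * cutoff (B k) q (s - of_int k)) = (\<Sum>k\<in>K. if \<lfloor>s\<rfloor> = k then E k * weight (B k) q (frac s) else 0)"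
  proof (intro sum.cong refl)
    fix k assume "k \<in> K"
    show "E k * cutoff (B k) q (s - of_int k) = (if \<lfloor>s\<rfloor> = k then E k * weight (B k) q (frac s) else 0)"
    proof (cases "\<lfloor>s\<rfloor> = k")
      case True
      then show ?thesis by (auto simp: cutoff_def frac_def) linarith+
    next
      case False
      then have "\<not> (0 \<le> s - of_int k \<and> s - of_int k < 1)" by linarith
      then show ?thesis using False by (auto simp: cutoff_def)
    qed
  qed
  then show ?thesis using assms by simp
qed

section \<open>The course of a horizontal slice through the lattice cells\<close>

context lattice_angle
begin

definition X :: "int \<Rightarrow> int \<Rightarrow> real" where "X n k = of_int n * cos \<phi> + of_int k * \<nu>"
definition Z :: "int \<Rightarrow> int \<Rightarrow> real" where "Z n k = \<gamma> * (of_int n * \<mu> + of_int k)"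

text \<open>Lengths are in units of the lattice spacing, and \<open>(n, k)\<close> stands for the point \<open>n v\<^sub>1 + k v\<^sub>2\<close>. The
  horizontal line at height \<open>\<gamma> \<sigma>\<close> meets the line \<open>n v\<^sub>1 + s v\<^sub>2\<close> at \<open>s = \<sigma> - n \<mu>\<close>. Between the lines
  with index \<open>n\<close> and \<open>n + 1\<close> it crosses the triangle \<open>(n, k), (n, k+1), (n+1, k)\<close> with \<open>k = row \<sigma> n\<close>, and
  then \<open>(n+1, k), (n+1, k+1), (n, k+1)\<close> with \<open>k = row \<sigma> (n+1)\<close>.\<close>

definition row :: "real \<Rightarrow> int \<Rightarrow> int" where "row \<sigma> n = \<lfloor>\<sigma> - of_int n * \<mu>\<rfloor>"
definition fr :: "real \<Rightarrow> int \<Rightarrow> real" where "fr \<sigma> n = frac (\<sigma> - of_int n * \<mu>)"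

lemma fr_bounds: "0 \<le> fr \<sigma> n" "fr \<sigma> n < 1"
  by (auto simp: fr_def frac_lt_1)

lemma row_eq: "of_int (row \<sigma> n) = \<sigma> - of_int n * \<mu> - fr \<sigma> n"
  by (simp add: row_def fr_def frac_def)

text \<open>From one lattice line to the next the crossing parameter drops by \<open>\<mu>\<close>
  in [0, 1), so the floor drops by at most one. The two cases decide which edge separates the two
  cells crossed in between: (n, k+1)-(n+1, k) if the row stays, (n, k)-(n+1, k) if it drops.\<close>

lemma row_step:
  "fr \<sigma> n \<ge> \<mu> \<Longrightarrow> row \<sigma> (n + 1) = row \<sigma> n \<and> fr \<sigma> (n + 1) = fr \<sigma> n - \<mu>"
  "fr \<sigma> n < \<mu> \<Longrightarrow> row \<sigma> (n + 1) = row \<sigma> n - 1 \<and> fr \<sigma> (n + 1) = fr \<sigma> n - \<mu> + 1"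
proof -
  have s: "\<sigma> - of_int (n + 1) * \<mu> = of_int (row \<sigma> n) + (fr \<sigma> n - \<mu>)"
    unfolding row_eq by (simp add: algebra_simps)
  have f: "\<sigma> - of_int (n + 1) * \<mu> = of_int (row \<sigma> (n + 1)) + fr \<sigma> (n + 1)"
    unfolding row_eq by simp
  have b: "0 \<le> fr \<sigma> n" "fr \<sigma> n < 1" "0 \<le> fr \<sigma> (n+1)" "fr \<sigma> (n+1) < 1"
    by (auto simp: fr_bounds)
  show "row \<sigma> (n + 1) = row \<sigma> n \<and> fr \<sigma> (n + 1) = fr \<sigma> n - \<mu>" if "fr \<sigma> n \<ge> \<mu>"
  proof -
    have "row \<sigma> (n + 1) = row \<sigma> n"
      unfolding row_def[of \<sigma> "n+1"] s using that b mu_nonneg by (intro floor_unique) auto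
    then show ?thesis using s f by simp
  qed
  show "row \<sigma> (n + 1) = row \<sigma> n - 1 \<and> fr \<sigma> (n + 1) = fr \<sigma> n - \<mu> + 1" if "fr \<sigma> n < \<mu>"
  proof -
    have "row \<sigma> (n + 1) = row \<sigma> n - 1"
      unfolding row_def[of \<sigma> "n+1"] s using that b mu_less_1 by (intro floor_unique) auto
    then show ?thesis using s f by simp
  qed
qed

lemma X_row: "X n (row \<sigma> n) = of_int n * \<kappa> + \<sigma> * \<nu> - fr \<sigma> n * \<nu>"
  unfolding X_def row_eq cos_phi_eq by (simp add: algebra_simps)

lemma Z_row: "Z n (row \<sigma> n) = \<gamma> * (\<sigma> - fr \<sigma> n)"
  unfolding Z_def row_eq by (simp add: algebra_simps)

lemma X_shift [simp]:
  "X (n + 1) k = X n k + cos \<phi>" "X n (k + 1) = X n k + \<nu>"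
  "X (1 + n) k = X n k + cos \<phi>" "X n (1 + k) = X n k + \<nu>"
  by (simp_all add: X_def algebra_simps)

lemma Z_shift [simp]:
  "Z (n + 1) k = Z n k + \<gamma> * \<mu>" "Z n (k + 1) = Z n k + \<gamma>"
  "Z (1 + n) k = Z n k + \<gamma> * \<mu>" "Z n (1 + k) = Z n k + \<gamma>"
  by (simp_all add: Z_def algebra_simps)

lemma abs_nu_minus_cos: "\<bar>\<nu> - cos \<phi>\<bar> \<le> 1"
proof -
  have "\<nu> - cos \<phi> = - cos (\<phi> - pi / 3)"
    by (simp add: nu_expand cos_diff cos_60 sin_60)
  then show ?thesis by simp
qed

text \<open>The two chords between consecutive lattice lines fill the horizontal distance
  \<open>\<kappa>\<close> of these lines.\<close>

lemma hat_sum: "hat \<mu> (fr \<sigma> n) + hat (1 - \<mu>) (fr \<sigma> (n + 1)) = 1"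
proof (cases "fr \<sigma> n \<ge> \<mu>")
  case True
  then have s: "fr \<sigma> (n + 1) = fr \<sigma> n - \<mu>" using row_step(1) by blast
  then show ?thesis unfolding hat_def s using True fr_bounds[of \<sigma> n] mu_less_1
    by (simp add: field_simps)
next
  case False
  then have s: "fr \<sigma> (n + 1) = fr \<sigma> n - \<mu> + 1" using row_step(2) by simp
  then show ?thesis unfolding hat_def s using False fr_bounds[of \<sigma> n] mu_less_1
    by (simp add: field_simps)
qed

text \<open>The affine interpolation of \<open>Y\<close> on a cell, differentiated in direction
  \<open>e\<^sub>1\<close>, minus 1. The edges issue from the corner (n, k) for
  \<open>strainU\<close> and end in the corner (n+1, k+1) for \<open>strainD\<close>, so that the
  two formulas are point reflections of each other.\<close>

definition strainU :: "(int \<Rightarrow> int \<Rightarrow> real) \<Rightarrow> int \<Rightarrow> int \<Rightarrow> real" where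
  "strainU Y n k = (Y (n+1) k - Y n k - \<mu> * (Y n (k+1) - Y n k)) / \<kappa> - 1"
definition strainD :: "(int \<Rightarrow> int \<Rightarrow> real) \<Rightarrow> int \<Rightarrow> int \<Rightarrow> real" where
  "strainD Y n k = (Y (n+1) (k+1) - Y n (k+1) - \<mu> * (Y (n+1) (k+1) - Y (n+1) k)) / \<kappa> - 1"

text \<open>Value of the piecewise affine interpolation at the point where the slice meets the
  lattice line with index \<open>n\<close>.\<close>

definition trace :: "(int \<Rightarrow> int \<Rightarrow> real) \<Rightarrow> real \<Rightarrow> int \<Rightarrow> real" where
  "trace Y \<sigma> n = (1 - fr \<sigma> n) * Y n (row \<sigma> n) + fr \<sigma> n * Y n (row \<sigma> n + 1)"

text \<open>Along each of the two chords the interpolation is affine, so its increment is chord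
  length times slope. The cases of \<open>row_step\<close> differ in the edge through which the
  slice passes from one cell to the other.\<close>

lemma trace_step:
  "trace Y \<sigma> (n + 1) - trace Y \<sigma> n
    = \<kappa> * (hat \<mu> (fr \<sigma> n) * (1 + strainU Y n (row \<sigma> n))
         + hat (1 - \<mu>) (fr \<sigma> (n+1)) * (1 + strainD Y n (row \<sigma> (n+1))))"
proof -
  have U: "\<kappa> * (h * (1 + strainU Y n k)) = h * (Y (n+1) k - Y n k - \<mu> * (Y n (k+1) - Y n k))" for h k
    using kappa_pos by (simp add: strainU_def)
  have D: "\<kappa> * (h * (1 + strainD Y n k)) = h * (Y (n+1) (k+1) - Y n (k+1) - \<mu> * (Y (n+1) (k+1) - Y (n+1) k))" for h k
    using kappa_pos by (simp add: strainD_def)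
  show ?thesis
  proof (cases "fr \<sigma> n \<ge> \<mu>")
    case True
    define f k where "f = fr \<sigma> n" and "k = row \<sigma> n"
    have s: "fr \<sigma> (n + 1) = f - \<mu>" "row \<sigma> (n+1) = k" using row_step(1)[OF True] by (auto simp: f_def k_def)
    have h: "hat \<mu> f = (1 - f) / (1 - \<mu>)" "hat (1 - \<mu>) (f - \<mu>) = (f - \<mu>) / (1 - \<mu>)"
      using True fr_bounds[of \<sigma> n] by (auto simp: hat_def f_def)
    have "trace Y \<sigma> (n + 1) - trace Y \<sigma> n = (1 - f + \<mu>) * Y (n+1) k + (f - \<mu>) * Y (n+1) (k+1)
        - ((1 - f) * Y n k + f * Y n (k + 1))"
      unfolding trace_def s f_def[symmetric] k_def[symmetric] by (simp add: algebra_simps)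
    also have "\<dots> = (1 - f) / (1 - \<mu>) * (Y (n+1) k - Y n k - \<mu> * (Y n (k+1) - Y n k))
      + (f - \<mu>) / (1 - \<mu>) * (Y (n+1) (k+1) - Y n (k+1) - \<mu> * (Y (n+1) (k+1) - Y (n+1) k))"
      using mu_less_1 by (simp add: divide_simps) algebra
    finally show ?thesis
      unfolding distrib_left[of \<kappa>] U D s f_def[symmetric] k_def[symmetric] h .
  next
    case False
    then have lt: "fr \<sigma> n < \<mu>" by simp
    define f k where "f = fr \<sigma> n" and "k = row \<sigma> n"
    have s: "fr \<sigma> (n + 1) = f - \<mu> + 1" "row \<sigma> (n+1) = k - 1" using row_step(2)[OF lt] by (auto simp: f_def k_def)
    have mu: "\<mu> > 0" using lt fr_bounds[of \<sigma> n] by simp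
    have h: "hat \<mu> f = f / \<mu>" "hat (1 - \<mu>) (f - \<mu> + 1) = (\<mu> - f) / \<mu>"
      using lt fr_bounds[of \<sigma> n] by (auto simp: hat_def f_def)
    have "trace Y \<sigma> (n + 1) - trace Y \<sigma> n = (\<mu> - f) * Y (n+1) (k-1) + (f - \<mu> + 1) * Y (n+1) k
        - ((1 - f) * Y n k + f * Y n (k + 1))"
      unfolding trace_def s f_def[symmetric] k_def[symmetric] by (simp add: algebra_simps)
    also have "\<dots> = f / \<mu> * (Y (n+1) k - Y n k - \<mu> * (Y n (k+1) - Y n k))
      + (\<mu> - f) / \<mu> * (Y (n+1) k - Y n k - \<mu> * (Y (n+1) k - Y (n+1) (k-1)))"
      using mu by (simp add: divide_simps) algebra
    finally show ?thesis
      unfolding distrib_left[of \<kappa>] U D s f_def[symmetric] k_def[symmetric] h by simp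
  qed
qed

lemma sum_int_telescope:
  fixes g :: "int \<Rightarrow> real"
  assumes "a \<le> b"
  shows "(\<Sum>n\<in>{a..<b}. g (n + 1) - g n) = g b - g a"
  using assms
proof (induction b rule: int_ge_induct)
  case base
  then show ?case by simp
next
  case (step i)
  have "{a..<i + 1} = insert i {a..<i}" using step.hyps by auto
  then show ?case using step by simp
qed

end

section \<open>The slice argument\<close>

text \<open>Here \<open>e u v\<close> stands for half the bond energy of a cell with edges
  \<open>u\<close>, \<open>v\<close>, \<open>v - u\<close>, since a bond is shared by two cells, and
  \<open>F\<close> for the elastic energy of two cells; hence the factor 2 in
  \<open>e_elastic\<close>. A broken cell has to pay the tangent value up to excess strain
  \<open>T\<close> with its own energy alone, so \<open>e_broken\<close> has no such factor.
  \<open>Bc\<close> is the cost of a cell with an edge of horizontal extent at least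
  \<open>R\<close>, and \<open>R_T\<close> ensures that an excess strain above \<open>T\<close>
  forces such edges.\<close>

locale slice_argument = lattice_angle +
  fixes L H \<tau> F A T R Bc :: real and y :: "int \<Rightarrow> int \<Rightarrow> complex"
    and e :: "complex \<Rightarrow> complex \<Rightarrow> real" and br :: "complex \<Rightarrow> complex \<Rightarrow> bool"
  assumes pinned: "\<And>n k. 0 < X n k \<Longrightarrow> X n k < L \<Longrightarrow> 0 < Z n k \<Longrightarrow> Z n k < H
        \<Longrightarrow> X n k \<le> 1 \<or> X n k \<ge> L - 1 \<Longrightarrow> Re (y n k) = (1 + \<tau>) * X n k"
    and tau_nonneg: "0 \<le> \<tau>" and F_nonneg: "0 \<le> F" and A_nonneg: "0 \<le> A"
    and e_nonneg: "\<And>u v. 0 \<le> e u v"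
    and e_broken: "\<And>u v. br u v \<Longrightarrow> F + A * T \<le> e u v"
    and e_elastic: "\<And>u v. \<not> br u v \<Longrightarrow> F + A * (Re (u - of_real \<mu> * v) / \<kappa> - 1 - \<tau>) \<le> 2 * e u v"
    and e_long: "\<And>u v. \<bar>Re u\<bar> \<ge> R \<or> \<bar>Re v\<bar> \<ge> R \<or> \<bar>Re (v - u)\<bar> \<ge> R \<Longrightarrow> br u v \<and> Bc \<le> e u v"
    and R_large: "1 + \<tau> < R" and R_T: "3 * R \<le> \<kappa> * (1 + \<tau> + T)"
begin

definition ins :: "int \<Rightarrow> int \<Rightarrow> bool" where
  "ins n k \<longleftrightarrow> 0 < X n k \<and> X n k < L \<and> 0 < Z n k \<and> Z n k < H"
definition pin :: "int \<Rightarrow> int \<Rightarrow> bool" where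
  "pin n k \<longleftrightarrow> X n k \<le> 1 \<or> X n k \<ge> L - 1"

text \<open>Extending the boundary condition to the lattice points beyond the lateral boundary gives
  every cell that is not contained in the domain exactly the strain \<open>\<tau>\<close>.\<close>

definition Y :: "int \<Rightarrow> int \<Rightarrow> real" where
  "Y n k = (if pin n k then (1 + \<tau>) * X n k else Re (y n k))"

definition insU :: "int \<Rightarrow> int \<Rightarrow> bool" where
  "insU n k \<longleftrightarrow> ins n k \<and> ins n (k+1) \<and> ins (n+1) k"
definition insD :: "int \<Rightarrow> int \<Rightarrow> bool" where
  "insD n k \<longleftrightarrow> ins (n+1) k \<and> ins (n+1) (k+1) \<and> ins n (k+1)"

abbreviation "tU \<equiv> strainU Y"
abbreviation "tD \<equiv> strainD Y"

definition brU :: "int \<Rightarrow> int \<Rightarrow> bool" where "brU n k = br (y (n+1) k - y n k) (y n (k+1) - y n k)"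
definition brD :: "int \<Rightarrow> int \<Rightarrow> bool" where
  "brD n k = br (y (n+1) (k+1) - y n (k+1)) (y (n+1) (k+1) - y (n+1) k)"

definition EU :: "int \<Rightarrow> int \<Rightarrow> real" where
  "EU n k = (if insU n k then e (y (n+1) k - y n k) (y n (k+1) - y n k) else 0)"
definition ED :: "int \<Rightarrow> int \<Rightarrow> real" where
  "ED n k = (if insD n k then e (y (n+1) (k+1) - y n (k+1)) (y (n+1) (k+1) - y (n+1) k) else 0)"

definition cU :: "real \<Rightarrow> int \<Rightarrow> real" where
  "cU \<sigma> n = EU n (row \<sigma> n) * weight (brU n (row \<sigma> n)) \<mu> (fr \<sigma> n)"
definition cD :: "real \<Rightarrow> int \<Rightarrow> real" where
  "cD \<sigma> n = ED n (row \<sigma> (n+1)) * weight (brD n (row \<sigma> (n+1))) (1 - \<mu>) (fr \<sigma> (n+1))"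

lemma Y_ins: "ins n k \<Longrightarrow> Y n k = Re (y n k)"
  using pinned by (auto simp: Y_def ins_def pin_def)

lemma EU_nonneg: "0 \<le> EU n k" and ED_nonneg: "0 \<le> ED n k"
  by (simp_all add: EU_def ED_def e_nonneg)

lemma cU_nonneg: "0 \<le> cU \<sigma> n" and cD_nonneg: "0 \<le> cD \<sigma> n"
  using EU_nonneg ED_nonneg weight_nonneg fr_bounds mu_nonneg mu_less_1
  by (auto simp: cU_def cD_def less_imp_le)

lemma hat_fr: "0 \<le> hat \<mu> (fr \<sigma> n)" "hat \<mu> (fr \<sigma> n) \<le> 1"
  "0 \<le> hat (1 - \<mu>) (fr \<sigma> n)" "hat (1 - \<mu>) (fr \<sigma> n) \<le> 1"
  using hat_nonneg hat_le_1 fr_bounds mu_nonneg mu_less_1 by (auto simp: less_imp_le)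

text \<open>The first coordinates of the vertices differ by at most 1. One vertex beyond a lateral
  side therefore puts all three into the strips where \<open>Y\<close> is prescribed.\<close>

lemma pin_all_U:
  assumes "\<not> insU n k" "0 < Z n k" "Z n (k+1) < H" "0 < Z (n+1) k" "Z (n+1) k < H"
  shows "pin n k" "pin n (k+1)" "pin (n+1) k"
proof -
  have c: "\<bar>cos \<phi>\<bar> \<le> 1" "\<bar>\<nu>\<bar> \<le> 1" "\<bar>\<nu> - cos \<phi>\<bar> \<le> 1" "\<gamma> > 0"
    using abs_nu_le abs_nu_minus_cos gamma_pos by auto
  have "Z n k < H" "0 < Z n (k+1)" using assms c by auto
  then have "X n k \<le> 0 \<or> X n k \<ge> L \<or> X n (k+1) \<le> 0 \<or> X n (k+1) \<ge> L \<or> X (n+1) k \<le> 0 \<or> X (n+1) k \<ge> L"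
    using assms by (auto simp: insU_def ins_def)
  then show "pin n k" "pin n (k+1)" "pin (n+1) k"
    using c unfolding pin_def X_shift by argo+
qed

lemma pin_all_D:
  assumes "\<not> insD n k" "0 < Z (n+1) k" "Z (n+1) (k+1) < H" "0 < Z n (k+1)" "Z n (k+1) < H"
  shows "pin (n+1) k" "pin (n+1) (k+1)" "pin n (k+1)"
proof -
  have c: "\<bar>cos \<phi>\<bar> \<le> 1" "\<bar>\<nu>\<bar> \<le> 1" "\<bar>\<nu> - cos \<phi>\<bar> \<le> 1" "\<gamma> > 0"
    using abs_nu_le abs_nu_minus_cos gamma_pos by auto
  have "Z (n+1) k < H" "0 < Z (n+1) (k+1)" using assms c by auto
  then have "X (n+1) k \<le> 0 \<or> X (n+1) k \<ge> L \<or> X (n+1) (k+1) \<le> 0 \<or> X (n+1) (k+1) \<ge> L \<or> X n (k+1) \<le> 0 \<or> X n (k+1) \<ge> L"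
    using assms by (auto simp: insD_def ins_def)
  then show "pin (n+1) k" "pin (n+1) (k+1)" "pin n (k+1)"
    using c unfolding pin_def X_shift by argo+
qed

lemma strain_pinned_U: "pin n k \<Longrightarrow> pin n (k+1) \<Longrightarrow> pin (n+1) k \<Longrightarrow> tU n k = \<tau>"
  using kappa_pos by (simp add: strainU_def Y_def cos_phi_eq field_simps)

lemma strain_pinned_D: "pin (n+1) k \<Longrightarrow> pin (n+1) (k+1) \<Longrightarrow> pin n (k+1) \<Longrightarrow> tD n k = \<tau>"
  using kappa_pos by (simp add: strainD_def Y_def cos_phi_eq field_simps)

text \<open>With \<open>h\<close> the normalised chord, an unbroken cell carries weight
  \<open>2 * h\<close>, which matches \<open>e_elastic\<close>. A broken cell carries weight 1 and
  covers the tangent value for every chord because \<open>h\<close> is at most 1.\<close>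

lemma contribution:
  assumes "0 \<le> h" "h \<le> 1" "t = Re (u - of_real \<mu> * v) / \<kappa> - 1" "t - \<tau> \<le> T"
  shows "h * (F + A * (t - \<tau>)) \<le> e u v * (if br u v then 1 else 2 * h)"
proof (cases "br u v")
  case True
  have "F + A * (t - \<tau>) \<le> F + A * T" using assms A_nonneg by (simp add: mult_left_mono)
  also have "\<dots> \<le> e u v" using e_broken[OF True] .
  finally have *: "F + A * (t - \<tau>) \<le> e u v" .
  have "h * (F + A * (t - \<tau>)) \<le> h * e u v" using * assms by (simp add: mult_left_mono)
  also have "\<dots> \<le> e u v" using assms e_nonneg[of u v] by (simp add: mult_left_le_one_le)
  finally show ?thesis using True by simp
next
  case False
  then have "h * (F + A * (t - \<tau>)) \<le> h * (2 * e u v)"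
    using e_elastic[OF False] assms by (intro mult_left_mono) auto
  then show ?thesis using False by (simp add: mult.commute mult.left_commute)
qed

lemma strain_ins_U: "insU n k \<Longrightarrow>
    tU n k = Re ((y (n+1) k - y n k) - of_real \<mu> * (y n (k+1) - y n k)) / \<kappa> - 1"
  by (simp add: strainU_def insU_def Y_ins)

lemma strain_ins_D: "insD n k \<Longrightarrow>
    tD n k = Re ((y (n+1) (k+1) - y n (k+1)) - of_real \<mu> * (y (n+1) (k+1) - y (n+1) k)) / \<kappa> - 1"
  by (simp add: strainD_def insD_def Y_ins)

section \<open>Estimates on a single slice\<close>

context
  fixes \<sigma> :: real
  assumes sigma: "1 \<le> \<sigma>" "\<gamma> * (\<sigma> + 1) < H"
begin

text \<open>The slice keeps a distance of at least one row from bottom and top, so a crossed cell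
  outside the domain can only lie beyond a lateral side.\<close>

lemma Z_slice:
  "0 < Z n (row \<sigma> n)" "Z n (row \<sigma> n + 1) < H" "0 < Z (n+1) (row \<sigma> n)" "Z (n+1) (row \<sigma> n) < H"
  "0 < Z n (row \<sigma> (n+1) + 1)" "Z n (row \<sigma> (n+1) + 1) < H"
proof -
  have f: "0 \<le> fr \<sigma> n" "fr \<sigma> n < 1" "0 \<le> fr \<sigma> (n+1)" "fr \<sigma> (n+1) < 1" by (auto simp: fr_bounds)
  have m: "0 \<le> \<mu>" "\<mu> < 1" using mu_nonneg mu_less_1 by auto
  have *: "0 < \<gamma> * s" if "0 < s" for s using gamma_pos that by simp
  have **: "\<gamma> * s < H" if "s \<le> \<sigma> + 1" for s
    using mult_left_mono[OF that, of \<gamma>] gamma_pos sigma by linarith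
  have e: "Z (n+1) (row \<sigma> n) = \<gamma> * (\<sigma> - fr \<sigma> n + \<mu>)" "Z n (row \<sigma> n + 1) = \<gamma> * (\<sigma> - fr \<sigma> n + 1)"
    by (simp_all add: Z_row algebra_simps)
  have e': "Z n (row \<sigma> (n+1) + 1) = \<gamma> * (\<sigma> - fr \<sigma> (n+1) + 1 - \<mu>)"
  proof -
    have "Z (n+1) (row \<sigma> (n+1)) = \<gamma> * (\<sigma> - fr \<sigma> (n+1))" by (rule Z_row)
    then have "Z n (row \<sigma> (n+1)) + \<gamma> * \<mu> = \<gamma> * (\<sigma> - fr \<sigma> (n+1))" by simp
    then show ?thesis by (simp add: algebra_simps)
  qed
  show "0 < Z n (row \<sigma> n)" unfolding Z_row using f sigma by (intro *) auto
  show "Z n (row \<sigma> n + 1) < H" unfolding e using f by (intro **) auto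
  show "0 < Z (n+1) (row \<sigma> n)" unfolding e using f m sigma by (intro *) auto
  show "Z (n+1) (row \<sigma> n) < H" unfolding e using f m by (intro **) auto
  show "0 < Z n (row \<sigma> (n+1) + 1)" unfolding e' using f m sigma by (intro *) auto
  show "Z n (row \<sigma> (n+1) + 1) < H" unfolding e' using f m by (intro **) auto
qed

lemmas pin_slice_U = pin_all_U[OF _ Z_slice(1-4)]
lemmas pin_slice_D = pin_all_D[OF _ Z_slice(1)[of "n + 1" for n] Z_slice(2)[of "n + 1" for n] Z_slice(5,6)]

lemma cU_ge:
  assumes "insU n (row \<sigma> n) \<Longrightarrow> tU n (row \<sigma> n) - \<tau> \<le> T"
  shows "hat \<mu> (fr \<sigma> n) * ((if insU n (row \<sigma> n) then F else 0) + A * (tU n (row \<sigma> n) - \<tau>)) \<le> cU \<sigma> n"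
proof (cases "insU n (row \<sigma> n)")
  case True
  show ?thesis
    using contribution[OF hat_fr(1,2) strain_ins_U[OF True] assms[OF True]] True
    by (simp add: cU_def EU_def brU_def weight_def)
next
  case False
  then have "tU n (row \<sigma> n) = \<tau>" using pin_slice_U strain_pinned_U by blast
  then show ?thesis using False by (simp add: cU_def EU_def)
qed

lemma cD_ge:
  assumes "insD n (row \<sigma> (n+1)) \<Longrightarrow> tD n (row \<sigma> (n+1)) - \<tau> \<le> T"
  shows "hat (1-\<mu>) (fr \<sigma> (n+1)) * ((if insD n (row \<sigma> (n+1)) then F else 0) + A * (tD n (row \<sigma> (n+1)) - \<tau>)) \<le> cD \<sigma> n"
proof (cases "insD n (row \<sigma> (n+1))")
  case True
  show ?thesis
    using contribution[OF hat_fr(3,4) strain_ins_D[OF True] assms[OF True]] True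
    by (simp add: cD_def ED_def brD_def weight_def)
next
  case False
  then have "tD n (row \<sigma> (n+1)) = \<tau>" using pin_slice_D strain_pinned_D by blast
  then show ?thesis using False by (simp add: cD_def ED_def)
qed

text \<open>A cell outside the domain is pinned and has edges of horizontal extent at most 1 +
  \<tau>, which is less than \<open>R\<close>; a long edge therefore puts the cell inside. Being
  broken, it then counts with full weight however short its chord is.\<close>

lemma long_U:
  assumes "\<bar>Y n (row \<sigma> n + 1) - Y n (row \<sigma> n)\<bar> \<ge> R \<or> \<bar>Y (n+1) (row \<sigma> n) - Y n (row \<sigma> n)\<bar> \<ge> R
     \<or> \<bar>Y n (row \<sigma> n + 1) - Y (n+1) (row \<sigma> n)\<bar> \<ge> R"
  shows "insU n (row \<sigma> n)" "Bc \<le> cU \<sigma> n"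
proof -
  define k where "k = row \<sigma> n"
  have c: "\<bar>cos \<phi>\<bar> \<le> 1" "\<bar>\<nu>\<bar> \<le> 1" "\<bar>\<nu> - cos \<phi>\<bar> \<le> 1"
    using abs_nu_le abs_nu_minus_cos by auto
  show i: "insU n (row \<sigma> n)"
  proof (rule ccontr)
    assume "\<not> insU n (row \<sigma> n)"
    then have p: "pin n k" "pin n (k+1)" "pin (n+1) k" using pin_slice_U by (auto simp: k_def)
    have *: "\<bar>(1 + \<tau>) * s\<bar> < R" if "\<bar>s\<bar> \<le> 1" for s
    proof -
      have "(1 + \<tau>) * \<bar>s\<bar> \<le> (1 + \<tau>) * 1" using that tau_nonneg by (intro mult_left_mono) auto
      also have "\<dots> < R" using R_large by simp
      finally show ?thesis using tau_nonneg by (simp add: abs_mult)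
    qed
    have "Y n (k+1) - Y n k = (1 + \<tau>) * \<nu>" "Y (n+1) k - Y n k = (1 + \<tau>) * cos \<phi>"
      "Y n (k+1) - Y (n+1) k = (1 + \<tau>) * (\<nu> - cos \<phi>)"
      using p by (auto simp: Y_def algebra_simps)
    then show False using assms *[OF c(1)] *[OF c(2)] *[OF c(3)] unfolding k_def[symmetric] by auto
  qed
  have "br (y (n+1) k - y n k) (y n (k+1) - y n k) \<and> Bc \<le> e (y (n+1) k - y n k) (y n (k+1) - y n k)"
    using assms i unfolding k_def[symmetric] by (intro e_long) (auto simp: insU_def Y_ins)
  then show "Bc \<le> cU \<sigma> n" using i
    by (auto simp: cU_def EU_def brU_def weight_def k_def[symmetric])
qed

lemma long_D:
  assumes "\<bar>Y (n+1) (row \<sigma> (n+1) + 1) - Y (n+1) (row \<sigma> (n+1))\<bar> \<ge> R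
     \<or> \<bar>Y (n+1) (row \<sigma> (n+1) + 1) - Y n (row \<sigma> (n+1) + 1)\<bar> \<ge> R
     \<or> \<bar>Y n (row \<sigma> (n+1) + 1) - Y (n+1) (row \<sigma> (n+1))\<bar> \<ge> R"
  shows "insD n (row \<sigma> (n+1))" "Bc \<le> cD \<sigma> n"
proof -
  define k where "k = row \<sigma> (n+1)"
  have c: "\<bar>cos \<phi>\<bar> \<le> 1" "\<bar>\<nu>\<bar> \<le> 1" "\<bar>\<nu> - cos \<phi>\<bar> \<le> 1"
    using abs_nu_le abs_nu_minus_cos by auto
  show i: "insD n (row \<sigma> (n+1))"
  proof (rule ccontr)
    assume "\<not> insD n (row \<sigma> (n+1))"
    then have p: "pin (n+1) k" "pin (n+1) (k+1)" "pin n (k+1)" using pin_slice_D by (auto simp: k_def)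
    have *: "\<bar>(1 + \<tau>) * s\<bar> < R" if "\<bar>s\<bar> \<le> 1" for s
    proof -
      have "(1 + \<tau>) * \<bar>s\<bar> \<le> (1 + \<tau>) * 1" using that tau_nonneg by (intro mult_left_mono) auto
      also have "\<dots> < R" using R_large by simp
      finally show ?thesis using tau_nonneg by (simp add: abs_mult)
    qed
    have "Y (n+1) (k+1) - Y (n+1) k = (1 + \<tau>) * \<nu>" "Y (n+1) (k+1) - Y n (k+1) = (1 + \<tau>) * cos \<phi>"
      "Y n (k+1) - Y (n+1) k = (1 + \<tau>) * (\<nu> - cos \<phi>)"
      using p by (auto simp: Y_def algebra_simps)
    then show False using assms *[OF c(1)] *[OF c(2)] *[OF c(3)] unfolding k_def[symmetric] by auto
  qed
  have "br (y (n+1) (k+1) - y n (k+1)) (y (n+1) (k+1) - y (n+1) k)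
      \<and> Bc \<le> e (y (n+1) (k+1) - y n (k+1)) (y (n+1) (k+1) - y (n+1) k)"
    using assms i unfolding k_def[symmetric] by (intro e_long) (auto simp: insD_def Y_ins)
  then show "Bc \<le> cD \<sigma> n" using i
    by (auto simp: cD_def ED_def brD_def weight_def k_def[symmetric])
qed

text \<open>The differences \<open>c - a\<close> and \<open>b - a\<close> together exceed
  \<open>3 * R\<close> in modulus, so one is at least \<open>R\<close>; and if \<open>b - a\<close>
  is shorter than \<open>R\<close>, then \<open>c - a\<close> exceeds \<open>2 * R\<close> and
  \<open>b - c\<close> exceeds \<open>R\<close>. Two versions are needed because the slice may cross
  either pair of edges.\<close>

lemma two_of_three_long:
  fixes a b c :: real
  assumes "t = (c - a - \<mu> * (b - a)) / \<kappa> - 1" "t - \<tau> > T"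
  shows "\<bar>b - a\<bar> \<ge> R \<or> \<bar>c - a\<bar> \<ge> R" "\<bar>b - a\<bar> \<ge> R \<or> \<bar>b - c\<bar> \<ge> R"
proof -
  have "3 * R < c - a - \<mu> * (b - a)"
  proof -
    have "\<kappa> * (1 + \<tau> + T) < \<kappa> * (1 + t)" using assms kappa_pos by (intro mult_strict_left_mono) auto
    also have "\<kappa> * (1 + t) = c - a - \<mu> * (b - a)" using assms kappa_pos by simp
    finally show ?thesis using R_T by linarith
  qed
  moreover have "\<bar>\<mu> * (b - a)\<bar> \<le> \<bar>b - a\<bar>" 
    using mu_nonneg mu_less_1 by (simp add: abs_mult mult_left_le_one_le)
  ultimately have "3 * R < \<bar>c - a\<bar> + \<bar>b - a\<bar>" by linarith
  then show "\<bar>b - a\<bar> \<ge> R \<or> \<bar>c - a\<bar> \<ge> R" "\<bar>b - a\<bar> \<ge> R \<or> \<bar>b - c\<bar> \<ge> R"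
    using R_large tau_nonneg by linarith+
qed

text \<open>A long edge crossed by the slice belongs to two cells of the slice, and each of them
  then has two long edges.\<close>

lemma crack_pair:
  assumes "tU n (row \<sigma> n) - \<tau> > T \<or> tD n (row \<sigma> (n+1)) - \<tau> > T"
  shows "\<exists>m j. insU m (row \<sigma> m) \<and> insD j (row \<sigma> (j+1)) \<and> Bc \<le> cU \<sigma> m \<and> Bc \<le> cD \<sigma> j"
proof -
  \<comment> \<open>The crossed edge on line \<open>m\<close> bounds the U cell to its right and the
    D cell to its left; the latter carries the index \<open>m - 1\<close>.\<close>
  have rowedge: "\<exists>m j. insU m (row \<sigma> m) \<and> insD j (row \<sigma> (j+1)) \<and> Bc \<le> cU \<sigma> m \<and> Bc \<le> cD \<sigma> j"
    if "\<bar>Y m (row \<sigma> m + 1) - Y m (row \<sigma> m)\<bar> \<ge> R" for m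
    using long_U[of m] long_D[of "m - 1"] that by (intro exI[of _ m] exI[of _ "m - 1"]) auto
  have midedge: "\<exists>m j. insU m (row \<sigma> m) \<and> insD j (row \<sigma> (j+1)) \<and> Bc \<le> cU \<sigma> m \<and> Bc \<le> cD \<sigma> j"
    if "insU n (row \<sigma> n)" "insD n (row \<sigma> (n+1))" "Bc \<le> cU \<sigma> n" "Bc \<le> cD \<sigma> n"
    using that by blast
  show ?thesis
  proof (cases "fr \<sigma> n \<ge> \<mu>")
    case True
    define k where "k = row \<sigma> n"
    have k': "row \<sigma> (n+1) = k" using row_step(1)[OF True] by (simp add: k_def)
    \<comment> \<open>These are exactly the edges crossed when the row does not change. The D cell
      is reduced to the U cell by negating all values.\<close>
    have "\<bar>Y n (k + 1) - Y n k\<bar> \<ge> R \<or> \<bar>Y n (k + 1) - Y (n+1) k\<bar> \<ge> R \<or> \<bar>Y (n+1) (k+1) - Y (n+1) k\<bar> \<ge> R"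
      using assms
    proof
      assume "T < tU n (row \<sigma> n) - \<tau>"
      then show ?thesis using two_of_three_long(2)[of "tU n k" "Y (n+1) k" "Y n k" "Y n (k+1)"]
        by (auto simp: strainU_def k_def)
    next
      assume "T < tD n (row \<sigma> (n+1)) - \<tau>"
      then show ?thesis
        using two_of_three_long(2)[of "tD n k" "- Y n (k+1)" "- Y (n+1) (k+1)" "- Y (n+1) k"]
        by (auto simp: strainD_def k')
    qed
    then show ?thesis
      using rowedge[of n] rowedge[of "n+1"] long_U[of n] long_D[of n] midedge
      unfolding k' k_def[symmetric] by blast
  next
    case False
    then have lt: "fr \<sigma> n < \<mu>" by simp
    define k where "k = row \<sigma> n"
    have k': "row \<sigma> (n+1) = k - 1" using row_step(2)[OF lt] by (simp add: k_def)
    have "\<bar>Y n (k + 1) - Y n k\<bar> \<ge> R \<or> \<bar>Y (n+1) k - Y n k\<bar> \<ge> R \<or> \<bar>Y (n+1) k - Y (n+1) (k-1)\<bar> \<ge> R"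
      using assms
    proof
      assume "T < tU n (row \<sigma> n) - \<tau>"
      then show ?thesis using two_of_three_long(1)[of "tU n k" "Y (n+1) k" "Y n k" "Y n (k+1)"]
        by (auto simp: strainU_def k_def)
    next
      assume "T < tD n (row \<sigma> (n+1)) - \<tau>"
      then show ?thesis
        using two_of_three_long(1)[of "tD n (k-1)" "- Y n k" "- Y (n+1) k" "- Y (n+1) (k-1)"]
        by (auto simp: strainD_def k')
    qed
    then show ?thesis
      using rowedge[of n] rowedge[of "n+1"] long_U[of n] long_D[of n] midedge
      unfolding k' k_def[symmetric] by auto
  qed
qed

lemma insU_bounded:
  assumes "0 \<le> L" "L + \<bar>\<sigma> * \<nu>\<bar> + 3 \<le> of_int N * \<kappa>" "ins n (row \<sigma> n)"
  shows "- N < n" "n < N"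
proof -
  have "\<bar>fr \<sigma> n * \<nu>\<bar> \<le> 1 * 1"
    unfolding abs_mult using fr_bounds[of \<sigma> n] abs_nu_le by (intro mult_mono) auto
  then have "\<bar>of_int n * \<kappa>\<bar> < of_int N * \<kappa>"
    using assms unfolding ins_def X_row by linarith
  then have "\<bar>of_int n\<bar> < (of_int N :: real)" using kappa_pos by (simp add: abs_mult)
  then show "- N < n" "n < N" by linarith+
qed

lemma trace_pinned:
  assumes "\<bar>of_int n * \<kappa>\<bar> \<ge> L + \<bar>\<sigma> * \<nu>\<bar> + 3" "0 \<le> L"
  shows "trace Y \<sigma> n = (1 + \<tau>) * (of_int n * \<kappa> + \<sigma> * \<nu>)"
proof -
  have "\<bar>fr \<sigma> n * \<nu>\<bar> \<le> 1 * (1/2)"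
    unfolding abs_mult using fr_bounds[of \<sigma> n] abs_nu_le by (intro mult_mono) auto
  then have "pin n (row \<sigma> n)" "pin n (row \<sigma> n + 1)"
    using assms abs_nu_le unfolding pin_def X_shift X_row by linarith+
  then show ?thesis unfolding trace_def Y_def X_shift X_row by (simp add: algebra_simps)
qed

text \<open>The increments of \<open>trace\<close> telescope to the imposed displacement (1 +
  \<tau>) 2 N \<kappa> between two lines in the pinned region, and by \<open>hat_sum\<close> the
  weights of each pair of cells add up to 1. Hence the weighted mean strain is \<tau>, whatever
  happens in between.\<close>

lemma strain_balance:
  assumes "0 \<le> L" "L + \<bar>\<sigma> * \<nu>\<bar> + 3 \<le> of_int N * \<kappa>"
  shows "(\<Sum>n\<in>{-N..<N}. hat \<mu> (fr \<sigma> n) * (tU n (row \<sigma> n) - \<tau>)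
     + hat (1 - \<mu>) (fr \<sigma> (n+1)) * (tD n (row \<sigma> (n+1)) - \<tau>)) = 0"
proof -
  let ?a = "\<lambda>n. hat \<mu> (fr \<sigma> n)" and ?b = "\<lambda>n. hat (1 - \<mu>) (fr \<sigma> (n+1))"
  have "0 \<le> of_int N * \<kappa>" using assms by linarith
  then have N: "0 \<le> N" using kappa_pos by (simp add: zero_le_mult_iff)
  have "(\<Sum>n\<in>{-N..<N}. trace Y \<sigma> (n+1) - trace Y \<sigma> n) = trace Y \<sigma> N - trace Y \<sigma> (-N)"
    using N by (intro sum_int_telescope) auto
  also have "\<dots> = (1 + \<tau>) * (of_int (2 * N) * \<kappa>)"
    using assms trace_pinned[of N] trace_pinned[of "-N"] by (simp add: algebra_simps)
  finally have 1: "(\<Sum>n\<in>{-N..<N}. trace Y \<sigma> (n+1) - trace Y \<sigma> n) = (1 + \<tau>) * (of_int (2 * N) * \<kappa>)" .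
  have "\<kappa> * (\<Sum>n\<in>{-N..<N}. ?a n * (tU n (row \<sigma> n) - \<tau>) + ?b n * (tD n (row \<sigma> (n+1)) - \<tau>))
    = (\<Sum>n\<in>{-N..<N}. (trace Y \<sigma> (n+1) - trace Y \<sigma> n) - \<kappa> * (1 + \<tau>))"
    unfolding sum_distrib_left
  proof (intro sum.cong refl)
    fix n
    have "\<kappa> * (?a n * (tU n (row \<sigma> n) - \<tau>) + ?b n * (tD n (row \<sigma> (n+1)) - \<tau>))
      = \<kappa> * (?a n * (1 + tU n (row \<sigma> n)) + ?b n * (1 + tD n (row \<sigma> (n+1)))) - \<kappa> * (1 + \<tau>) * (?a n + ?b n)"
      by (simp add: algebra_simps)
    then show "\<kappa> * (?a n * (tU n (row \<sigma> n) - \<tau>) + ?b n * (tD n (row \<sigma> (n+1)) - \<tau>))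
      = (trace Y \<sigma> (n+1) - trace Y \<sigma> n) - \<kappa> * (1 + \<tau>)"
      unfolding trace_step hat_sum by simp
  qed
  also have "\<dots> = (\<Sum>n\<in>{-N..<N}. trace Y \<sigma> (n+1) - trace Y \<sigma> n) - (\<Sum>n\<in>{-N..<N}. \<kappa> * (1 + \<tau>))"
    by (rule sum_subtractf)
  also have "\<dots> = 0"
    unfolding 1 using N by (simp add: algebra_simps)
  finally show ?thesis using kappa_pos by simp
qed

lemma good_cells:
  assumes "3 \<le> of_int n * \<kappa> + \<sigma> * \<nu>" "of_int n * \<kappa> + \<sigma> * \<nu> \<le> L - 3"
  shows "insU n (row \<sigma> n)" "insD n (row \<sigma> (n+1))"
proof -
  have 1: "\<bar>fr \<sigma> m * \<nu>\<bar> \<le> 1 * (1/2)" for m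
    unfolding abs_mult using fr_bounds[of \<sigma> m] abs_nu_le by (intro mult_mono) auto
  have c: "\<bar>cos \<phi>\<bar> \<le> 1" "\<bar>\<nu>\<bar> \<le> 1/2" "\<bar>\<nu> - cos \<phi>\<bar> \<le> 1"
    using abs_nu_le abs_nu_minus_cos by auto
  have g: "\<gamma> > 0" "\<gamma> * \<mu> \<ge> 0" using gamma_pos mu_nonneg by auto
  show "insU n (row \<sigma> n)"
    using 1[of n] c assms Z_slice[of n] g unfolding insU_def ins_def X_shift(1,2) Z_shift(1,2) X_row
    by (simp; linarith)
  have "X (n+1) (row \<sigma> (n+1)) = of_int n * \<kappa> + \<kappa> + \<sigma> * \<nu> - fr \<sigma> (n+1) * \<nu>"
    unfolding X_row by (simp add: algebra_simps)
  then have x: "X n (row \<sigma> (n+1)) = of_int n * \<kappa> + \<kappa> + \<sigma> * \<nu> - fr \<sigma> (n+1) * \<nu> - cos \<phi>"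
    by simp
  show "insD n (row \<sigma> (n+1))"
    using 1[of "n+1"] c assms Z_slice[of n] Z_slice[of "n+1"] g kappa_pos kappa_le_1
    unfolding insD_def ins_def X_shift(1,2) Z_shift(1,2) x
    by (simp; linarith)
qed

text \<open>If no strain is excessive, every cell pays its tangent value; the linear parts cancel by
  \<open>strain_balance\<close>, where cells outside contribute zero, and the multiples of
  \<open>F\<close> remain. They are counted on the lines at distance at least 3 from the lateral
  sides, whose cells are inside by \<open>good_cells\<close>.\<close>

lemma slice_lower_bound:
  assumes "0 \<le> L" "L + \<bar>\<sigma> * \<nu>\<bar> + 3 \<le> of_int N * \<kappa>"
  shows "min (F * ((L - 6) / \<kappa> - 1)) (2 * Bc) \<le> (\<Sum>n\<in>{-N..<N}. cU \<sigma> n + cD \<sigma> n)"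
proof (cases "\<exists>n. tU n (row \<sigma> n) - \<tau> > T \<or> tD n (row \<sigma> (n+1)) - \<tau> > T")
  case True
  then obtain m j where mj: "insU m (row \<sigma> m)" "insD j (row \<sigma> (j+1))" "Bc \<le> cU \<sigma> m" "Bc \<le> cD \<sigma> j"
    using crack_pair by blast
  have m: "m \<in> {-N..<N}" using insU_bounded[OF assms, of m] mj(1) by (auto simp: insU_def)
  have j: "j \<in> {-N..<N}" using insU_bounded[OF assms, of "j+1"] mj(2) by (auto simp: insD_def)
  have "Bc \<le> (\<Sum>n\<in>{-N..<N}. cU \<sigma> n)"
    using mj(3) member_le_sum[OF m, of "cU \<sigma>"] cU_nonneg by force
  moreover have "Bc \<le> (\<Sum>n\<in>{-N..<N}. cD \<sigma> n)"
    using mj(4) member_le_sum[OF j, of "cD \<sigma>"] cD_nonneg by force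
  ultimately show ?thesis by (simp add: sum.distrib)
next
  case False
  let ?a = "\<lambda>n. hat \<mu> (fr \<sigma> n)" and ?b = "\<lambda>n. hat (1 - \<mu>) (fr \<sigma> (n+1))"
  let ?f = "\<lambda>n. ?a n * (if insU n (row \<sigma> n) then F else 0) + ?b n * (if insD n (row \<sigma> (n+1)) then F else 0)"
  define u v where "u = (3 - \<sigma> * \<nu>) / \<kappa>" and "v = (L - 3 - \<sigma> * \<nu>) / \<kappa>"
  define G where "G = {\<lceil>u\<rceil>..\<lfloor>v\<rfloor>}"
  have G: "insU n (row \<sigma> n)" "insD n (row \<sigma> (n+1))" if "n \<in> G" for n
  proof -
    have "u \<le> of_int n" "of_int n \<le> v" using that unfolding G_def by (auto simp: ceiling_le_iff le_floor_iff)
    then have "3 - \<sigma> * \<nu> \<le> of_int n * \<kappa>" "of_int n * \<kappa> \<le> L - 3 - \<sigma> * \<nu>"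
      using kappa_pos by (auto simp: u_def v_def field_simps)
    then show "insU n (row \<sigma> n)" "insD n (row \<sigma> (n+1))" by (auto intro!: good_cells)
  qed
  have GN: "G \<subseteq> {-N..<N}" using insU_bounded[OF assms] G(1) by (force simp: insU_def)
  have cardG: "real (card G) \<ge> (L - 6) / \<kappa> - 1"
  proof -
    have "(L - 6) / \<kappa> = v - u" by (simp add: u_def v_def diff_divide_distrib)
    then show ?thesis unfolding G_def by (simp; linarith)
  qed
  have "F * ((L - 6) / \<kappa> - 1) \<le> F * real (card G)"
    using cardG F_nonneg by (rule mult_left_mono)
  also have "\<dots> = (\<Sum>n\<in>G. ?f n)"
  proof -
    have "?f n = F" if "n \<in> G" for n
      using G[OF that] hat_sum[of \<sigma> n] by (simp add: distrib_right[symmetric])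
    then show ?thesis by simp
  qed
  also have "\<dots> \<le> (\<Sum>n\<in>{-N..<N}. ?f n)"
    using GN hat_fr F_nonneg by (intro sum_mono2) auto
  also have "\<dots> = (\<Sum>n\<in>{-N..<N}. ?f n) + A * (\<Sum>n\<in>{-N..<N}. ?a n * (tU n (row \<sigma> n) - \<tau>) + ?b n * (tD n (row \<sigma> (n+1)) - \<tau>))"
    unfolding strain_balance[OF assms] by simp
  also have "\<dots> = (\<Sum>n\<in>{-N..<N}. ?a n * ((if insU n (row \<sigma> n) then F else 0) + A * (tU n (row \<sigma> n) - \<tau>))
      + ?b n * ((if insD n (row \<sigma> (n+1)) then F else 0) + A * (tD n (row \<sigma> (n+1)) - \<tau>)))"
    unfolding sum_distrib_left sum.distrib[symmetric] by (intro sum.cong refl) (simp add: algebra_simps)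
  also have "\<dots> \<le> (\<Sum>n\<in>{-N..<N}. cU \<sigma> n + cD \<sigma> n)"
    using False by (intro sum_mono add_mono cU_ge cD_ge) (auto simp: not_less)
  finally show ?thesis by simp
qed

end

lemma cell_sum_lower_bound:
  assumes "0 \<le> L" "3 \<le> H / \<gamma>"
  shows "\<exists>I J. finite I \<and> finite J \<and>
    (H / \<gamma> - 3) * min (F * ((L - 6) / \<kappa> - 1)) (2 * Bc) \<le> (\<Sum>n\<in>I. \<Sum>k\<in>J. EU n k + ED n k)"
proof -
  define m where "m = min (F * ((L - 6) / \<kappa> - 1)) (2 * Bc)"
  define N where "N = \<lceil>(L + H / \<gamma> + 3) / \<kappa>\<rceil>"
  define K where "K = \<lceil>H / \<gamma>\<rceil> + N + 2"
  have "(L + H / \<gamma> + 3) / \<kappa> \<le> of_int N" unfolding N_def by simp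
  then have N: "L + H / \<gamma> + 3 \<le> of_int N * \<kappa>" using kappa_pos by (simp add: field_simps)
  have "(L + H / \<gamma> + 3) / \<kappa> \<ge> 0" using assms kappa_pos by simp
  then have N0: "N \<ge> 0" unfolding N_def by simp
  let ?U = "\<lambda>n k \<sigma>. EU n k * cutoff (brU n k) \<mu> (\<sigma> - (of_int n * \<mu> + of_int k))"
  let ?D = "\<lambda>n k \<sigma>. ED n k * cutoff (brD n k) (1 - \<mu>) (\<sigma> - (of_int (n+1) * \<mu> + of_int k))"
  let ?S = "\<lambda>\<sigma>. \<Sum>n\<in>{-N..<N}. \<Sum>k\<in>{-K..K}. ?U n k \<sigma> + ?D n k \<sigma>"
  have I: "(?S has_integral (\<Sum>n\<in>{-N..<N}. \<Sum>k\<in>{-K..K}. EU n k * 1 + ED n k * 1)) UNIV"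
    using mu_nonneg mu_less_1
    by (intro has_integral_sum has_integral_add has_integral_mult_right cutoff_has_integral) auto
  have "((\<lambda>\<sigma>. m) has_integral (H / \<gamma> - 2 - 1) * m) {1..H / \<gamma> - 2}"
    using assms has_integral_const_real[of m 1 "H / \<gamma> - 2"] by simp
  then have M: "((\<lambda>\<sigma>. if \<sigma> \<in> {1..H / \<gamma> - 2} then m else 0) has_integral (H / \<gamma> - 2 - 1) * m) UNIV"
    by (simp only: has_integral_restrict_UNIV)
  have "(H / \<gamma> - 2 - 1) * m \<le> (\<Sum>n\<in>{-N..<N}. \<Sum>k\<in>{-K..K}. EU n k * 1 + ED n k * 1)"
  proof (rule has_integral_le[OF M I])
    fix \<sigma> :: real
    show "(if \<sigma> \<in> {1..H / \<gamma> - 2} then m else 0) \<le> ?S \<sigma>"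
    proof (cases "\<sigma> \<in> {1..H / \<gamma> - 2}")
      case False
      have "0 \<le> ?S \<sigma>"
        using EU_nonneg ED_nonneg cutoff_nonneg mu_nonneg mu_less_1
        by (intro sum_nonneg add_nonneg_nonneg mult_nonneg_nonneg) auto
      then show ?thesis using False by auto
    next
      case True
      have "\<sigma> + 1 < H / \<gamma>" using True by auto
      then have s: "1 \<le> \<sigma>" "\<gamma> * (\<sigma> + 1) < H" using True gamma_pos by (auto simp: field_simps)
      have "\<bar>\<sigma> * \<nu>\<bar> \<le> \<sigma> * 1" unfolding abs_mult using s abs_nu_le by (intro mult_mono) auto
      then have LN: "L + \<bar>\<sigma> * \<nu>\<bar> + 3 \<le> of_int N * \<kappa>" using N True by auto
      have row: "row \<sigma> n \<in> {-K..K}" if "n \<in> {-N..N}" for n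
      proof -
        have "\<bar>of_int n * \<mu>\<bar> \<le> of_int N * 1"
          unfolding abs_mult using that mu_nonneg mu_less_1 N0 by (intro mult_mono) auto
        moreover have "of_int (row \<sigma> n) = \<sigma> - of_int n * \<mu> - fr \<sigma> n" by (rule row_eq)
        moreover have "H / \<gamma> \<le> of_int \<lceil>H / \<gamma>\<rceil>" by simp
        ultimately have "\<bar>of_int (row \<sigma> n)\<bar> \<le> (of_int K :: real)"
          using fr_bounds[of \<sigma> n] True unfolding K_def atLeastAtMost_iff of_int_add of_int_numeral by linarith
        then show ?thesis by auto
      qed
      have "?S \<sigma> = (\<Sum>n\<in>{-N..<N}. cU \<sigma> n + cD \<sigma> n)"
      proof (intro sum.cong refl)
        fix n assume n: "n \<in> {-N..<N}"
        have "(\<Sum>k\<in>{-K..K}. ?U n k \<sigma>) = cU \<sigma> n"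
          using sum_cutoff_floor[of "{-K..K}" "\<sigma> - of_int n * \<mu>" "EU n" "brU n" \<mu>] row[of n] n
          unfolding cU_def row_def fr_def by (simp add: diff_diff_eq)
        moreover have "(\<Sum>k\<in>{-K..K}. ?D n k \<sigma>) = cD \<sigma> n"
          using sum_cutoff_floor[of "{-K..K}" "\<sigma> - of_int (n+1) * \<mu>" "ED n" "brD n" "1 - \<mu>"] row[of "n+1"] n
          unfolding cD_def row_def fr_def by (simp add: diff_diff_eq)
        ultimately show "(\<Sum>k\<in>{-K..K}. ?U n k \<sigma> + ?D n k \<sigma>) = cU \<sigma> n + cD \<sigma> n"
          by (simp add: sum.distrib)
      qed
      then show ?thesis
        using slice_lower_bound[OF s assms(1) LN] True by (simp add: m_def)
    qed
  qed
  then show ?thesis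
    by (intro exI[of _ "{-N..<N}"] exI[of _ "{-K..K}"]) (simp add: m_def)
qed

end

section \<open>Bonds and lattice sites\<close>

text \<open>Bonds of the triangular lattice in the basis \<open>v\<^sub>1, v\<^sub>2\<close>, one vector from each pair of
  opposite ones.\<close>

definition bond_dirs :: "(int \<times> int) set" where "bond_dirs = {(1, 0), (0, 1), (-1, 1)}"

lemma finite_bond_dirs [simp]: "finite bond_dirs"
  by (simp add: bond_dirs_def)

text \<open>Four times the quadratic form is (2 m + n)^2 + 3 n^2, and likewise with the roles
  exchanged, which confines both integers to -1, 0, 1.\<close>

lemma unit_vectors:
  "(m::int)\<^sup>2 + m * n + n\<^sup>2 = 1 \<longleftrightarrow> (m, n) \<in> bond_dirs \<union> uminus ` bond_dirs"
proof
  assume h: "m\<^sup>2 + m * n + n\<^sup>2 = 1"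
  have nn: "3 * s \<le> 4" if "q + 3 * s = 4" "0 \<le> q" for q s :: int using that by linarith
  have "(2 * m + n)\<^sup>2 + 3 * n\<^sup>2 = 4 * (m\<^sup>2 + m * n + n\<^sup>2)" by (simp add: power2_eq_square algebra_simps)
  then have "3 * n\<^sup>2 \<le> 4" unfolding h by (intro nn) auto
  then have n: "\<bar>n\<bar> \<le> 1" using abs_square_le_1[of n] by simp
  have "(2 * n + m)\<^sup>2 + 3 * m\<^sup>2 = 4 * (m\<^sup>2 + m * n + n\<^sup>2)" by (simp add: power2_eq_square algebra_simps)
  then have "3 * m\<^sup>2 \<le> 4" unfolding h by (intro nn) auto
  then have m: "\<bar>m\<bar> \<le> 1" using abs_square_le_1[of m] by simp
  have "m = -1 \<or> m = 0 \<or> m = 1" "n = -1 \<or> n = 0 \<or> n = 1" using m n by linarith+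
  then show "(m, n) \<in> bond_dirs \<union> uminus ` bond_dirs" using h by (auto simp: bond_dirs_def)
next
  assume "(m, n) \<in> bond_dirs \<union> uminus ` bond_dirs"
  then show "m\<^sup>2 + m * n + n\<^sup>2 = 1" by (auto simp: bond_dirs_def)
qed

lemma sum_unoriented_bonds:
  fixes f :: "int \<times> int \<Rightarrow> int \<times> int \<Rightarrow> real"
  assumes I: "finite I" and sym: "\<And>p q. f p q = f q p"
  shows "(\<Sum>p\<in>I. \<Sum>q\<in>I. if q - p \<in> bond_dirs \<union> uminus ` bond_dirs then f p q else 0)
    = 2 * (\<Sum>p\<in>I. \<Sum>u\<in>bond_dirs. if p + u \<in> I then f p (p + u) else 0)"
proof -
  let ?S = "bond_dirs \<union> uminus ` bond_dirs"
  have inner: "(\<Sum>q\<in>I. if q - p \<in> ?S then f p q else 0) = (\<Sum>u\<in>?S. if p + u \<in> I then f p (p + u) else 0)" for p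
  proof -
    have "(\<Sum>q\<in>I. if q - p \<in> ?S then f p q else 0) = (\<Sum>q\<in>I \<inter> {q. q - p \<in> ?S}. f p q)"
      using I by (simp add: sum.inter_restrict)
    also have "\<dots> = (\<Sum>u\<in>?S \<inter> {u. p + u \<in> I}. f p (p + u))"
      by (rule sum.reindex_bij_witness[of _ "\<lambda>u. p + u" "\<lambda>q. q - p"]) auto
    also have "\<dots> = (\<Sum>u\<in>?S. if p + u \<in> I then f p (p + u) else 0)"
      by (subst sum.inter_restrict) auto
    finally show ?thesis .
  qed
  have disj: "bond_dirs \<inter> uminus ` bond_dirs = {}" by (auto simp: bond_dirs_def)
  have split: "(\<Sum>u\<in>?S. g u) = (\<Sum>u\<in>bond_dirs. g u) + (\<Sum>u\<in>bond_dirs. g (- u))" for g :: "int \<times> int \<Rightarrow> real"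
    using disj by (subst sum.union_disjoint) (auto simp: sum.reindex)
  have opp: "(\<Sum>p\<in>I. if p + - u \<in> I then f p (p + - u) else 0) = (\<Sum>p\<in>I. if p + u \<in> I then f p (p + u) else 0)" for u
  proof -
    have "(\<Sum>p\<in>I. if p + - u \<in> I then f p (p + - u) else 0) = (\<Sum>p\<in>I \<inter> {p. p + - u \<in> I}. f p (p + - u))"
      by (subst sum.inter_restrict[OF I]) simp
    also have "\<dots> = (\<Sum>p\<in>I \<inter> {p. p + u \<in> I}. f p (p + u))"
      by (rule sum.reindex_bij_witness[of _ "\<lambda>p. p + u" "\<lambda>p. p + - u"]) (auto simp: sym)
    also have "\<dots> = (\<Sum>p\<in>I. if p + u \<in> I then f p (p + u) else 0)"
      using I by (simp add: sum.inter_restrict)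
    finally show ?thesis .
  qed
  have "(\<Sum>p\<in>I. \<Sum>u\<in>bond_dirs. if p + - u \<in> I then f p (p + - u) else 0)
    = (\<Sum>p\<in>I. \<Sum>u\<in>bond_dirs. if p + u \<in> I then f p (p + u) else 0)"
    by (subst (1 2) sum.swap) (intro sum.cong refl opp)
  then show ?thesis unfolding inner split sum.distrib by simp
qed

section \<open>Lattice points in the plane and the energy as a sum over unoriented bonds\<close>

context lattice_angle
begin

definition pt :: "real \<Rightarrow> int \<times> int \<Rightarrow> complex" where
  "pt eps p = of_real eps * (cis \<phi> * (of_int (fst p) + of_int (snd p) * cis (pi / 3)))"

definition box :: "real \<Rightarrow> real \<Rightarrow> (int \<times> int) set" where
  "box L H = {p. 0 < X (fst p) (snd p) \<and> X (fst p) (snd p) < L \<and> 0 < Z (fst p) (snd p) \<and> Z (fst p) (snd p) < H}"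

lemma Re_pt: "Re (pt eps p) = eps * X (fst p) (snd p)" and Im_pt: "Im (pt eps p) = eps * Z (fst p) (snd p)"
proof -
  have "pt eps p = of_real eps * (of_int (fst p) * cis \<phi> + of_int (snd p) * cis (\<phi> + pi / 3))"
    unfolding cis_mult[symmetric] by (simp add: pt_def algebra_simps)
  then show "Re (pt eps p) = eps * X (fst p) (snd p)" "Im (pt eps p) = eps * Z (fst p) (snd p)"
    using gamma_mu by (auto simp: X_def Z_def \<nu>_def \<gamma>_def algebra_simps)
qed

lemma pt_diff: "pt eps p - pt eps q = pt eps (p - q)"
  by (simp add: pt_def algebra_simps)

text \<open>The mixed term comes from the scalar product 1/2 of the lattice vectors.\<close>

lemma cmod_pt:
  "(cmod (pt eps (m, n)))\<^sup>2 = eps\<^sup>2 * of_int (m\<^sup>2 + m * n + n\<^sup>2)"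
proof -
  have "X m n = of_int m * cos \<phi> + of_int n * cos (\<phi> + pi/3)" by (simp add: X_def \<nu>_def)
  moreover have "Z m n = of_int m * sin \<phi> + of_int n * sin (\<phi> + pi/3)"
    using gamma_mu by (simp add: Z_def \<gamma>_def algebra_simps)
  moreover have "cos \<phi> * cos (\<phi> + pi/3) + sin \<phi> * sin (\<phi> + pi/3) = 1 / 2"
    using cos_diff[of "\<phi> + pi/3" \<phi>] by (simp add: cos_60 algebra_simps)
  moreover have "(a * c + b * c')\<^sup>2 + (a * s + b * s')\<^sup>2 = a\<^sup>2 * (s\<^sup>2 + c\<^sup>2) + b\<^sup>2 * (s'\<^sup>2 + c'\<^sup>2) + 2 * a * b * (c * c' + s * s')"
    for a b c c' s s' :: real by (simp add: power2_eq_square algebra_simps)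
  ultimately have "(X m n)\<^sup>2 + (Z m n)\<^sup>2 = (of_int m)\<^sup>2 + (of_int n)\<^sup>2 + of_int m * of_int n"
    by simp
  moreover have "(cmod (pt eps (m, n)))\<^sup>2 = eps\<^sup>2 * ((X m n)\<^sup>2 + (Z m n)\<^sup>2)"
    unfolding cmod_power2 Re_pt Im_pt by (simp add: power_mult_distrib distrib_left)
  ultimately show ?thesis by simp
qed

lemma pt_neighbours:
  assumes "eps > 0"
  shows "cmod (pt eps p - pt eps q) = eps \<longleftrightarrow> q - p \<in> bond_dirs \<union> uminus ` bond_dirs"
proof -
  obtain m n where mn: "q - p = (m, n)" by force
  have "cmod (pt eps p - pt eps q) = cmod (pt eps (m, n))"
    unfolding mn[symmetric] pt_diff[symmetric] by (rule norm_minus_commute)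
  moreover have "cmod (pt eps (m, n)) = eps \<longleftrightarrow> (cmod (pt eps (m, n)))\<^sup>2 = eps\<^sup>2"
    using assms by (simp add: power2_eq_iff_nonneg)
  moreover have "\<dots> \<longleftrightarrow> (of_int (m\<^sup>2 + m * n + n\<^sup>2) :: real) = 1"
    unfolding cmod_pt using assms by simp
  moreover have "\<dots> \<longleftrightarrow> m\<^sup>2 + m * n + n\<^sup>2 = 1" by linarith
  ultimately show ?thesis unfolding mn unit_vectors by simp
qed

lemma inj_pt: "eps > 0 \<Longrightarrow> inj (pt eps)"
proof (rule injI)
  fix p q assume e: "eps > 0" "pt eps p = pt eps q"
  obtain m n where mn: "p - q = (m, n)" by force
  have "pt eps (m, n) = 0" unfolding mn[symmetric] pt_diff[symmetric] using e by simp
  then have "m\<^sup>2 + m * n + n\<^sup>2 = 0" using cmod_pt[of eps m n] e by (simp add: flip: of_int_power of_int_mult of_int_add)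
  then have "(2 * m + n)\<^sup>2 + 3 * n\<^sup>2 = 0" by (simp add: power2_eq_square algebra_simps)
  then have "n\<^sup>2 = 0 \<and> (2 * m + n)\<^sup>2 = 0"
    using zero_le_power2[of "2 * m + n"] zero_le_power2[of n] by linarith
  then have "m = 0" "n = 0" by auto
  then show "p = q" using mn by (simp add: zero_prod_def[symmetric])
qed

lemma finite_box [simp]: "finite (box L H)"
proof -
  define N where "N = \<lceil>(\<bar>L\<bar> + \<bar>H\<bar> / \<gamma>) / \<kappa>\<rceil>"
  define K where "K = \<lceil>\<bar>H\<bar> / \<gamma>\<rceil> + N"
  have "box L H \<subseteq> {-N..N} \<times> {-K..K}"
  proof
    fix p assume p: "p \<in> box L H"
    obtain n k where nk: "p = (n, k)" by force
    define s where "s = of_int n * \<mu> + of_int k"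
    have b: "0 < X n k" "X n k < L" "0 < \<gamma> * s" "\<gamma> * s < H" using p by (auto simp: box_def nk s_def Z_def)
    have s: "0 < s" "s < H / \<gamma>" using b(3,4) gamma_pos by (auto simp: field_simps zero_less_mult_iff)
    have "X n k = of_int n * \<kappa> + s * \<nu>" unfolding X_def s_def cos_phi_eq by (simp add: algebra_simps)
    moreover have "\<bar>s * \<nu>\<bar> \<le> s * 1" unfolding abs_mult using s abs_nu_le by (intro mult_mono) auto
    moreover have "H / \<gamma> \<le> \<bar>H\<bar> / \<gamma>" using gamma_pos by (simp add: divide_right_mono)
    ultimately have "\<bar>of_int n * \<kappa>\<bar> \<le> \<bar>L\<bar> + \<bar>H\<bar> / \<gamma>" using b s by linarith
    then have "\<bar>of_int n\<bar> \<le> (\<bar>L\<bar> + \<bar>H\<bar> / \<gamma>) / \<kappa>" using kappa_pos by (simp add: abs_mult field_simps)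
    also have "\<dots> \<le> of_int N" by (simp add: N_def)
    finally have n: "\<bar>of_int n\<bar> \<le> (of_int N :: real)" .
    have "\<bar>of_int n * \<mu>\<bar> \<le> of_int N * 1"
      unfolding abs_mult using n mu_nonneg mu_less_1 by (intro mult_mono) auto
    moreover have "\<bar>H\<bar> / \<gamma> \<le> of_int \<lceil>\<bar>H\<bar> / \<gamma>\<rceil>" by simp
    ultimately have "\<bar>of_int k\<bar> \<le> (of_int K :: real)"
      using s \<open>H / \<gamma> \<le> \<bar>H\<bar> / \<gamma>\<close> unfolding K_def s_def of_int_add by linarith
    then show "p \<in> {-N..N} \<times> {-K..K}" using n unfolding nk by auto
  qed
  then show ?thesis by (rule finite_subset) auto
qed

lemma sites_eq:
  assumes "eps > 0"
  shows "sites \<phi> l eps = pt eps ` box (l / eps) (1 / eps)"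
proof -
  have "x \<in> (\<lambda>z. complex_of_real eps * z) ` tri_lattice \<phi> \<longleftrightarrow> x \<in> range (pt eps)" for x
    by (auto simp: tri_lattice_def pt_def image_iff)
  then have "sites \<phi> l eps = {x \<in> range (pt eps). 0 < Re x \<and> Re x < l \<and> 0 < Im x \<and> Im x < 1}"
    by (auto simp: sites_def)
  also have "\<dots> = pt eps ` box (l / eps) (1 / eps)"
    using assms by (auto simp: box_def Re_pt Im_pt field_simps zero_less_mult_iff)
  finally show ?thesis .
qed

definition bond_sum :: "real \<Rightarrow> real \<Rightarrow> (int \<times> int \<Rightarrow> int \<times> int \<Rightarrow> real) \<Rightarrow> real" where
  "bond_sum L H f = (\<Sum>p\<in>box L H. \<Sum>u\<in>bond_dirs. if p + u \<in> box L H then f p (p + u) else 0)"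

lemma sum_sites:
  fixes g :: "complex \<Rightarrow> complex \<Rightarrow> real"
  assumes e: "eps > 0" and sym: "\<And>x x'. g x x' = g x' x"
  shows "(\<Sum>x\<in>sites \<phi> l eps. \<Sum>x'\<in>sites \<phi> l eps. if cmod (x - x') = eps then g x x' else 0)
    = 2 * bond_sum (l / eps) (1 / eps) (\<lambda>p q. g (pt eps p) (pt eps q))"
proof -
  have inj: "inj_on (pt eps) S" for S by (rule inj_on_subset[OF inj_pt[OF e]]) simp
  show ?thesis
    unfolding sites_eq[OF e] sum.reindex[OF inj] o_def pt_neighbours[OF e] bond_sum_def
    by (rule sum_unoriented_bonds) (auto intro: sym)
qed

lemma energy_ge:
  assumes e: "eps > 0" and v: "\<forall>r\<ge>0. ereal (v r) \<le> W r"
  shows "ereal (bond_sum (l / eps) (1 / eps) (\<lambda>p q. v (cmod (y (pt eps p) - y (pt eps q)) / eps))) \<le> energy W \<phi> l eps y"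
proof -
  let ?g = "\<lambda>x x'. v (cmod (y x - y x') / eps)"
  have "ereal (\<Sum>x\<in>sites \<phi> l eps. \<Sum>x'\<in>sites \<phi> l eps. if cmod (x - x') = eps then ?g x x' else 0)
    \<le> (\<Sum>x\<in>sites \<phi> l eps. \<Sum>x'\<in>sites \<phi> l eps. if cmod (x - x') = eps then W (cmod (y x - y x') / eps) else 0)"
    unfolding sum_ereal[symmetric] using v e by (intro sum_mono) (auto simp: zero_ereal_def[symmetric])
  then have "ereal (2 * bond_sum (l / eps) (1 / eps) (\<lambda>p q. ?g (pt eps p) (pt eps q)))
    \<le> (\<Sum>x\<in>sites \<phi> l eps. \<Sum>x'\<in>sites \<phi> l eps. if cmod (x - x') = eps then W (cmod (y x - y x') / eps) else 0)"
    by (subst (asm) sum_sites[OF e]) (auto simp: norm_minus_commute)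
  then have "ereal (1/2) * ereal (2 * bond_sum (l / eps) (1 / eps) (\<lambda>p q. ?g (pt eps p) (pt eps q))) \<le> energy W \<phi> l eps y"
    unfolding energy_def by (intro ereal_mult_left_mono) auto
  then show ?thesis by simp
qed

text \<open>A real bound on one orientation of each bond suffices: the interaction is symmetric, and
  a nonnegative value of \<open>W\<close> with a real upper bound is itself real, so the extended
  sum becomes a real one.\<close>

lemma energy_le:
  assumes e: "eps > 0" and nn: "\<forall>r\<ge>0. W r \<ge> 0"
    and v: "\<And>p q. p \<in> box (l / eps) (1 / eps) \<Longrightarrow> q \<in> box (l / eps) (1 / eps) \<Longrightarrow> q - p \<in> bond_dirs
      \<Longrightarrow> W (cmod (y (pt eps p) - y (pt eps q)) / eps) \<le> ereal (f p q)"
  shows "energy W \<phi> l eps y \<le> ereal (bond_sum (l / eps) (1 / eps) f)"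
proof -
  define g where "g x x' = real_of_ereal (W (cmod (y x - y x') / eps))" for x x'
  have sym: "g x x' = g x' x" for x x' by (simp add: g_def norm_minus_commute)
  have fin: "W (cmod (y (pt eps p) - y (pt eps q)) / eps) = ereal (g (pt eps p) (pt eps q))"
    if pq: "p \<in> box (l / eps) (1 / eps)" "q \<in> box (l / eps) (1 / eps)" "q - p \<in> bond_dirs \<union> uminus ` bond_dirs" for p q
  proof -
    have "\<exists>c. W (cmod (y (pt eps p) - y (pt eps q)) / eps) \<le> ereal c"
    proof (cases "q - p \<in> bond_dirs")
      case True
      then show ?thesis using v[OF pq(1,2)] by blast
    next
      case False
      then obtain u where "u \<in> bond_dirs" "q - p = - u" using pq(3) by blast
      then have "p - q \<in> bond_dirs" by (metis minus_diff_eq minus_minus)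
      then show ?thesis using v[OF pq(2,1)] by (subst norm_minus_commute) blast
    qed
    moreover have "0 \<le> W (cmod (y (pt eps p) - y (pt eps q)) / eps)" using nn e by simp
    ultimately show ?thesis unfolding g_def
      by (cases "W (cmod (y (pt eps p) - y (pt eps q)) / eps)") auto
  qed
  have "(\<Sum>x\<in>sites \<phi> l eps. \<Sum>x'\<in>sites \<phi> l eps. if cmod (x - x') = eps then W (cmod (y x - y x') / eps) else 0)
    = ereal (\<Sum>x\<in>sites \<phi> l eps. \<Sum>x'\<in>sites \<phi> l eps. if cmod (x - x') = eps then g x x' else 0)"
    unfolding sum_ereal[symmetric]
    by (intro sum.cong refl) (auto simp: sites_eq[OF e] pt_neighbours[OF e] fin zero_ereal_def)
  also have "\<dots> = ereal (2 * bond_sum (l / eps) (1 / eps) (\<lambda>p q. g (pt eps p) (pt eps q)))"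
    by (subst sum_sites[OF e sym]) simp
  finally have "energy W \<phi> l eps y = ereal (bond_sum (l / eps) (1 / eps) (\<lambda>p q. g (pt eps p) (pt eps q)))"
    unfolding energy_def by simp
  also have "\<dots> \<le> ereal (bond_sum (l / eps) (1 / eps) f)"
  proof -
    have "g (pt eps p) (pt eps (p + u)) \<le> f p (p + u)"
      if "p \<in> box (l / eps) (1 / eps)" "u \<in> bond_dirs" "p + u \<in> box (l / eps) (1 / eps)" for p u
      using v[OF that(1,3)] fin[OF that(1,3)] that(2) by simp
    then have "bond_sum (l / eps) (1 / eps) (\<lambda>p q. g (pt eps p) (pt eps q)) \<le> bond_sum (l / eps) (1 / eps) f"
      unfolding bond_sum_def by (intro sum_mono) auto
    then show ?thesis by simp
  qed
  finally show ?thesis .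
qed

text \<open>Lattice points are counted by slices. A point is active for a unit interval of \<sigma>,
  and a slice is met by at most one active point per lattice line; the added 1 in the width comes
  from the offset of at most 1/2 on either side between the point and the crossing.\<close>

lemma card_strip_le:
  assumes fin: "finite I" and x: "x0 \<le> x1" and H: "H \<ge> 0"
    and I: "\<And>n k. (n, k) \<in> I \<Longrightarrow> x0 \<le> X n k \<and> X n k \<le> x1 \<and> 0 \<le> Z n k \<and> Z n k \<le> H"
  shows "real (card I) \<le> (H / \<gamma> + 1) * ((x1 - x0 + 1) / \<kappa> + 1)"
proof -
  define m where "m = (x1 - x0 + 1) / \<kappa> + 1"
  have m0: "m \<ge> 0" using x kappa_pos by (simp add: m_def)
  let ?S = "\<lambda>\<sigma>. \<Sum>p\<in>I. cutoff True \<mu> (\<sigma> - (of_int (fst p) * \<mu> + of_int (snd p)))"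
  have S: "(?S has_integral (\<Sum>p\<in>I. 1)) UNIV"
    using mu_nonneg mu_less_1 fin by (intro has_integral_sum cutoff_has_integral) auto
  have "((\<lambda>\<sigma>. m) has_integral (H / \<gamma> + 1 - 0) * m) {0..H / \<gamma> + 1}"
    using H gamma_pos has_integral_const_real[of m 0 "H / \<gamma> + 1"] by simp
  then have M: "((\<lambda>\<sigma>. if \<sigma> \<in> {0..H / \<gamma> + 1} then m else 0) has_integral (H / \<gamma> + 1 - 0) * m) UNIV"
    by (simp only: has_integral_restrict_UNIV)
  have "(\<Sum>p\<in>I. 1) \<le> (H / \<gamma> + 1 - 0) * m"
  proof (rule has_integral_le[OF S M])
    fix \<sigma> :: real
    define J where "J = {p\<in>I. snd p = row \<sigma> (fst p)}"
    have "?S \<sigma> = (\<Sum>p\<in>I. if snd p = row \<sigma> (fst p) then 1 else 0)"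
    proof (intro sum.cong refl)
      fix p :: "int \<times> int"
      have "snd p = row \<sigma> (fst p) \<longleftrightarrow> 0 \<le> \<sigma> - (of_int (fst p) * \<mu> + of_int (snd p)) \<and> \<sigma> - (of_int (fst p) * \<mu> + of_int (snd p)) < 1"
        unfolding row_def by linarith
      then show "cutoff True \<mu> (\<sigma> - (of_int (fst p) * \<mu> + of_int (snd p))) = (if snd p = row \<sigma> (fst p) then 1 else 0)"
        by (simp add: cutoff_def weight_def)
    qed
    then have SJ: "?S \<sigma> = real (card J)" using fin by (simp add: J_def sum.If_cases Int_def)
    show "?S \<sigma> \<le> (if \<sigma> \<in> {0..H / \<gamma> + 1} then m else 0)"
    proof (cases "J = {}")
      case True
      then show ?thesis unfolding SJ using m0 by simp
    next
      case False
      then obtain n k where "(n, k) \<in> I" "k = row \<sigma> n" by (auto simp: J_def)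
      then have "0 \<le> \<gamma> * (\<sigma> - fr \<sigma> n)" "\<gamma> * (\<sigma> - fr \<sigma> n) \<le> H" using I[of n k] Z_row[of n \<sigma>] by auto
      then have "0 \<le> \<sigma> - fr \<sigma> n" "\<sigma> - fr \<sigma> n \<le> H / \<gamma>" using gamma_pos by (auto simp: field_simps zero_le_mult_iff)
      then have \<sigma>: "\<sigma> \<in> {0..H / \<gamma> + 1}" using fr_bounds[of \<sigma> n] by auto
      define u v where "u = (x0 - \<sigma> * \<nu> - 1/2) / \<kappa>" and "v = (x1 - \<sigma> * \<nu> + 1/2) / \<kappa>"
      have "fst ` J \<subseteq> {\<lceil>u\<rceil>..\<lfloor>v\<rfloor>}"
      proof
        fix n assume "n \<in> fst ` J"
        then have "(n, row \<sigma> n) \<in> I" by (auto simp: J_def)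
        then have "x0 \<le> of_int n * \<kappa> + \<sigma> * \<nu> - fr \<sigma> n * \<nu>" "of_int n * \<kappa> + \<sigma> * \<nu> - fr \<sigma> n * \<nu> \<le> x1"
          using I[of n "row \<sigma> n"] X_row[of n \<sigma>] by auto
        moreover have "\<bar>fr \<sigma> n * \<nu>\<bar> \<le> 1 * (1/2)"
          unfolding abs_mult using fr_bounds[of \<sigma> n] abs_nu_le by (intro mult_mono) auto
        ultimately have "x0 - \<sigma> * \<nu> - 1/2 \<le> of_int n * \<kappa>" "of_int n * \<kappa> \<le> x1 - \<sigma> * \<nu> + 1/2" by linarith+
        then have "u \<le> of_int n" "of_int n \<le> v" unfolding u_def v_def using kappa_pos by (simp_all add: field_simps)
        then show "n \<in> {\<lceil>u\<rceil>..\<lfloor>v\<rfloor>}" by (auto simp: ceiling_le_iff le_floor_iff)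
      qed
      then have "card (fst ` J) \<le> card {\<lceil>u\<rceil>..\<lfloor>v\<rfloor>}" by (intro card_mono) auto
      moreover have "card (fst ` J) = card J" by (intro card_image inj_onI) (auto simp: J_def prod_eq_iff)
      ultimately have "real (card J) \<le> real (nat (\<lfloor>v\<rfloor> + 1 - \<lceil>u\<rceil>))" by simp
      also have "\<dots> \<le> v - u + 1"
      proof -
        have "u \<le> v" unfolding u_def v_def using x kappa_pos by (intro divide_right_mono) auto
        then show ?thesis by linarith
      qed
      also have "\<dots> = m" unfolding m_def u_def v_def by (simp add: diff_divide_distrib add_divide_distrib)
      finally show ?thesis unfolding SJ using \<sigma> by simp
    qed
  qed
  then show ?thesis by (simp add: m_def)
qed

end

section \<open>Expansion of the potential\<close>

text \<open>The first-order term vanishes since 1 is a local minimum. Halving the radius gives a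
  compact interval on which the fourth derivative is bounded.\<close>

lemma C4_taylor_at_minimum:
  assumes C4: "C4_on (ball 1 \<delta>) w" and \<delta>: "\<delta> > 0" and w1: "w 1 = 0"
    and pos: "\<And>r. r \<in> ball 1 \<delta> \<Longrightarrow> w r \<ge> 0"
  shows "\<exists>C\<ge>0. \<forall>r. \<bar>r - 1\<bar> \<le> \<delta> / 2 \<longrightarrow>
    \<bar>w r - ((deriv ^^ 2) w 1 / 2 * (r - 1)\<^sup>2 + (deriv ^^ 3) w 1 / 6 * (r - 1) ^ 3)\<bar> \<le> C * (r - 1) ^ 4"
proof -
  let ?d = "\<lambda>k. (deriv ^^ k) w"
  have D: "DERIV (?d k) x :> ?d (Suc k) x" if "k < 4" "x \<in> ball 1 \<delta>" for k x
    using C4 that unfolding C4_on_def by blast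
  have "DERIV w 1 :> ?d 1 1" using D[of 0 1] \<delta> by simp
  then have d1: "?d 1 1 = 0"
    by (rule DERIV_local_min[OF _ \<delta>]) (use pos w1 in \<open>auto simp: dist_real_def\<close>)
  have "continuous_on (cball 1 (\<delta>/2)) (?d 4)"
    using C4 \<delta> unfolding C4_on_def by (auto elim!: continuous_on_subset simp: subset_iff)
  then have "bounded (?d 4 ` cball 1 (\<delta>/2))"
    by (intro compact_imp_bounded compact_continuous_image) auto
  then obtain B where B: "B > 0" "\<And>x. x \<in> cball 1 (\<delta>/2) \<Longrightarrow> \<bar>?d 4 x\<bar> \<le> B"
    by (auto simp: bounded_pos)
  have *: "\<bar>w r - (?d 2 1 / 2 * (r - 1)\<^sup>2 + ?d 3 1 / 6 * (r - 1) ^ 3)\<bar> \<le> B * (r - 1) ^ 4"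
    if r: "\<bar>r - 1\<bar> \<le> \<delta> / 2" for r
  proof (cases "r = 1")
    case True
    then show ?thesis using w1 by simp
  next
    case False
    have r': "1 - \<delta>/2 \<le> r" "r \<le> 1 + \<delta>/2" using r by linarith+
    have "\<exists>t. (if r < 1 then r < t \<and> t < 1 else 1 < t \<and> t < r) \<and>
      w r = (\<Sum>m<4. ?d m 1 / fact m * (r - 1) ^ m) + ?d 4 t / fact 4 * (r - 1) ^ 4"
    proof (rule Taylor[of 4 ?d w "1 - \<delta>/2" "1 + \<delta>/2" 1 r])
      show "\<forall>m t. m < 4 \<and> 1 - \<delta>/2 \<le> t \<and> t \<le> 1 + \<delta>/2 \<longrightarrow> DERIV (?d m) t :> ?d (Suc m) t"
      proof (intro allI impI)
        fix m :: nat and t :: real assume a: "m < 4 \<and> 1 - \<delta>/2 \<le> t \<and> t \<le> 1 + \<delta>/2"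
        then have "t \<in> ball 1 \<delta>" using \<delta> by (auto simp: dist_real_def)
        then show "DERIV (?d m) t :> ?d (Suc m) t" using D a by blast
      qed
    qed (use r' False \<delta> in auto)
    then obtain t where t0: "if r < 1 then r < t \<and> t < 1 else 1 < t \<and> t < r"
      and t: "w r = (\<Sum>m<4. ?d m 1 / fact m * (r - 1) ^ m) + ?d 4 t / fact 4 * (r - 1) ^ 4"
      by blast
    have t1: "\<bar>t - 1\<bar> \<le> \<delta>/2" using t0 r by (auto split: if_splits)
    have "(\<Sum>m<4. ?d m 1 / fact m * (r - 1) ^ m) = ?d 2 1 / 2 * (r - 1)\<^sup>2 + ?d 3 1 / 6 * (r - 1) ^ 3"
      using d1 w1 by (simp add: eval_nat_numeral)
    then have "\<bar>w r - (?d 2 1 / 2 * (r - 1)\<^sup>2 + ?d 3 1 / 6 * (r - 1) ^ 3)\<bar> = \<bar>?d 4 t\<bar> / fact 4 * (r - 1) ^ 4"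
      using t by (simp add: abs_mult)
    also have "\<dots> \<le> B * (r - 1) ^ 4"
    proof (intro mult_right_mono)
      have "\<bar>?d 4 t\<bar> \<le> B" using t1 by (intro B(2)) (auto simp: dist_real_def abs_minus_commute)
      then show "\<bar>?d 4 t\<bar> / fact 4 \<le> B" by (simp add: fact_numeral)
    qed simp
    finally show ?thesis .
  qed
  then show ?thesis using B(1) by (intro exI[of _ B]) auto
qed

text \<open>For r = 1 + s one has 2 s + s^2 = r^2 - 1. The coefficient b/48 - a/16 is the one for
  which the cubic terms in \<open>s\<close> agree, and 19 bounds the remaining factor 12 + 6 s +
  s^2.\<close>

lemma quartic_change_of_variable:
  fixes s a b :: real
  assumes "\<bar>s\<bar> \<le> 1"
  shows "\<bar>(a / 8 * (2 * s + s\<^sup>2)\<^sup>2 + (b / 48 - a / 16) * (2 * s + s\<^sup>2) ^ 3) - (a / 2 * s\<^sup>2 + b / 6 * s ^ 3)\<bar>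
    \<le> (\<bar>a\<bar> / 8 + 19 * \<bar>b / 48 - a / 16\<bar>) * s ^ 4"
proof -
  define c where "c = b / 48 - a / 16"
  have "(a / 8 * (2 * s + s\<^sup>2)\<^sup>2 + c * (2 * s + s\<^sup>2) ^ 3) - (a / 2 * s\<^sup>2 + b / 6 * s ^ 3)
    = s ^ 4 * (a / 8 + c * (12 + 6 * s + s\<^sup>2))"
    unfolding c_def by (simp add: field_simps power2_eq_square power3_eq_cube power4_eq_xxxx)
  moreover have "\<bar>s ^ 4 * (a / 8 + c * (12 + 6 * s + s\<^sup>2))\<bar> = s ^ 4 * \<bar>a / 8 + c * (12 + 6 * s + s\<^sup>2)\<bar>"
    by (simp add: abs_mult)
  moreover have "\<bar>a / 8 + c * (12 + 6 * s + s\<^sup>2)\<bar> \<le> \<bar>a\<bar> / 8 + 19 * \<bar>c\<bar>"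
  proof -
    have "s\<^sup>2 \<le> 1" using assms abs_square_le_1 by auto
    then have "\<bar>12 + 6 * s + s\<^sup>2\<bar> \<le> 19" using assms by (auto simp: abs_le_iff)
    then have "\<bar>c * (12 + 6 * s + s\<^sup>2)\<bar> \<le> \<bar>c\<bar> * 19" unfolding abs_mult by (intro mult_left_mono) auto
    then show ?thesis by linarith
  qed
  ultimately show ?thesis unfolding c_def[symmetric]
    by (metis (no_types, lifting) mult.commute mult_left_mono zero_le_even_power even_numeral)
qed

text \<open>Squared lengths are the right variable because \<open>metric_identity\<close> is linear
  in them. The error transfers since |r - 1| is at most |r^2 - 1| for nonnegative
  \<open>r\<close>.\<close>

lemma expansion_in_squared_length:
  assumes C4: "C4_on (ball 1 \<delta>) w" and \<delta>: "\<delta> > 0" and w1: "w 1 = 0"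
    and pos: "\<And>r. r \<in> ball 1 \<delta> \<Longrightarrow> w r \<ge> 0"
    and \<alpha>: "\<alpha> = (deriv ^^ 2) w 1" and \<alpha>': "\<alpha>' = (deriv ^^ 3) w 1"
  shows "\<exists>C\<ge>0. \<forall>r\<ge>0. \<bar>r\<^sup>2 - 1\<bar> \<le> min 1 (\<delta>/2) \<longrightarrow> r \<in> ball 1 \<delta> \<and>
    \<bar>w r - (\<alpha> / 8 * (r\<^sup>2 - 1)\<^sup>2 + (\<alpha>' / 48 - \<alpha> / 16) * (r\<^sup>2 - 1) ^ 3)\<bar> \<le> C * (r\<^sup>2 - 1) ^ 4"
proof -
  obtain C where C: "C \<ge> 0" "\<And>r. \<bar>r - 1\<bar> \<le> \<delta> / 2 \<Longrightarrow>
    \<bar>w r - (\<alpha> / 2 * (r - 1)\<^sup>2 + \<alpha>' / 6 * (r - 1) ^ 3)\<bar> \<le> C * (r - 1) ^ 4"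
    using C4_taylor_at_minimum[OF C4 \<delta> w1 pos] unfolding \<alpha> \<alpha>' by blast
  define K where "K = C + (\<bar>\<alpha>\<bar> / 8 + 19 * \<bar>\<alpha>' / 48 - \<alpha> / 16\<bar>)"
  have K0: "K \<ge> 0" using C(1) by (simp add: K_def)
  have "r \<in> ball 1 \<delta> \<and>
    \<bar>w r - (\<alpha> / 8 * (r\<^sup>2 - 1)\<^sup>2 + (\<alpha>' / 48 - \<alpha> / 16) * (r\<^sup>2 - 1) ^ 3)\<bar> \<le> K * (r\<^sup>2 - 1) ^ 4"
    if r: "r \<ge> 0" "\<bar>r\<^sup>2 - 1\<bar> \<le> min 1 (\<delta>/2)" for r
  proof -
    define s where "s = r - 1"
    have z: "r\<^sup>2 - 1 = 2 * s + s\<^sup>2" by (simp add: s_def power2_eq_square algebra_simps)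
    have "\<bar>r\<^sup>2 - 1\<bar> = \<bar>s\<bar> * (r + 1)"
      using r(1) abs_mult[of s "r + 1"] by (simp add: s_def power2_eq_square algebra_simps)
    then have sz: "\<bar>s\<bar> \<le> \<bar>r\<^sup>2 - 1\<bar>" using r(1) by (simp add: algebra_simps)
    then have s1: "\<bar>s\<bar> \<le> 1" "\<bar>s\<bar> \<le> \<delta>/2" using r by auto
    have "s ^ 4 \<le> (r\<^sup>2 - 1) ^ 4"
      using power_mono[OF sz, of 4] by simp
    then have "K * s ^ 4 \<le> K * (r\<^sup>2 - 1) ^ 4" using K0 by (rule mult_left_mono)
    moreover have "\<bar>w r - (\<alpha> / 8 * (r\<^sup>2 - 1)\<^sup>2 + (\<alpha>' / 48 - \<alpha> / 16) * (r\<^sup>2 - 1) ^ 3)\<bar> \<le> K * s ^ 4"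
      using C(2)[of r] s1(2) quartic_change_of_variable[OF s1(1), of \<alpha> \<alpha>']
      unfolding z s_def[symmetric] K_def distrib_right by linarith
    moreover have "r \<in> ball 1 \<delta>" using s1 \<delta> by (auto simp: s_def dist_real_def abs_if split: if_splits)
    ultimately show ?thesis by linarith
  qed
  then show ?thesis using K0 by blast
qed

text \<open>The slope \<open>4 a \<tau> p\<close> is the derivative of \<open>a z\<^sup>2\<close> at \<open>z = 2 \<tau> p\<close>; the cubic term only
  perturbs it by \<open>O(\<tau>\<^sup>2)\<close>, which the quadratic term absorbs.\<close>

lemma tangent_lower_bound:
  fixes a b C :: real
  assumes "a > 0" "C \<ge> 0"
  shows "\<exists>\<eta>>0. \<exists>K\<ge>0. \<forall>z \<tau> p. \<bar>z\<bar> \<le> \<eta> \<longrightarrow> 0 \<le> \<tau> \<longrightarrow> \<tau> \<le> \<eta> \<longrightarrow> \<bar>p\<bar> \<le> 1 \<longrightarrow>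
    4 * a * \<tau>\<^sup>2 * p\<^sup>2 + 8 * b * \<tau> ^ 3 * p ^ 3 + 4 * a * \<tau> * p * (z - 2 * \<tau> * p) - K * \<tau> ^ 4
      \<le> a * z\<^sup>2 + b * z ^ 3 - C * z ^ 4"
proof -
  \<comment> \<open>Chosen so that each of the three error terms \<open>e1\<close>,
    \<open>e2\<close>, \<open>e3\<close> costs at most a quarter of the quadratic term in the
    deviation \<open>d\<close>, up to multiples of the fourth power of \<tau>.\<close>
  define D where "D = 36 * \<bar>b\<bar> + 288 * C + 1"
  define \<eta> where "\<eta> = min 1 (a / D)"
  have D: "D > 0" using assms by (simp add: D_def)
  have \<eta>: "\<eta> > 0" "\<eta> \<le> 1" using assms D by (auto simp: \<eta>_def)
  have "\<eta> * D \<le> a" using D by (simp add: \<eta>_def min_def field_simps)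
  then have "36 * (\<eta> * \<bar>b\<bar>) + 288 * (\<eta> * C) + \<eta> \<le> a" by (simp add: D_def algebra_simps)
  moreover have "0 \<le> \<eta> * \<bar>b\<bar>" "0 \<le> \<eta> * C" using \<eta> assms by auto
  ultimately have "9 * (\<eta> * \<bar>b\<bar>) \<le> a / 4" "72 * (\<eta> * C) \<le> a / 4" using \<eta> by linarith+
  then have \<eta>b: "9 * \<eta> * \<bar>b\<bar> \<le> a / 4" and \<eta>C: "72 * C * \<eta> \<le> a / 4" by (auto simp: mult_ac)
  define K where "K = 144 * b\<^sup>2 / a + 128 * C"
  have "4 * a * \<tau>\<^sup>2 * p\<^sup>2 + 8 * b * \<tau> ^ 3 * p ^ 3 + 4 * a * \<tau> * p * (z - 2 * \<tau> * p) - K * \<tau> ^ 4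
      \<le> a * z\<^sup>2 + b * z ^ 3 - C * z ^ 4"
    if h: "\<bar>z\<bar> \<le> \<eta>" "0 \<le> \<tau>" "\<tau> \<le> \<eta>" "\<bar>p\<bar> \<le> 1" for z \<tau> p
  proof -
    define x where "x = 2 * \<tau> * p"
    define d where "d = z - x"
    have x: "\<bar>x\<bar> \<le> 2 * \<tau>" using h by (simp add: x_def abs_mult mult_left_le)
    have d: "\<bar>d\<bar> \<le> 3 * \<eta>" using h x by (simp add: d_def)
    have z: "z = x + d" by (simp add: d_def)
    have e1: "- (a / 4 * d\<^sup>2 + 144 * b\<^sup>2 / a * \<tau> ^ 4) \<le> b * (3 * x\<^sup>2 * d)"
    proof -
      have "x\<^sup>2 \<le> (2 * \<tau>)\<^sup>2" using power_mono[OF x, of 2] by simp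
      then have "\<bar>b * (3 * x\<^sup>2 * d)\<bar> \<le> \<bar>b\<bar> * (3 * (2 * \<tau>)\<^sup>2 * \<bar>d\<bar>)"
        unfolding abs_mult by (intro mult_mono) auto
      also have "\<dots> = 2 * (\<bar>d\<bar> / 2) * (12 * \<bar>b\<bar> * \<tau>\<^sup>2)" by (simp add: power2_eq_square)
      also have "\<dots> \<le> a / 4 * d\<^sup>2 + 144 * b\<^sup>2 / a * \<tau> ^ 4"
      proof -
        have "0 \<le> (a * \<bar>d\<bar> / 2 - 12 * \<bar>b\<bar> * \<tau>\<^sup>2)\<^sup>2 / a" using assms by simp
        also have "\<dots> = a / 4 * d\<^sup>2 + 144 * b\<^sup>2 / a * \<tau> ^ 4 - 2 * (\<bar>d\<bar> / 2) * (12 * \<bar>b\<bar> * \<tau>\<^sup>2)"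
        proof -
          have *: "(a * u / 2 - 12 * v * t)\<^sup>2 / a = a / 4 * u\<^sup>2 + 144 * v\<^sup>2 / a * t\<^sup>2 - 2 * (u / 2) * (12 * v * t)"
            for u v t :: real
            using assms(1) by (simp add: power2_eq_square field_simps)
          show ?thesis unfolding * by simp
        qed
        finally show ?thesis by simp
      qed
      finally show ?thesis by linarith
    qed
    have e2: "- (a / 4 * d\<^sup>2) \<le> b * ((3 * x + d) * d\<^sup>2)"
    proof -
      have "\<bar>3 * x + d\<bar> \<le> 9 * \<eta>" using x d h by linarith
      then have "\<bar>b * ((3 * x + d) * d\<^sup>2)\<bar> \<le> \<bar>b\<bar> * (9 * \<eta> * d\<^sup>2)"
        unfolding abs_mult by (intro mult_mono) auto
      also have "\<dots> = 9 * \<eta> * \<bar>b\<bar> * d\<^sup>2" by simp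
      also have "\<dots> \<le> a / 4 * d\<^sup>2" using \<eta>b by (rule mult_right_mono) simp
      finally show ?thesis by linarith
    qed
    have e3: "C * (x + d) ^ 4 \<le> 128 * C * \<tau> ^ 4 + a / 4 * d\<^sup>2"
    proof -
      have q: "(x + d)\<^sup>2 \<le> 2 * (x\<^sup>2 + d\<^sup>2)" using zero_le_power2[of "x - d"] by (simp add: power2_eq_square algebra_simps)
      have q': "(x\<^sup>2 + d\<^sup>2)\<^sup>2 \<le> 2 * (x ^ 4 + d ^ 4)"
        using zero_le_power2[of "x\<^sup>2 - d\<^sup>2"] by (simp add: power2_eq_square power4_eq_xxxx algebra_simps)
      have "(x + d) ^ 4 = ((x + d)\<^sup>2)\<^sup>2" by simp
      also have "\<dots> \<le> (2 * (x\<^sup>2 + d\<^sup>2))\<^sup>2" using q by (intro power_mono) auto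
      also have "\<dots> = 4 * (x\<^sup>2 + d\<^sup>2)\<^sup>2" unfolding power_mult_distrib by simp
      also have "\<dots> \<le> 8 * (x ^ 4 + d ^ 4)" using q' by simp
      finally have "(x + d) ^ 4 \<le> 8 * x ^ 4 + 8 * d ^ 4" by simp
      moreover have "x ^ 4 \<le> 16 * \<tau> ^ 4"
        using power_mono[OF x, of 4] by (simp add: power_mult_distrib)
      moreover have "d ^ 4 \<le> 9 * \<eta> * d\<^sup>2"
      proof -
        have "d\<^sup>2 \<le> (3 * \<eta>)\<^sup>2" using power_mono[OF d, of 2] by simp
        also have "\<dots> \<le> 9 * \<eta>" using \<eta> by (simp add: power2_eq_square)
        finally have "d\<^sup>2 * d\<^sup>2 \<le> 9 * \<eta> * d\<^sup>2" by (rule mult_right_mono) simp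
        then show ?thesis by (simp add: power2_eq_square power4_eq_xxxx mult.assoc)
      qed
      ultimately have "(x + d) ^ 4 \<le> 128 * \<tau> ^ 4 + 72 * \<eta> * d\<^sup>2" by linarith
      then have "C * (x + d) ^ 4 \<le> C * (128 * \<tau> ^ 4 + 72 * \<eta> * d\<^sup>2)" using assms(2) by (rule mult_left_mono)
      also have "\<dots> = 128 * C * \<tau> ^ 4 + 72 * C * \<eta> * d\<^sup>2" by (simp add: algebra_simps)
      also have "72 * C * \<eta> * d\<^sup>2 \<le> a / 4 * d\<^sup>2" using \<eta>C by (rule mult_right_mono) simp
      finally show ?thesis by linarith
    qed
    have "a * z\<^sup>2 + b * z ^ 3 - C * z ^ 4 = a * x\<^sup>2 + b * x ^ 3 + 2 * a * x * d + a * d\<^sup>2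
        + b * (3 * x\<^sup>2 * d) + b * ((3 * x + d) * d\<^sup>2) - C * (x + d) ^ 4"
      unfolding z by (simp add: power2_eq_square power3_eq_cube algebra_simps)
    also have "\<dots> \<ge> a * x\<^sup>2 + b * x ^ 3 + 2 * a * x * d - K * \<tau> ^ 4"
      using e1 e2 e3 assms(1) zero_le_power2[of d] mult_nonneg_nonneg[of a "d\<^sup>2"]
      unfolding K_def distrib_right by linarith
    finally have "a * x\<^sup>2 + b * x ^ 3 + 2 * a * x * d - K * \<tau> ^ 4 \<le> a * z\<^sup>2 + b * z ^ 3 - C * z ^ 4" .
    moreover have "a * x\<^sup>2 = 4 * a * \<tau>\<^sup>2 * p\<^sup>2" "b * x ^ 3 = 8 * b * \<tau> ^ 3 * p ^ 3"
      "2 * a * x * d = 4 * a * \<tau> * p * (z - 2 * \<tau> * p)"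
      by (auto simp: x_def d_def power_mult_distrib)
    ultimately show ?thesis by simp
  qed
  moreover have "K \<ge> 0" using assms by (simp add: K_def)
  ultimately show ?thesis using \<eta>(1) by blast
qed

text \<open>Truncating \<open>W\<close> at the level \<open>B\<close> gives a real minorant that
  retains every lower bound not exceeding \<open>B\<close>, so that infinite values of
  \<open>W\<close> disappear from the estimates.\<close>

lemma real_envelope:
  fixes W :: "real \<Rightarrow> ereal" and B :: real
  assumes "\<forall>r\<ge>0. W r \<ge> 0" "B \<ge> 0"
  shows "\<exists>v. (\<forall>r\<ge>0. 0 \<le> v r \<and> ereal (v r) \<le> W r) \<and> (\<forall>r\<ge>0. \<forall>x\<le>B. ereal x \<le> W r \<longrightarrow> x \<le> v r)"
proof (intro exI conjI allI impI)
  let ?v = "\<lambda>r. real_of_ereal (min (W r) (ereal B))"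
  fix r :: real assume r: "0 \<le> r"
  have e: "ereal (?v r) = min (W r) (ereal B)"
    using assms(1)[rule_format, OF r] by (cases "W r") (auto simp: min_def)
  show "0 \<le> ?v r" using assms r by (simp add: real_of_ereal_pos)
  show "ereal (?v r) \<le> W r" unfolding e by simp
  fix x assume "x \<le> B" "ereal x \<le> W r"
  then have "ereal x \<le> ereal (?v r)" unfolding e by simp
  then show "x \<le> ?v r" by simp
qed

lemma positive_away_from_one:
  fixes W :: "real \<Rightarrow> ereal"
  assumes nn: "\<forall>r\<ge>0. W r \<ge> 0" and z: "\<forall>r\<ge>0. W r = 0 \<longleftrightarrow> r = 1" and c: "continuous_on {0..} W"
    and \<beta>: "\<beta> > 0" and inf: "\<And>r. r \<ge> M \<Longrightarrow> ereal \<beta> \<le> W r" and \<eta>: "\<eta> > 0"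
  shows "\<exists>c>0. \<forall>r\<ge>0. \<bar>r\<^sup>2 - 1\<bar> \<ge> \<eta> \<longrightarrow> ereal c \<le> W r"
proof -
  define S where "S = {0..M} \<inter> {r. \<bar>r\<^sup>2 - 1\<bar> \<ge> \<eta>}"
  have "closed {r::real. \<bar>r\<^sup>2 - 1\<bar> \<ge> \<eta>}" by (intro closed_Collect_le continuous_intros)
  then have S: "compact S" unfolding S_def by (intro compact_Int_closed) auto
  have "\<exists>c>0. \<forall>r\<in>S. ereal c \<le> W r"
  proof (cases "S = {}")
    case True
    then show ?thesis by (intro exI[of _ 1]) auto
  next
    case False
    have "continuous_on S W" using c by (rule continuous_on_subset) (auto simp: S_def)
    then obtain x where x: "x \<in> S" "\<And>r. r \<in> S \<Longrightarrow> W x \<le> W r"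
      using continuous_attains_inf[OF S False] by blast
    have "0 \<le> x" "x \<noteq> 1" using x(1) \<eta> by (auto simp: S_def)
    then have "0 < W x" using nn z by (metis order_le_less)
    then obtain c where "0 < ereal c" "ereal c < W x" by (metis ereal_dense2 zero_ereal_def)
    then show ?thesis using x(2) by (intro exI[of _ c]) (auto intro: less_imp_le order_less_le_trans)
  qed
  then obtain c where c: "c > 0" "\<And>r. r \<in> S \<Longrightarrow> ereal c \<le> W r" by blast
  have "ereal (min c \<beta>) \<le> W r" if "r \<ge> 0" "\<bar>r\<^sup>2 - 1\<bar> \<ge> \<eta>" for r
  proof (cases "r \<le> M")
    case True
    then have "ereal c \<le> W r" using that by (intro c) (auto simp: S_def)
    then show ?thesis by (meson ereal_less_eq(3) min.cobounded1 order_trans)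
  next
    case False
    then have "ereal \<beta> \<le> W r" by (intro inf) auto
    then show ?thesis by (meson ereal_less_eq(3) min.cobounded2 order_trans)
  qed
  then show ?thesis using c \<beta> by (intro exI[of _ "min c \<beta>"]) auto
qed

section \<open>Lower bound\<close>

text \<open>Each bond is an edge of at most two cells and enters each of them with factor 1/2. Bonds
  along a boundary may be used only once, hence the inequality.\<close>

lemma (in slice_argument) cell_sum_le_bond_sum:
  assumes e: "\<And>u v. e u v = (w (cmod u) + w (cmod v) + w (cmod (v - u))) / 2"
    and w: "\<And>r. 0 \<le> r \<Longrightarrow> 0 \<le> w r" and fin: "finite I" "finite J"
  shows "(\<Sum>n\<in>I. \<Sum>k\<in>J. EU n k + ED n k)
    \<le> bond_sum L H (\<lambda>p q. w (cmod (y (fst p) (snd p) - y (fst q) (snd q))))"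
proof -
  define b where "b u p = (if p \<in> box L H \<and> p + u \<in> box L H
    then w (cmod (y (fst p) (snd p) - y (fst (p + u)) (snd (p + u)))) else 0)" for u p
  define T where "T u = (\<Sum>p\<in>box L H. b u p)" for u
  have b0: "0 \<le> b u p" for u p by (simp add: b_def w)
  have shift: "(\<Sum>n\<in>I. \<Sum>k\<in>J. b u (n + i, k + j)) \<le> T u" for u i j
  proof -
    have "(\<Sum>n\<in>I. \<Sum>k\<in>J. b u (n + i, k + j)) = (\<Sum>p\<in>I \<times> J. b u (p + (i, j)))"
      by (simp add: sum.cartesian_product case_prod_beta plus_prod_def)
    also have "\<dots> = (\<Sum>p\<in>(\<lambda>p. p + (i, j)) ` (I \<times> J). b u p)"
      by (subst sum.reindex) (auto simp: inj_on_def)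
    also have "\<dots> \<le> (\<Sum>p\<in>(\<lambda>p. p + (i, j)) ` (I \<times> J) \<union> box L H. b u p)"
      using fin b0 by (intro sum_mono2) auto
    also have "\<dots> = T u" unfolding T_def
      using fin by (intro sum.mono_neutral_right) (auto simp: b_def)
    finally show ?thesis .
  qed
  have i: "ins n k \<longleftrightarrow> (n, k) \<in> box L H" for n k by (simp add: ins_def box_def)
  have cell: "EU n k + ED n k \<le> (b (1,0) (n + 0, k + 0) + b (0,1) (n + 0, k + 0) + b (-1,1) (n + 1, k + 0)
      + b (1,0) (n + 0, k + 1) + b (0,1) (n + 1, k + 0) + b (-1,1) (n + 1, k + 0)) / 2" for n k
  proof -
    have "EU n k \<le> (b (1,0) (n, k) + b (0,1) (n, k) + b (-1,1) (n + 1, k)) / 2"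
    proof (cases "insU n k")
      case True
      then show ?thesis unfolding insU_def i
        by (simp add: EU_def insU_def i e b_def norm_minus_commute)
    next
      case False
      then show ?thesis using b0[of "(1,0)"] b0[of "(0,1)"] b0[of "(-1,1)"] by (simp add: EU_def)
    qed
    moreover have "ED n k \<le> (b (1,0) (n, k + 1) + b (0,1) (n + 1, k) + b (-1,1) (n + 1, k)) / 2"
    proof (cases "insD n k")
      case True
      then show ?thesis unfolding insD_def i
        by (simp add: ED_def insD_def i e b_def norm_minus_commute)
    next
      case False
      then show ?thesis using b0[of "(1,0)"] b0[of "(0,1)"] b0[of "(-1,1)"] by (simp add: ED_def)
    qed
    ultimately show ?thesis by (simp add: add_divide_distrib)
  qed
  have "(\<Sum>n\<in>I. \<Sum>k\<in>J. EU n k + ED n k) \<le> (\<Sum>n\<in>I. \<Sum>k\<in>J. (b (1,0) (n + 0, k + 0) + b (0,1) (n + 0, k + 0) + b (-1,1) (n + 1, k + 0)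
      + b (1,0) (n + 0, k + 1) + b (0,1) (n + 1, k + 0) + b (-1,1) (n + 1, k + 0)) / 2)"
    by (intro sum_mono cell)
  also have "\<dots> \<le> T (1,0) + T (0,1) + T (-1,1)"
    unfolding sum_divide_distrib[symmetric] sum.distrib
    using shift[of "(1,0)" 0 0] shift[of "(0,1)" 0 0] shift[of "(-1,1)" 1 0]
      shift[of "(1,0)" 0 1] shift[of "(0,1)" 1 0] by (simp add: field_simps)
  also have "\<dots> = (\<Sum>u\<in>bond_dirs. T u)" by (simp add: bond_dirs_def)
  also have "\<dots> = bond_sum L H (\<lambda>p q. w (cmod (y (fst p) (snd p) - y (fst q) (snd q))))"
    unfolding bond_sum_def T_def by (subst sum.swap) (intro sum.cong refl, simp add: b_def)
  finally show ?thesis .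
qed

section \<open>Cell energies and the discrete lower bound\<close>

context lattice_angle
begin

definition "cube = p1 ^ 3 + p2 ^ 3 + p3 ^ 3"

text \<open>Coefficient of the cubed strain in the energy per site. With r^2 - 1 = 2 e p + O(e^2) on
  a bond, the cubic term of the potential gives 8 b times \<open>cube\<close>, and the second-order
  part of r^2 - 1 enters the quadratic term as \<alpha> / 2. In \<open>elastic\<close>,
  \<open>\<gamma> * \<kappa>\<close> is the area per site.\<close>

abbreviation "cubic \<alpha> b \<equiv> 8 * b * cube + \<alpha> / 2"
abbreviation "elastic l \<alpha> b a eps \<equiv> l / (\<gamma> * \<kappa>) * (\<alpha> / 2 * a\<^sup>2 + cubic \<alpha> b * sqrt eps * a ^ 3)"

text \<open>The tangents at 2 \<tau> p have slopes proportional to \<open>p1\<close>,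
  \<open>p2\<close>, \<open>p3\<close>, so their sum involves the edges only through p1 x + p2 y +
  p3 z, which is the squared stretch of \<open>e\<^sub>1\<close> minus 1. Dropping the imaginary
  part bounds it below by (1 + t)^2 - 1, and convexity linearises this at \<tau>. Since
  \<open>p2\<close> is not positive, the combination must be formed before anything is
  estimated.\<close>

lemma elastic_cell:
  fixes w :: "real \<Rightarrow> real"
  assumes tangent: "\<And>r p. 0 \<le> r \<Longrightarrow> \<bar>r\<^sup>2 - 1\<bar> \<le> \<eta> \<Longrightarrow> \<bar>p\<bar> \<le> 1 \<Longrightarrow>
      4 * a * \<tau>\<^sup>2 * p\<^sup>2 + 8 * b * \<tau> ^ 3 * p ^ 3 + 4 * a * \<tau> * p * ((r\<^sup>2 - 1) - 2 * \<tau> * p) - K * \<tau> ^ 4 \<le> w r"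
    and ab: "0 \<le> a" "0 \<le> \<tau>"
    and r: "\<bar>(cmod u)\<^sup>2 - 1\<bar> \<le> \<eta>" "\<bar>(cmod v)\<^sup>2 - 1\<bar> \<le> \<eta>" "\<bar>(cmod (v - u))\<^sup>2 - 1\<bar> \<le> \<eta>"
  shows "4 * a * \<tau>\<^sup>2 + (8 * b * cube + 4 * a) * \<tau> ^ 3 - 3 * K * \<tau> ^ 4
      + 8 * a * \<tau> * (1 + \<tau>) * (Re (u - of_real \<mu> * v) / \<kappa> - 1 - \<tau>)
    \<le> w (cmod u) + w (cmod v) + w (cmod (v - u))"
proof -
  define t where "t = Re (u - of_real \<mu> * v) / \<kappa> - 1"
  define x y z where "x = (cmod u)\<^sup>2 - 1" and "y = (cmod v)\<^sup>2 - 1" and "z = (cmod (v - u))\<^sup>2 - 1"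
  have "(1 + t)\<^sup>2 \<le> (cmod (u - of_real \<mu> * v))\<^sup>2 / \<kappa>\<^sup>2"
    unfolding t_def by (simp add: power_divide divide_right_mono cmod_power2)
  also have "\<dots> = p1 * x + p2 * y + p3 * z + (p1 + p2 + p3)"
    unfolding metric_identity x_def y_def z_def by (simp add: algebra_simps)
  finally have "(1 + t)\<^sup>2 - 1 \<le> p1 * x + p2 * y + p3 * z" unfolding sum_p by simp
  moreover have "2 * (1 + \<tau>) * t - \<tau>\<^sup>2 \<le> (1 + t)\<^sup>2 - 1"
    using zero_le_power2[of "t - \<tau>"] by (simp add: power2_eq_square algebra_simps)
  ultimately have "2 * (1 + \<tau>) * t - \<tau>\<^sup>2 \<le> p1 * x + p2 * y + p3 * z" by linarith
  then have "4 * a * \<tau> * (2 * (1 + \<tau>) * t - \<tau>\<^sup>2) \<le> 4 * a * \<tau> * (p1 * x + p2 * y + p3 * z)"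
    using ab by (intro mult_left_mono) auto
  moreover have
    "4 * a * \<tau>\<^sup>2 * p1\<^sup>2 + 8 * b * \<tau> ^ 3 * p1 ^ 3 + 4 * a * \<tau> * p1 * (x - 2 * \<tau> * p1) - K * \<tau> ^ 4 \<le> w (cmod u)"
    "4 * a * \<tau>\<^sup>2 * p2\<^sup>2 + 8 * b * \<tau> ^ 3 * p2 ^ 3 + 4 * a * \<tau> * p2 * (y - 2 * \<tau> * p2) - K * \<tau> ^ 4 \<le> w (cmod v)"
    "4 * a * \<tau>\<^sup>2 * p3\<^sup>2 + 8 * b * \<tau> ^ 3 * p3 ^ 3 + 4 * a * \<tau> * p3 * (z - 2 * \<tau> * p3) - K * \<tau> ^ 4 \<le> w (cmod (v - u))"
    unfolding x_def y_def z_def by (intro tangent r abs_p_le norm_ge_zero)+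
  moreover have "4 * a * \<tau>\<^sup>2 * p1\<^sup>2 + 8 * b * \<tau> ^ 3 * p1 ^ 3 + 4 * a * \<tau> * p1 * (x - 2 * \<tau> * p1) - K * \<tau> ^ 4
     + (4 * a * \<tau>\<^sup>2 * p2\<^sup>2 + 8 * b * \<tau> ^ 3 * p2 ^ 3 + 4 * a * \<tau> * p2 * (y - 2 * \<tau> * p2) - K * \<tau> ^ 4)
     + (4 * a * \<tau>\<^sup>2 * p3\<^sup>2 + 8 * b * \<tau> ^ 3 * p3 ^ 3 + 4 * a * \<tau> * p3 * (z - 2 * \<tau> * p3) - K * \<tau> ^ 4)
    = 4 * a * \<tau> * (p1 * x + p2 * y + p3 * z) - 4 * a * \<tau>\<^sup>2 * (p1\<^sup>2 + p2\<^sup>2 + p3\<^sup>2) + 8 * b * \<tau> ^ 3 * cube - 3 * K * \<tau> ^ 4"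
    unfolding cube_def by (simp add: power2_eq_square algebra_simps)
  moreover have "4 * a * \<tau>\<^sup>2 + (8 * b * cube + 4 * a) * \<tau> ^ 3 - 3 * K * \<tau> ^ 4 + 8 * a * \<tau> * (1 + \<tau>) * (t - \<tau>)
    = 4 * a * \<tau> * (2 * (1 + \<tau>) * t - \<tau>\<^sup>2) - 4 * a * \<tau>\<^sup>2 + 8 * b * \<tau> ^ 3 * cube - 3 * K * \<tau> ^ 4"
    by (simp add: power2_eq_square power3_eq_cube algebra_simps)
  ultimately show ?thesis unfolding sum_p_sq t_def by linarith
qed

text \<open>By the triangle inequality one edge of length at least \<open>2 * Q\<close> forces a
  second one of length at least \<open>Q\<close>; both lie in the tail of the potential.\<close>

lemma long_cell:
  fixes w :: "real \<Rightarrow> real" and u v :: complex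
  assumes w: "\<And>r. 0 \<le> r \<Longrightarrow> 0 \<le> w r" and far: "\<And>r. r \<ge> Q \<Longrightarrow> B \<le> w r" and Q: "Q \<ge> 0"
    and long: "\<bar>Re u\<bar> \<ge> 2 * Q \<or> \<bar>Re v\<bar> \<ge> 2 * Q \<or> \<bar>Re (v - u)\<bar> \<ge> 2 * Q"
  shows "2 * B \<le> w (cmod u) + w (cmod v) + w (cmod (v - u))"
proof -
  have 1: "cmod u \<ge> 2 * Q \<or> cmod v \<ge> 2 * Q \<or> cmod (v - u) \<ge> 2 * Q"
    using long abs_Re_le_cmod[of u] abs_Re_le_cmod[of v] abs_Re_le_cmod[of "v - u"] by linarith
  have 2: "cmod u \<le> cmod v + cmod (v - u)" "cmod v \<le> cmod u + cmod (v - u)" "cmod (v - u) \<le> cmod u + cmod v"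
    using norm_triangle_sub[of u v] norm_triangle_sub[of v u] norm_triangle_ineq4[of v u]
    by (auto simp: norm_minus_commute)
  have "(cmod u \<ge> Q \<and> cmod v \<ge> Q) \<or> (cmod u \<ge> Q \<and> cmod (v - u) \<ge> Q) \<or> (cmod v \<ge> Q \<and> cmod (v - u) \<ge> Q)"
    using 1 2 Q by linarith
  then show ?thesis using w[of "cmod u"] w[of "cmod v"] w[of "cmod (v - u)"]
      far[of "cmod u"] far[of "cmod v"] far[of "cmod (v - u)"] by fastforce
qed

lemma bond_sum_lower_bound:
  fixes w :: "real \<Rightarrow> real"
  assumes \<alpha>: "\<alpha> > 0" and \<beta>: "\<beta> > 0" and w': "\<forall>r\<ge>0. 0 \<le> w r"
    and near': "\<forall>r\<ge>0. \<bar>r\<^sup>2 - 1\<bar> \<le> \<eta>0 \<longrightarrow>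
       \<alpha> / 8 * (r\<^sup>2 - 1)\<^sup>2 + b * (r\<^sup>2 - 1) ^ 3 - C * (r\<^sup>2 - 1) ^ 4 \<le> w r" and \<eta>0: "\<eta>0 > 0" and C: "C \<ge> 0"
    and away: "\<forall>\<eta>>0. \<exists>c>0. \<forall>r\<ge>0. \<bar>r\<^sup>2 - 1\<bar> \<ge> \<eta> \<longrightarrow> c \<le> w r"
    and far': "\<forall>r\<ge>M. \<beta> - C1 / r\<^sup>2 \<le> w r" and C1: "C1 \<ge> 0"
  shows "\<exists>\<tau>0>0. \<exists>K\<ge>0. \<exists>K'\<ge>0. \<forall>\<tau> L H y. 0 < \<tau> \<longrightarrow> \<tau> \<le> \<tau>0 \<longrightarrow> 0 \<le> L \<longrightarrow> 3 \<le> H / \<gamma> \<longrightarrow>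
    (\<forall>p\<in>box L H. X (fst p) (snd p) \<le> 1 \<or> X (fst p) (snd p) \<ge> L - 1 \<longrightarrow> Re (y p) = (1 + \<tau>) * X (fst p) (snd p)) \<longrightarrow>
    0 \<le> \<alpha> / 2 * \<tau>\<^sup>2 + cubic \<alpha> b * \<tau> ^ 3 - K * \<tau> ^ 4 \<and>
    (H / \<gamma> - 3) * min ((\<alpha> / 2 * \<tau>\<^sup>2 + cubic \<alpha> b * \<tau> ^ 3 - K * \<tau> ^ 4) * ((L - 6) / \<kappa> - 1))
       (2 * (\<beta> - K' * \<tau>\<^sup>2)) \<le> bond_sum L H (\<lambda>p q. w (cmod (y p - y q)))"
proof -
  note w = w'[rule_format] and near = near'[rule_format] and far = far'[rule_format]
  obtain \<eta>1 K1 where \<eta>1: "\<eta>1 > 0" "K1 \<ge> 0" and tan: "\<And>z \<tau> p. \<bar>z\<bar> \<le> \<eta>1 \<Longrightarrow> 0 \<le> \<tau> \<Longrightarrow> \<tau> \<le> \<eta>1 \<Longrightarrow> \<bar>p\<bar> \<le> 1 \<Longrightarrow>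
    4 * (\<alpha>/8) * \<tau>\<^sup>2 * p\<^sup>2 + 8 * b * \<tau> ^ 3 * p ^ 3 + 4 * (\<alpha>/8) * \<tau> * p * (z - 2 * \<tau> * p) - K1 * \<tau> ^ 4
      \<le> (\<alpha>/8) * z\<^sup>2 + b * z ^ 3 - C * z ^ 4"
    using tangent_lower_bound[of "\<alpha>/8" C b] \<alpha> C by auto
  define \<eta> where "\<eta> = min 1 (min \<eta>0 \<eta>1)"
  have \<eta>: "\<eta> > 0" "\<eta> \<le> 1" "\<eta> \<le> \<eta>0" "\<eta> \<le> \<eta>1" using \<eta>0 \<eta>1 by (auto simp: \<eta>_def)
  obtain c where c: "c > 0" "\<And>r. r \<ge> 0 \<Longrightarrow> \<bar>r\<^sup>2 - 1\<bar> \<ge> \<eta> \<Longrightarrow> c \<le> w r" using away \<eta>(1) by blast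
  define k where "k = cubic \<alpha> b"
  \<comment> \<open>The strain threshold will be \<rho> / \<tau>. The tangent slope is \<alpha>
    \<tau> (1 + \<tau>), so at the threshold the linear term is at most c / 4, and \<open>F\<close>
    at most c / 4 leaves the c / 2 that a broken cell is known to cost.\<close>
  define \<rho> where "\<rho> = c / (8 * \<alpha>)"
  have \<rho>: "\<rho> > 0" using c \<alpha> by (simp add: \<rho>_def)
  define M' where "M' = max M 0 + 3"
  \<comment> \<open>The last four entries serve in turn the tangent bound, \<open>0 \<le> F\<close>,
    \<open>F \<le> c / 4\<close>, and \<open>Q \<ge> M'\<close>, which places long edges in the
    tail.\<close>
  define \<tau>0 where "\<tau>0 = Min {1, \<eta>1, \<alpha> / (2 * (\<bar>k\<bar> + 3 * K1 + 1)), c / (4 * (\<alpha> / 2 + \<bar>k\<bar> + 1)), \<kappa> * \<rho> / (6 * M')}"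
  have M': "M' \<ge> 3" "M' \<ge> M" by (auto simp: M'_def)
  have kk: "\<bar>k\<bar> + 3 * K1 + 1 > 0" "\<alpha> / 2 + \<bar>k\<bar> + 1 > 0" using \<eta>1 \<alpha> by auto
  have \<tau>0: "\<tau>0 > 0" using \<eta>1 \<alpha> c \<rho> kappa_pos M' kk by (simp add: \<tau>0_def)
  \<comment> \<open>Makes \<open>K' * \<tau>\<^sup>2\<close> the tail error C1 / Q^2 at Q = \<kappa>
    \<rho> / (6 \<tau>).\<close>
  define K' where "K' = C1 * 36 / (\<kappa> * \<rho>)\<^sup>2"
  have K0: "3 * K1 \<ge> 0" "K' \<ge> 0" using \<eta>1 C1 by (auto simp: K'_def)
  show ?thesis
  proof (rule exI[of _ \<tau>0], rule conjI, rule \<tau>0, rule exI[of _ "3 * K1"], rule conjI, rule K0,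
      rule exI[of _ K'], rule conjI, rule K0, intro allI impI conjI)
    fix \<tau> L H :: real and y :: "int \<times> int \<Rightarrow> complex"
    assume \<tau>: "0 < \<tau>" "\<tau> \<le> \<tau>0" and L: "0 \<le> L" and H: "3 \<le> H / \<gamma>"
      and pinned: "\<forall>p\<in>box L H. X (fst p) (snd p) \<le> 1 \<or> X (fst p) (snd p) \<ge> L - 1 \<longrightarrow> Re (y p) = (1 + \<tau>) * X (fst p) (snd p)"
    have t: "\<tau> \<le> 1" "\<tau> \<le> \<eta>1" "\<tau> \<le> \<alpha> / (2 * (\<bar>k\<bar> + 3 * K1 + 1))" "\<tau> \<le> c / (4 * (\<alpha> / 2 + \<bar>k\<bar> + 1))" "\<tau> \<le> \<kappa> * \<rho> / (6 * M')"
      using \<tau>(2) by (auto simp: \<tau>0_def)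
    define F where "F = \<alpha> / 2 * \<tau>\<^sup>2 + k * \<tau> ^ 3 - 3 * K1 * \<tau> ^ 4"
    define A where "A = \<alpha> * \<tau> * (1 + \<tau>)"
    define Q where "Q = \<kappa> * \<rho> / (6 * \<tau>)"
    define br where "br u v = (\<not> (\<bar>(cmod u)\<^sup>2 - 1\<bar> \<le> \<eta> \<and> \<bar>(cmod v)\<^sup>2 - 1\<bar> \<le> \<eta> \<and> \<bar>(cmod (v - u))\<^sup>2 - 1\<bar> \<le> \<eta>))" for u v
    define e where "e u v = (w (cmod u) + w (cmod v) + w (cmod (v - u))) / 2" for u v
    have F_eq: "F = \<tau>\<^sup>2 * (\<alpha> / 2 + k * \<tau> - 3 * K1 * \<tau>\<^sup>2)"
      by (simp add: F_def power2_eq_square power3_eq_cube power4_eq_xxxx algebra_simps)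
    have kt: "\<bar>k * \<tau>\<bar> \<le> \<bar>k\<bar> * \<tau>" "\<bar>k\<bar> * \<tau> \<le> \<bar>k\<bar>" using \<tau> t by (auto simp: abs_mult mult_left_le)
    have K1t: "0 \<le> 3 * K1 * \<tau>\<^sup>2" "3 * K1 * \<tau>\<^sup>2 \<le> 3 * K1 * \<tau>"
      using \<eta>1 \<tau> t by (auto intro!: mult_left_mono simp: power2_eq_square mult_left_le)
    have F0: "0 \<le> F"
    proof -
      have "\<tau> * (2 * (\<bar>k\<bar> + 3 * K1 + 1)) \<le> \<alpha>" using t(3) kk by (simp add: field_simps)
      then have "\<bar>k\<bar> * \<tau> + 3 * K1 * \<tau> + \<tau> \<le> \<alpha> / 2" by (simp add: algebra_simps)
      then show ?thesis unfolding F_eq using kt K1t \<tau> by (intro mult_nonneg_nonneg) auto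
    qed
    have Fc: "F \<le> c / 4"
    proof -
      have "F \<le> \<tau>\<^sup>2 * (\<alpha> / 2 + \<bar>k\<bar> + 1)" unfolding F_eq using kt K1t by (intro mult_left_mono) auto
      also have "\<dots> \<le> \<tau> * (\<alpha> / 2 + \<bar>k\<bar> + 1)"
        using kk t \<tau> by (intro mult_right_mono) (auto simp: power2_eq_square mult_left_le)
      also have "\<dots> \<le> c / 4" using t(4) kk by (simp add: field_simps)
      finally show ?thesis .
    qed
    have Q3: "Q \<ge> M'"
    proof -
      have "M' * (6 * \<tau>) \<le> \<kappa> * \<rho>" using t(5) M' by (simp add: field_simps)
      then show ?thesis using \<tau> by (simp add: Q_def field_simps)
    qed
    have AT: "A * (\<rho> / \<tau>) \<le> c / 4"
    proof -
      have "A * (\<rho> / \<tau>) = c / 8 * (1 + \<tau>)" using \<tau> \<alpha> by (simp add: A_def \<rho>_def field_simps)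
      also have "\<dots> \<le> c / 8 * 2" using t c by (intro mult_left_mono) auto
      finally show ?thesis by simp
    qed
    have RT: "2 * Q = \<kappa> * (\<rho> / \<tau>) / 3" by (simp add: Q_def mult.commute)
    interpret slice_argument \<phi> L H \<tau> F A "\<rho> / \<tau>" "2 * Q" "\<beta> - K' * \<tau>\<^sup>2" "\<lambda>n k. y (n, k)" e br
    proof
      show "Re (y (n, k)) = (1 + \<tau>) * X n k" if "0 < X n k" "X n k < L" "0 < Z n k" "Z n k < H"
        "X n k \<le> 1 \<or> X n k \<ge> L - 1" for n k
        using pinned[rule_format, of "(n, k)"] that by (simp add: box_def)
      show "0 \<le> \<tau>" "0 \<le> F" "0 \<le> A" using \<tau> F0 \<alpha> by (auto simp: A_def)
      show "0 \<le> e u v" for u v by (simp add: e_def w)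
      show "F + A * (\<rho> / \<tau>) \<le> e u v" if "br u v" for u v
      proof -
        have "c \<le> w (cmod u) \<or> c \<le> w (cmod v) \<or> c \<le> w (cmod (v - u))"
          using that c(2)[of "cmod u"] c(2)[of "cmod v"] c(2)[of "cmod (v - u)"] by (auto simp: br_def)
        then have "c / 2 \<le> e u v"
          unfolding e_def using w[of "cmod u"] w[of "cmod v"] w[of "cmod (v - u)"] by auto
        then show ?thesis using Fc AT by linarith
      qed
      show "F + A * (Re (u - of_real \<mu> * v) / \<kappa> - 1 - \<tau>) \<le> 2 * e u v" if "\<not> br u v" for u v
      proof -
        have tg: "4 * (\<alpha>/8) * \<tau>\<^sup>2 * p\<^sup>2 + 8 * b * \<tau> ^ 3 * p ^ 3 + 4 * (\<alpha>/8) * \<tau> * p * ((r\<^sup>2 - 1) - 2 * \<tau> * p) - K1 * \<tau> ^ 4 \<le> w r"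
          if "0 \<le> r" "\<bar>r\<^sup>2 - 1\<bar> \<le> \<eta>" "\<bar>p\<bar> \<le> 1" for r p
          using tan[of "r\<^sup>2 - 1" \<tau> p] near[of r] that \<eta> \<tau> t by linarith
        have e2: "2 * e u v = w (cmod u) + w (cmod v) + w (cmod (v - u))" by (simp add: e_def)
        have r: "\<bar>(cmod u)\<^sup>2 - 1\<bar> \<le> \<eta>" "\<bar>(cmod v)\<^sup>2 - 1\<bar> \<le> \<eta>" "\<bar>(cmod (v - u))\<^sup>2 - 1\<bar> \<le> \<eta>"
          using that by (auto simp: br_def)
        have "0 \<le> \<alpha> / 8" "0 \<le> \<tau>" using \<alpha> \<tau> by auto
        from elastic_cell[OF tg this r] show ?thesis
          unfolding F_def A_def k_def e2 by simp
      qed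
      show "br u v \<and> \<beta> - K' * \<tau>\<^sup>2 \<le> e u v"
        if "\<bar>Re u\<bar> \<ge> 2 * Q \<or> \<bar>Re v\<bar> \<ge> 2 * Q \<or> \<bar>Re (v - u)\<bar> \<ge> 2 * Q" for u v
      proof
        have big: "\<not> (\<bar>(cmod x)\<^sup>2 - 1\<bar> \<le> \<eta>)" if "\<bar>Re x\<bar> \<ge> 2 * Q" for x
        proof -
          have "cmod x \<ge> 2" using that abs_Re_le_cmod[of x] Q3 M' by linarith
          then have "(cmod x)\<^sup>2 \<ge> 2\<^sup>2" by (intro power_mono) auto
          then show ?thesis using \<eta> by auto
        qed
        show "br u v" using that big by (auto simp: br_def)
        have "C1 / Q\<^sup>2 = K' * \<tau>\<^sup>2" using \<tau> by (simp add: K'_def Q_def power_divide power_mult_distrib field_simps)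
        moreover have "\<beta> - C1 / Q\<^sup>2 \<le> w r" if "r \<ge> Q" for r
        proof -
          have "C1 / r\<^sup>2 \<le> C1 / Q\<^sup>2" using that Q3 M' C1 by (intro divide_left_mono power_mono) auto
          then show ?thesis using far[of r] that Q3 M' by linarith
        qed
        ultimately have "2 * (\<beta> - K' * \<tau>\<^sup>2) \<le> w (cmod u) + w (cmod v) + w (cmod (v - u))"
          using w Q3 M' that by (intro long_cell[of w Q]) auto
        then show "\<beta> - K' * \<tau>\<^sup>2 \<le> e u v" by (simp add: e_def)
      qed
      show "1 + \<tau> < 2 * Q" using Q3 M' t by linarith
      show "3 * (2 * Q) \<le> \<kappa> * (1 + \<tau> + \<rho> / \<tau>)"
        unfolding RT using kappa_pos \<tau> by (simp add: distrib_left)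
    qed
    obtain I J where IJ: "finite I" "finite J"
      "(H / \<gamma> - 3) * min (F * ((L - 6) / \<kappa> - 1)) (2 * (\<beta> - K' * \<tau>\<^sup>2)) \<le> (\<Sum>n\<in>I. \<Sum>k\<in>J. EU n k + ED n k)"
      using cell_sum_lower_bound[OF L H] by blast
    note IJ(3)
    also have "(\<Sum>n\<in>I. \<Sum>k\<in>J. EU n k + ED n k) \<le> bond_sum L H (\<lambda>p q. w (cmod (y p - y q)))"
      using cell_sum_le_bond_sum[of w I J] IJ w by (simp add: e_def)
    finally show "(H / \<gamma> - 3) * min ((\<alpha> / 2 * \<tau>\<^sup>2 + cubic \<alpha> b * \<tau> ^ 3 - 3 * K1 * \<tau> ^ 4) * ((L - 6) / \<kappa> - 1))
       (2 * (\<beta> - K' * \<tau>\<^sup>2)) \<le> bond_sum L H (\<lambda>p q. w (cmod (y p - y q)))"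
      unfolding F_def k_def .
    show "0 \<le> \<alpha> / 2 * \<tau>\<^sup>2 + cubic \<alpha> b * \<tau> ^ 3 - 3 * K1 * \<tau> ^ 4"
      using F0 unfolding F_def k_def .
  qed
qed

end

text \<open>\<open>F\<close> is of order eps, so scaling leaves a quantity of order 1. The slices
  lost at top and bottom and the cells lost at the lateral sides are relative losses of order eps,
  as is the correction \<open>K'\<close> of the crack cost.\<close>

lemma lower_asymptotics:
  fixes \<gamma> \<kappa> l a \<alpha> \<beta> k K K' :: real
  assumes g: "0 < \<gamma>" "\<gamma> \<le> 1" and kp: "0 < \<kappa>" and l: "0 \<le> l" and K: "0 \<le> K" "0 \<le> K'"
    and ab: "0 \<le> \<alpha>" "0 \<le> \<beta>" "0 \<le> a"
  shows "\<exists>C\<ge>0. \<forall>eps F. 0 < eps \<longrightarrow> eps \<le> 1/3 \<longrightarrow>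
    F = \<alpha> / 2 * (sqrt eps * a)\<^sup>2 + k * (sqrt eps * a) ^ 3 - K * (sqrt eps * a) ^ 4 \<longrightarrow> 0 \<le> F \<longrightarrow>
    min (l / (\<gamma> * \<kappa>) * (\<alpha> / 2 * a\<^sup>2 + k * sqrt eps * a ^ 3)) (2 * \<beta> / \<gamma>) - C * eps
    \<le> eps * (((1 / eps) / \<gamma> - 3) * min (F * ((l / eps - 6) / \<kappa> - 1)) (2 * (\<beta> - K' * (sqrt eps * a)\<^sup>2)))"
proof -
  define D where "D = (6 / \<kappa> + 1) / \<gamma> + 3 * l / \<kappa>"
  define fm where "fm = \<alpha> / 2 * a\<^sup>2 + \<bar>k\<bar> * a ^ 3"
  define C1 where "C1 = l / (\<gamma> * \<kappa>) * (K * a ^ 4) + D * fm"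
  define C2 where "C2 = 6 * \<beta> + 2 * K' * a\<^sup>2 / \<gamma>"
  have D0: "0 \<le> D" using g kp l by (simp add: D_def)
  have fm0: "0 \<le> fm" using ab by (simp add: fm_def)
  have C0: "0 \<le> C1" "0 \<le> C2" using D0 fm0 g kp l K ab by (auto simp: C1_def C2_def)
  have "min (l / (\<gamma> * \<kappa>) * (\<alpha> / 2 * a\<^sup>2 + k * sqrt eps * a ^ 3)) (2 * \<beta> / \<gamma>) - (C1 + C2) * eps
    \<le> eps * (((1 / eps) / \<gamma> - 3) * min (F * ((l / eps - 6) / \<kappa> - 1)) (2 * (\<beta> - K' * (sqrt eps * a)\<^sup>2)))"
    if e: "0 < eps" "eps \<le> 1/3" and F: "F = \<alpha> / 2 * (sqrt eps * a)\<^sup>2 + k * (sqrt eps * a) ^ 3 - K * (sqrt eps * a) ^ 4"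
      and F0: "0 \<le> F" for eps F
  proof -
    define s where "s = sqrt eps"
    have s: "s\<^sup>2 = eps" "0 < s" "s \<le> 1" using e by (auto simp: s_def)
    define f where "f = \<alpha> / 2 * a\<^sup>2 + k * s * a ^ 3 - K * a ^ 4 * eps"
    have s34: "s ^ 3 = s * eps" "s ^ 4 = eps * eps"
      using s(1) by (auto simp: power2_eq_square power3_eq_cube power4_eq_xxxx mult.assoc)
    have Ff: "F = eps * f"
      unfolding F s_def[symmetric] f_def power_mult_distrib s s34 by (simp add: algebra_simps)
    have f0: "0 \<le> f" using F0 e by (simp add: Ff zero_le_mult_iff)
    have ffm: "f \<le> fm"
    proof -
      have "k * s * a ^ 3 \<le> \<bar>k\<bar> * 1 * a ^ 3"
        using s ab by (intro mult_right_mono mult_mono) auto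
      moreover have "0 \<le> K * a ^ 4 * eps" using K e by simp
      ultimately show ?thesis by (simp add: f_def fm_def)
    qed
    define G where "G = 1 / \<gamma> - 3 * eps"
    \<comment> \<open>Together with eps at most 1/3 this makes \<open>G\<close> nonnegative, so that
      it can be moved into the minimum.\<close>
    have "1 \<le> 1 / \<gamma>" using g by simp
    then have G0: "0 \<le> G" using e unfolding G_def by linarith
    have G1: "G \<le> 1 / \<gamma>" using e by (simp add: G_def)
    have e1: "eps * ((1 / eps) / \<gamma> - 3) = G" using e by (simp add: G_def field_simps)
    have e2: "F * ((l / eps - 6) / \<kappa> - 1) = f * ((l - 6 * eps) / \<kappa> - eps)"
      using e kp by (simp add: Ff field_simps)
    have A: "l / (\<gamma> * \<kappa>) * (\<alpha> / 2 * a\<^sup>2 + k * s * a ^ 3) - C1 * eps \<le> G * (f * ((l - 6 * eps) / \<kappa> - eps))"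
    proof -
      have "l / (\<gamma> * \<kappa>) - eps * D \<le> G * ((l - 6 * eps) / \<kappa> - eps)"
      proof -
        have "G * ((l - 6 * eps) / \<kappa> - eps) = l / (\<gamma> * \<kappa>) - eps * D + 3 * eps\<^sup>2 * (6 / \<kappa> + 1)"
          unfolding G_def D_def using g kp by (simp add: field_simps power2_eq_square)
        moreover have "0 \<le> 3 * eps\<^sup>2 * (6 / \<kappa> + 1)" using kp by simp
        ultimately show ?thesis by linarith
      qed
      then have "f * (l / (\<gamma> * \<kappa>) - eps * D) \<le> f * (G * ((l - 6 * eps) / \<kappa> - eps))"
        using f0 by (rule mult_left_mono)
      moreover have "eps * D * f \<le> eps * D * fm" using ffm e D0 by (intro mult_left_mono) auto
      moreover have "(P - K * a ^ 4 * eps) * (q - eps * D) = q * P - q * (K * a ^ 4) * eps - eps * D * (P - K * a ^ 4 * eps)" for P q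
        by (simp add: algebra_simps)
      then have "f * (l / (\<gamma> * \<kappa>) - eps * D) = l / (\<gamma> * \<kappa>) * (\<alpha> / 2 * a\<^sup>2 + k * s * a ^ 3) - l / (\<gamma> * \<kappa>) * (K * a ^ 4) * eps - eps * D * f"
        unfolding f_def .
      ultimately show ?thesis unfolding C1_def distrib_right by (simp add: mult_ac)
    qed
    have B: "2 * \<beta> / \<gamma> - C2 * eps \<le> G * (2 * (\<beta> - K' * (s * a)\<^sup>2))"
    proof -
      have "G * (K' * a\<^sup>2 * eps) \<le> 1 / \<gamma> * (K' * a\<^sup>2 * eps)" using G1 K e by (intro mult_right_mono) auto
      moreover have "G * (2 * (\<beta> - K' * (s * a)\<^sup>2)) = 2 * \<beta> / \<gamma> - 6 * \<beta> * eps - 2 * (G * (K' * a\<^sup>2 * eps))"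
        unfolding power_mult_distrib s G_def by (simp add: algebra_simps)
      moreover have "C2 * eps = 6 * \<beta> * eps + 2 * (1 / \<gamma> * (K' * a\<^sup>2 * eps))" by (simp add: C2_def algebra_simps)
      ultimately show ?thesis by linarith
    qed
    have C12: "0 \<le> C1 * eps" "0 \<le> C2 * eps" using C0 e by auto
    have "eps * (((1 / eps) / \<gamma> - 3) * min (F * ((l / eps - 6) / \<kappa> - 1)) (2 * (\<beta> - K' * (s * a)\<^sup>2)))
      = min (G * (f * ((l - 6 * eps) / \<kappa> - eps))) (G * (2 * (\<beta> - K' * (s * a)\<^sup>2)))"
      unfolding mult.assoc[symmetric] e1 unfolding mult.assoc e2 using G0 by (simp add: min_mult_distrib_left)
    then show ?thesis
      using A B C12 unfolding s_def[symmetric] distrib_right by linarith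
  qed
  then show ?thesis using C0 by (intro exI[of _ "C1 + C2"]) auto
qed

context lattice_angle
begin

lemma energy_lower_bound:
  fixes W :: "real \<Rightarrow> ereal"
  assumes a: "a > 0" and l: "l > 0" and \<beta>: "\<beta> > 0"
    and W_nonneg: "\<forall>r\<ge>0. W r \<ge> 0"
    and W_zero: "\<forall>r\<ge>0. W r = 0 \<longleftrightarrow> r = 1"
    and W_cont: "continuous_on {0..} W"
    and near: "\<And>r. 0 \<le> r \<Longrightarrow> \<bar>r\<^sup>2 - 1\<bar> \<le> \<eta>0 \<Longrightarrow>
       ereal (\<alpha> / 8 * (r\<^sup>2 - 1)\<^sup>2 + b * (r\<^sup>2 - 1) ^ 3 - C * (r\<^sup>2 - 1) ^ 4) \<le> W r"
    and \<eta>0: "0 < \<eta>0" "\<eta>0 \<le> 1" and C: "C \<ge> 0" and \<alpha>: "\<alpha> > 0"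
    and far: "\<And>r. r \<ge> M \<Longrightarrow> ereal (\<beta> - C1 / r\<^sup>2) \<le> W r" and C1: "C1 \<ge> 0"
  shows "\<exists>C eps0. eps0 > 0 \<and> (\<forall>eps y. 0 < eps \<longrightarrow> eps < eps0 \<longrightarrow>
    (\<forall>x\<in>sites \<phi> l eps. Re x \<le> eps \<or> Re x \<ge> l - eps \<longrightarrow> Re (y x) = (1 + sqrt eps * a) * Re x) \<longrightarrow>
    ereal (min (elastic l \<alpha> b a eps) (2 * \<beta> / \<gamma>) - C * eps)
      \<le> scaled_energy W \<phi> l eps y)"
proof -
  \<comment> \<open>A truncation level above both lower bounds that must survive: the expansion near
    1, where |r^2 - 1| is at most 1, and the tail below \<beta>.\<close>
  define Bd where "Bd = \<beta> + \<alpha> + \<bar>b\<bar>"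
  have Bd: "Bd > 0" "Bd \<ge> \<beta>" using \<beta> \<alpha> by (auto simp: Bd_def)
  obtain v where v: "\<forall>r\<ge>0. 0 \<le> v r" "\<forall>r\<ge>0. ereal (v r) \<le> W r"
    and vx: "\<And>r x. r \<ge> 0 \<Longrightarrow> x \<le> Bd \<Longrightarrow> ereal x \<le> W r \<Longrightarrow> x \<le> v r"
    using real_envelope[OF W_nonneg, of Bd] Bd by auto
  define M' where "M' = max (max M 1) (2 * C1 / \<beta> + 1)"
  have M': "M' \<ge> 1" "M' \<ge> M" "M' \<ge> 2 * C1 / \<beta> + 1" by (auto simp: M'_def)
  have half: "ereal (\<beta> / 2) \<le> W r" if "r \<ge> M'" for r
  proof -
    have "C1 / r\<^sup>2 \<le> \<beta> / 2"
    proof -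
      have r: "r \<ge> 1" "r \<ge> 2 * C1 / \<beta>" using that M' by auto
      then have "r * 1 \<le> r\<^sup>2" unfolding power2_eq_square by (intro mult_left_mono) auto
      then have "2 * C1 / \<beta> \<le> r\<^sup>2" using r by linarith
      then show ?thesis using \<beta> r by (simp add: field_simps)
    qed
    then have "ereal (\<beta> / 2) \<le> ereal (\<beta> - C1 / r\<^sup>2)" by simp
    also have "\<dots> \<le> W r" using far that M' by auto
    finally show ?thesis .
  qed
  obtain \<tau>0 K K' where \<tau>0: "\<tau>0 > 0" "K \<ge> 0" "K' \<ge> 0" and main: "\<forall>\<tau> L H y. 0 < \<tau> \<longrightarrow> \<tau> \<le> \<tau>0 \<longrightarrow> 0 \<le> L \<longrightarrow> 3 \<le> H / \<gamma> \<longrightarrow>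
    (\<forall>p\<in>box L H. X (fst p) (snd p) \<le> 1 \<or> X (fst p) (snd p) \<ge> L - 1 \<longrightarrow> Re (y p) = (1 + \<tau>) * X (fst p) (snd p)) \<longrightarrow>
    0 \<le> \<alpha> / 2 * \<tau>\<^sup>2 + cubic \<alpha> b * \<tau> ^ 3 - K * \<tau> ^ 4 \<and>
    (H / \<gamma> - 3) * min ((\<alpha> / 2 * \<tau>\<^sup>2 + cubic \<alpha> b * \<tau> ^ 3 - K * \<tau> ^ 4) * ((L - 6) / \<kappa> - 1))
       (2 * (\<beta> - K' * \<tau>\<^sup>2)) \<le> bond_sum L H (\<lambda>p q. v (cmod (y p - y q)))"
  proof -
    have n: "\<alpha> / 8 * (r\<^sup>2 - 1)\<^sup>2 + b * (r\<^sup>2 - 1) ^ 3 - C * (r\<^sup>2 - 1) ^ 4 \<le> v r"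
      if r: "0 \<le> r" "\<bar>r\<^sup>2 - 1\<bar> \<le> \<eta>0" for r
    proof (rule vx[OF r(1) _ near[OF r]])
      define z where "z = r\<^sup>2 - 1"
      have "\<bar>z\<bar> \<le> 1" using r \<eta>0 by (simp add: z_def)
      then have "z\<^sup>2 \<le> 1" "\<bar>z\<bar> ^ 3 \<le> 1" by (auto simp: abs_square_le_1 power_le_one)
      then have "\<alpha> / 8 * z\<^sup>2 \<le> \<alpha> / 8 * 1" "\<bar>b\<bar> * \<bar>z\<bar> ^ 3 \<le> \<bar>b\<bar> * 1" using \<alpha> by (intro mult_left_mono; simp)+
      moreover have "b * z ^ 3 \<le> \<bar>b\<bar> * \<bar>z\<bar> ^ 3" by (metis abs_ge_self abs_mult power_abs)
      moreover have "0 \<le> C * z ^ 4" using C by simp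
      ultimately have "\<alpha> / 8 * z\<^sup>2 + b * z ^ 3 - C * z ^ 4 \<le> \<alpha> / 8 + \<bar>b\<bar>" by linarith
      then show "\<alpha> / 8 * (r\<^sup>2 - 1)\<^sup>2 + b * (r\<^sup>2 - 1) ^ 3 - C * (r\<^sup>2 - 1) ^ 4 \<le> Bd"
        unfolding z_def Bd_def using \<beta> \<alpha> by linarith
    qed
    have aw: "\<exists>c>0. \<forall>r\<ge>0. \<bar>r\<^sup>2 - 1\<bar> \<ge> \<eta> \<longrightarrow> c \<le> v r" if eta: "\<eta> > 0" for \<eta>
    proof -
      obtain c where c: "c > 0" "\<And>r. r \<ge> 0 \<Longrightarrow> \<bar>r\<^sup>2 - 1\<bar> \<ge> \<eta> \<Longrightarrow> ereal c \<le> W r"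
        using positive_away_from_one[OF W_nonneg W_zero W_cont, of "\<beta>/2" M' \<eta>] \<beta> half eta by auto
      have "min c Bd \<le> v r" if "r \<ge> 0" "\<bar>r\<^sup>2 - 1\<bar> \<ge> \<eta>" for r
      proof (rule vx[OF that(1)])
        show "ereal (min c Bd) \<le> W r" using c(2)[OF that] by (meson ereal_less_eq(3) min.cobounded1 order_trans)
      qed simp
      then show ?thesis using c Bd by (intro exI[of _ "min c Bd"]) auto
    qed
    have fr: "\<beta> - C1 / r\<^sup>2 \<le> v r" if "r \<ge> M'" for r
    proof (rule vx)
      have "0 \<le> C1 / r\<^sup>2" using C1 by simp
      then show "\<beta> - C1 / r\<^sup>2 \<le> Bd" using Bd by linarith
    qed (use that M' far in auto)
    have n': "\<forall>r\<ge>0. \<bar>r\<^sup>2 - 1\<bar> \<le> \<eta>0 \<longrightarrow> \<alpha> / 8 * (r\<^sup>2 - 1)\<^sup>2 + b * (r\<^sup>2 - 1) ^ 3 - C * (r\<^sup>2 - 1) ^ 4 \<le> v r"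
      and aw': "\<forall>\<eta>>0. \<exists>c>0. \<forall>r\<ge>0. \<bar>r\<^sup>2 - 1\<bar> \<ge> \<eta> \<longrightarrow> c \<le> v r" and fr': "\<forall>r\<ge>M'. \<beta> - C1 / r\<^sup>2 \<le> v r"
      using n aw fr by auto
    show ?thesis
      using bond_sum_lower_bound[OF \<alpha> \<beta> v(1) n' \<eta>0(1) C aw' fr' C1]
      by (elim exE conjE) (rule that; assumption)
  qed
  obtain D where D: "D \<ge> 0" and low: "\<forall>eps F. 0 < eps \<longrightarrow> eps \<le> 1/3 \<longrightarrow>
    F = \<alpha> / 2 * (sqrt eps * a)\<^sup>2 + cubic \<alpha> b * (sqrt eps * a) ^ 3 - K * (sqrt eps * a) ^ 4 \<longrightarrow> 0 \<le> F \<longrightarrow>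
    min (elastic l \<alpha> b a eps) (2 * \<beta> / \<gamma>) - D * eps
    \<le> eps * (((1 / eps) / \<gamma> - 3) * min (F * ((l / eps - 6) / \<kappa> - 1)) (2 * (\<beta> - K' * (sqrt eps * a)\<^sup>2)))"
    using lower_asymptotics[OF gamma_pos gamma_le_1 kappa_pos less_imp_le[OF l] \<tau>0(2,3)
        less_imp_le[OF \<alpha>] less_imp_le[OF \<beta>] less_imp_le[OF a], of "cubic \<alpha> b"]
    by (elim exE conjE) (rule that; assumption)
  define eps0 where "eps0 = min (1/3) ((\<tau>0 / a)\<^sup>2)"
  show ?thesis
  proof (rule exI[of _ D], rule exI[of _ eps0], intro conjI allI impI)
    show "eps0 > 0" using \<tau>0 a by (simp add: eps0_def)
    fix eps y assume e: "0 < eps" "eps < eps0"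
      and pinned: "\<forall>x\<in>sites \<phi> l eps. Re x \<le> eps \<or> Re x \<ge> l - eps \<longrightarrow> Re (y x) = (1 + sqrt eps * a) * Re x"
    have e3: "eps \<le> 1/3" using e by (simp add: eps0_def)
    define \<tau> where "\<tau> = sqrt eps * a"
    have "sqrt eps \<le> \<tau>0 / a" using e \<tau>0 a by (intro real_le_lsqrt) (auto simp: eps0_def)
    then have \<tau>: "0 < \<tau>" "\<tau> \<le> \<tau>0" using e a by (auto simp: \<tau>_def field_simps)
    have L: "0 \<le> l / eps" using l e by simp
    have H: "3 \<le> (1 / eps) / \<gamma>"
    proof -
      have "3 \<le> 1 / eps" using e e3 by (simp add: field_simps)
      also have "\<dots> \<le> (1 / eps) / \<gamma>" using gamma_pos gamma_le_1 e by (simp add: field_simps)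
      finally show ?thesis .
    qed
    define y' where "y' p = y (pt eps p) / of_real eps" for p
    have "\<forall>p\<in>box (l / eps) (1 / eps). X (fst p) (snd p) \<le> 1 \<or> X (fst p) (snd p) \<ge> l / eps - 1 \<longrightarrow> Re (y' p) = (1 + \<tau>) * X (fst p) (snd p)"
    proof (intro ballI impI)
      fix p assume p: "p \<in> box (l / eps) (1 / eps)" "X (fst p) (snd p) \<le> 1 \<or> X (fst p) (snd p) \<ge> l / eps - 1"
      have "Re (y (pt eps p)) = (1 + sqrt eps * a) * Re (pt eps p)"
        using p e by (intro pinned[rule_format]) (auto simp: sites_eq Re_pt field_simps)
      then show "Re (y' p) = (1 + \<tau>) * X (fst p) (snd p)" using e by (simp add: y'_def Re_pt \<tau>_def field_simps)
    qed
    then have m: "0 \<le> \<alpha> / 2 * \<tau>\<^sup>2 + cubic \<alpha> b * \<tau> ^ 3 - K * \<tau> ^ 4 \<and>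
      ((1 / eps) / \<gamma> - 3) * min ((\<alpha> / 2 * \<tau>\<^sup>2 + cubic \<alpha> b * \<tau> ^ 3 - K * \<tau> ^ 4) * ((l / eps - 6) / \<kappa> - 1))
       (2 * (\<beta> - K' * \<tau>\<^sup>2)) \<le> bond_sum (l / eps) (1 / eps) (\<lambda>p q. v (cmod (y' p - y' q)))"
      by (rule main[THEN spec, THEN spec, THEN spec, THEN spec, THEN mp, THEN mp, THEN mp, THEN mp, THEN mp, OF \<tau> L H])
    have yy: "cmod (y' p - y' q) = cmod (y (pt eps p) - y (pt eps q)) / eps" for p q
      using e unfolding y'_def diff_divide_distrib[symmetric] norm_divide by simp
    have "min (elastic l \<alpha> b a eps) (2 * \<beta> / \<gamma>) - D * eps
      \<le> eps * bond_sum (l / eps) (1 / eps) (\<lambda>p q. v (cmod (y' p - y' q)))"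
      using low[rule_format, OF e(1) e3 refl] m mult_left_mono[OF conjunct2[OF m], of eps] e
      unfolding \<tau>_def[symmetric] by linarith
    then have "ereal (min (elastic l \<alpha> b a eps) (2 * \<beta> / \<gamma>) - D * eps)
      \<le> ereal eps * ereal (bond_sum (l / eps) (1 / eps) (\<lambda>p q. v (cmod (y' p - y' q))))" by simp
    also have "\<dots> \<le> scaled_energy W \<phi> l eps y"
      unfolding scaled_energy_def yy using energy_ge[OF e(1) v(2)] e by (intro ereal_mult_left_mono) auto
    finally show "ereal (min (elastic l \<alpha> b a eps) (2 * \<beta> / \<gamma>) - D * eps)
      \<le> scaled_energy W \<phi> l eps y" .
  qed
qed

end

section \<open>Elastic upper bound\<close>

lemma upper_asymptotics:
  fixes \<gamma> \<kappa> l a \<alpha> k K :: real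
  assumes g: "0 < \<gamma>" and kp: "0 < \<kappa>" and l: "0 \<le> l" and K: "0 \<le> K" and ab: "0 \<le> \<alpha>" "0 \<le> a"
  shows "\<exists>C\<ge>0. \<forall>eps N S. 0 < eps \<longrightarrow> eps \<le> 1 \<longrightarrow> 0 \<le> N \<longrightarrow> N \<le> ((1 / eps) / \<gamma> + 1) * ((l / eps + 1) / \<kappa> + 1) \<longrightarrow> 0 \<le> S \<longrightarrow>
    S \<le> \<alpha> / 2 * (sqrt eps * a)\<^sup>2 + k * (sqrt eps * a) ^ 3 + K * (sqrt eps * a) ^ 4 \<longrightarrow>
    eps * (N * S) \<le> l / (\<gamma> * \<kappa>) * (\<alpha> / 2 * a\<^sup>2 + k * sqrt eps * a ^ 3) + C * eps"
proof -
  define D where "D = (1 / \<kappa> + 1) / \<gamma> + l / \<kappa> + (1 / \<kappa> + 1)"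
  define fm where "fm = \<alpha> / 2 * a\<^sup>2 + \<bar>k\<bar> * a ^ 3 + K * a ^ 4"
  define C where "C = l / (\<gamma> * \<kappa>) * (K * a ^ 4) + D * fm"
  have D0: "0 \<le> D" using g kp l by (simp add: D_def)
  have fm0: "0 \<le> fm" using ab K by (simp add: fm_def)
  have C0: "0 \<le> C" using D0 fm0 g kp l K ab by (auto simp: C_def)
  have "eps * (N * S) \<le> l / (\<gamma> * \<kappa>) * (\<alpha> / 2 * a\<^sup>2 + k * sqrt eps * a ^ 3) + C * eps"
    if e: "0 < eps" "eps \<le> 1" and N: "0 \<le> N" "N \<le> ((1 / eps) / \<gamma> + 1) * ((l / eps + 1) / \<kappa> + 1)"
      and S: "0 \<le> S" "S \<le> \<alpha> / 2 * (sqrt eps * a)\<^sup>2 + k * (sqrt eps * a) ^ 3 + K * (sqrt eps * a) ^ 4" for eps N S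
  proof -
    define s where "s = sqrt eps"
    have s: "s\<^sup>2 = eps" "0 < s" "s \<le> 1" using e by (auto simp: s_def)
    define P where "P = \<alpha> / 2 * a\<^sup>2 + k * s * a ^ 3"
    define f where "f = P + K * a ^ 4 * eps"
    have s34: "s ^ 3 = s * eps" "s ^ 4 = eps * eps"
      using s(1) by (auto simp: power2_eq_square power3_eq_cube power4_eq_xxxx mult.assoc)
    have Sf: "S \<le> eps * f"
      using S(2) unfolding s_def[symmetric] f_def P_def power_mult_distrib s s34 by (simp add: algebra_simps)
    have f0: "0 \<le> f" using order_trans[OF S(1) Sf] e by (simp add: zero_le_mult_iff)
    have ffm: "f \<le> fm"
    proof -
      have "k * s * a ^ 3 \<le> \<bar>k\<bar> * 1 * a ^ 3"
        using s ab by (intro mult_right_mono mult_mono) auto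
      moreover have "K * a ^ 4 * eps \<le> K * a ^ 4 * 1" using K e by (intro mult_left_mono) auto
      ultimately show ?thesis by (simp add: f_def P_def fm_def)
    qed
    have "eps * (N * S) \<le> eps * (N * (eps * f))" using Sf N e by (intro mult_left_mono) auto
    also have "\<dots> = (eps * eps * N) * f" by simp
    also have "\<dots> \<le> (l / (\<gamma> * \<kappa>) + eps * D) * f"
    proof (rule mult_right_mono[OF _ f0])
      have "eps * eps * N \<le> eps * eps * (((1 / eps) / \<gamma> + 1) * ((l / eps + 1) / \<kappa> + 1))"
        using N e by (intro mult_left_mono) auto
      also have "\<dots> = l / (\<gamma> * \<kappa>) + eps * ((1 / \<kappa> + 1) / \<gamma> + l / \<kappa> + eps * (1 / \<kappa> + 1))"
        using e g kp by (simp add: field_simps)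
      also have "\<dots> \<le> l / (\<gamma> * \<kappa>) + eps * D"
        unfolding D_def using e kp by (intro add_left_mono mult_left_mono add_mono) (auto simp: mult_left_le_one_le)
      finally show "eps * eps * N \<le> l / (\<gamma> * \<kappa>) + eps * D" .
    qed
    also have "\<dots> = l / (\<gamma> * \<kappa>) * P + l / (\<gamma> * \<kappa>) * (K * a ^ 4) * eps + eps * D * f"
      unfolding distrib_right f_def distrib_left by simp
    also have "eps * D * f \<le> eps * D * fm" using ffm e D0 by (intro mult_left_mono) auto
    finally have "eps * (N * S) \<le> l / (\<gamma> * \<kappa>) * P + l / (\<gamma> * \<kappa>) * (K * a ^ 4) * eps + eps * D * fm" by simp
    then show ?thesis unfolding C_def P_def s_def[symmetric] distrib_right[of _ _ eps] by (simp add: mult_ac)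
  qed
  then show ?thesis using C0 by blast
qed

text \<open>Only the terms up to e^3 are kept exactly. The constants are 19 = 12 + 6 + 1 from the
  cube and 81 = 3^4 from |z| at most 3 e.\<close>

lemma cubic_expansion_upper:
  fixes \<alpha> b C e p q :: real
  assumes "0 \<le> \<alpha>" "0 \<le> C" "0 \<le> e" "e \<le> 1" "\<bar>p\<bar> \<le> 1" "\<bar>q\<bar> \<le> 1" and z: "z = 2 * e * p + e\<^sup>2 * q"
  shows "\<alpha> / 8 * z\<^sup>2 + b * z ^ 3 + C * z ^ 4
    \<le> \<alpha> / 2 * e\<^sup>2 * p\<^sup>2 + \<alpha> / 2 * e ^ 3 * (p * q) + 8 * b * e ^ 3 * p ^ 3 + (\<alpha> / 8 + 19 * \<bar>b\<bar> + 81 * C) * e ^ 4"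
    "\<bar>z\<bar> \<le> 3 * e"
proof -
  have "\<bar>e * q\<bar> \<le> 1 * 1" unfolding abs_mult using assms by (intro mult_mono) auto
  then have eq: "\<bar>e * q\<bar> \<le> 1" by simp
  have zz: "z = e * (2 * p + e * q)" using z by (simp add: power2_eq_square algebra_simps)
  have "\<bar>2 * p + e * q\<bar> \<le> 3" using eq assms by linarith
  then have z3: "\<bar>z\<bar> \<le> e * 3" unfolding zz abs_mult using assms by (intro mult_mono) auto
  then show "\<bar>z\<bar> \<le> 3 * e" by simp
  have 4: "z ^ 4 \<le> 81 * e ^ 4" using power_mono[OF z3, of 4] assms by (simp add: power_mult_distrib)
  have q2: "q\<^sup>2 \<le> 1" using assms by (simp add: abs_square_le_1)
  have 2: "\<alpha> / 8 * z\<^sup>2 \<le> \<alpha> / 2 * e\<^sup>2 * p\<^sup>2 + \<alpha> / 2 * e ^ 3 * (p * q) + \<alpha> / 8 * e ^ 4"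
  proof -
    have "\<alpha> / 8 * z\<^sup>2 = \<alpha> / 2 * e\<^sup>2 * p\<^sup>2 + \<alpha> / 2 * e ^ 3 * (p * q) + \<alpha> / 8 * e ^ 4 * q\<^sup>2"
      unfolding z by (simp add: power2_eq_square power3_eq_cube power4_eq_xxxx field_simps)
    moreover have "\<alpha> / 8 * e ^ 4 * q\<^sup>2 \<le> \<alpha> / 8 * e ^ 4 * 1" using q2 assms by (intro mult_left_mono) auto
    ultimately show ?thesis by simp
  qed
  have 3: "b * z ^ 3 \<le> 8 * b * e ^ 3 * p ^ 3 + 19 * \<bar>b\<bar> * e ^ 4"
  proof -
    define r where "r = 12 * p\<^sup>2 * q + 6 * p * q * (e * q) + q * (e * q)\<^sup>2"
    have "b * z ^ 3 = 8 * b * e ^ 3 * p ^ 3 + b * e ^ 4 * r"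
      unfolding z r_def by (simp add: power2_eq_square power3_eq_cube power4_eq_xxxx algebra_simps)
    moreover have "b * e ^ 4 * r \<le> 19 * \<bar>b\<bar> * e ^ 4"
    proof -
      have "\<bar>12 * p\<^sup>2 * q\<bar> \<le> 12 * 1 * 1" unfolding abs_mult using assms by (intro mult_mono) (auto simp: abs_square_le_1)
      moreover have "\<bar>6 * p * q * (e * q)\<bar> \<le> 6 * 1 * 1 * 1" unfolding abs_mult[of "6 * p * q"] abs_mult[of "6 * p"] abs_mult[of 6]
        using assms eq by (intro mult_mono) auto
      moreover have "\<bar>q * (e * q)\<^sup>2\<bar> \<le> 1 * 1" unfolding abs_mult[of q] using assms eq by (intro mult_mono) (auto simp: abs_square_le_1)
      ultimately have "\<bar>r\<bar> \<le> 19" unfolding r_def by linarith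
      then have "\<bar>b * e ^ 4 * r\<bar> \<le> \<bar>b\<bar> * e ^ 4 * 19" unfolding abs_mult using assms by (intro mult_mono) auto
      then show ?thesis by linarith
    qed
    ultimately show ?thesis by linarith
  qed
  have "C * z ^ 4 \<le> C * (81 * e ^ 4)" using 4 assms(2) by (rule mult_left_mono)
  then show "\<alpha> / 8 * z\<^sup>2 + b * z ^ 3 + C * z ^ 4
    \<le> \<alpha> / 2 * e\<^sup>2 * p\<^sup>2 + \<alpha> / 2 * e ^ 3 * (p * q) + 8 * b * e ^ 3 * p ^ 3 + (\<alpha> / 8 + 19 * \<bar>b\<bar> + 81 * C) * e ^ 4"
    using 2 3 unfolding distrib_right by linarith
qed

section \<open>The affine competitor\<close>

context lattice_angle
begin

text \<open>The weights \<open>p1\<close>, \<open>p2\<close>, \<open>p3\<close> as one function of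
  the bond direction, in the form that the bond strains of diag(1 + e, 1 - e/3) produce.\<close>

definition pu :: "int \<times> int \<Rightarrow> real" where "pu u = (4 * (X (fst u) (snd u))\<^sup>2 - 1) / 3"

lemma pu_eq: "pu (1, 0) = p1" "pu (0, 1) = p2" "pu (-1, 1) = p3"
  unfolding pu_def p_cos by (simp_all add: X_def \<nu>_def) (rule power2_commute)

lemma X_Z_add: "X (fst (p + u)) (snd (p + u)) = X (fst p) (snd p) + X (fst u) (snd u)"
  "Z (fst (p + u)) (snd (p + u)) = Z (fst p) (snd p) + Z (fst u) (snd u)"
  by (simp_all add: X_def Z_def algebra_simps)

lemma X_Z_unit: "u \<in> bond_dirs \<Longrightarrow> (X (fst u) (snd u))\<^sup>2 + (Z (fst u) (snd u))\<^sup>2 = 1"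
proof -
  assume u: "u \<in> bond_dirs"
  have "(cmod (pt 1 u))\<^sup>2 = 1" using u cmod_pt[of 1 "fst u" "snd u"] by (auto simp: bond_dirs_def)
  then show ?thesis by (simp add: cmod_power2 Re_pt Im_pt)
qed

lemma card_box_le:
  assumes "L \<ge> 0" "H \<ge> 0"
  shows "real (card (box L H)) \<le> (H / \<gamma> + 1) * ((L + 1) / \<kappa> + 1)"
proof -
  have "real (card (box L H)) \<le> (H / \<gamma> + 1) * ((L - 0 + 1) / \<kappa> + 1)"
    using assms by (intro card_strip_le finite_box) (auto simp: box_def)
  then show ?thesis by simp
qed

text \<open>The lateral contraction e/3 is the one that minimises the quadratic energy at horizontal
  strain e; it makes the bond strains e times \<open>pu\<close>, the points where the lower bound
  places its tangents, so both bounds agree through third order.\<close>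

lemma elastic_upper_bound:
  fixes W :: "real \<Rightarrow> ereal"
  assumes a: "a \<ge> 0" and l: "l > 0" and \<alpha>: "\<alpha> > 0" and C: "C \<ge> 0" and R0: "R0 > 1"
    and W_nonneg: "\<forall>r\<ge>0. W r \<ge> 0"
    and near: "\<And>r. 0 \<le> r \<Longrightarrow> \<bar>r\<^sup>2 - 1\<bar> \<le> \<eta>0 \<Longrightarrow>
       W r \<le> ereal (\<alpha> / 8 * (r\<^sup>2 - 1)\<^sup>2 + b * (r\<^sup>2 - 1) ^ 3 + C * (r\<^sup>2 - 1) ^ 4)" and \<eta>0: "\<eta>0 > 0"
  shows "\<exists>C eps0. eps0 > 0 \<and> (\<forall>eps. 0 < eps \<longrightarrow> eps < eps0 \<longrightarrow> (\<exists>y\<in>admissible \<phi> l R0 \<psi> eps (sqrt eps * a).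
    scaled_energy W \<phi> l eps y
      \<le> ereal (elastic l \<alpha> b a eps + C * eps)))"
proof -
  define D where "D = \<alpha> / 8 + 19 * \<bar>b\<bar> + 81 * C"
  have D0: "3 * D \<ge> 0" using \<alpha> C by (simp add: D_def)
  obtain K where K: "\<forall>eps N S. 0 < eps \<longrightarrow> eps \<le> 1 \<longrightarrow> 0 \<le> N \<longrightarrow> N \<le> ((1 / eps) / \<gamma> + 1) * ((l / eps + 1) / \<kappa> + 1) \<longrightarrow> 0 \<le> S \<longrightarrow>
    S \<le> \<alpha> / 2 * (sqrt eps * a)\<^sup>2 + cubic \<alpha> b * (sqrt eps * a) ^ 3 + 3 * D * (sqrt eps * a) ^ 4 \<longrightarrow>
    eps * (N * S) \<le> elastic l \<alpha> b a eps + K * eps"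
    using upper_asymptotics[OF gamma_pos kappa_pos less_imp_le[OF l] D0 less_imp_le[OF \<alpha>] a, of "cubic \<alpha> b"]
    by (elim exE conjE) (rule that; assumption)
  define e0 where "e0 = min 1 (min (\<eta>0 / 3) ((R0 - 1) / 3))"
  have "e0 \<le> \<eta>0 / 3" unfolding e0_def by (rule min.coboundedI2, rule min.coboundedI1, rule order_refl)
  moreover have "e0 \<le> (R0 - 1) / 3" unfolding e0_def by (rule min.coboundedI2, rule min.coboundedI2, rule order_refl)
  moreover have "e0 > 0" "e0 \<le> 1" using \<eta>0 R0 by (auto simp: e0_def)
  ultimately have e0: "e0 > 0" "e0 \<le> 1" "3 * e0 \<le> \<eta>0" "3 * e0 \<le> R0 - 1" by simp_all
  \<comment> \<open>The denominator a + 1 also covers a = 0.\<close>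
  define eps0 where "eps0 = min 1 ((e0 / (a + 1))\<^sup>2)"
  show ?thesis
  proof (rule exI[of _ K], rule exI[of _ eps0], intro conjI allI impI)
    show "eps0 > 0" using e0 a by (simp add: eps0_def)
    fix eps assume eps: "0 < eps" "eps < eps0"
    define e where "e = sqrt eps * a"
    have "sqrt eps \<le> e0 / (a + 1)" using eps e0 a by (intro real_le_lsqrt) (auto simp: eps0_def)
    then have "sqrt eps * (a + 1) \<le> e0" using a by (simp add: field_simps)
    moreover have "sqrt eps * a \<le> sqrt eps * (a + 1)" using eps by (intro mult_left_mono) auto
    ultimately have "sqrt eps * a \<le> e0" by linarith
    then have e: "0 \<le> e" "e \<le> e0" using eps a by (auto simp: e_def)
    have e1: "e \<le> 1" "3 * e \<le> \<eta>0" "3 * e \<le> R0 - 1" using e e0 by auto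
    define y where "y x = Complex ((1 + e) * Re x) ((1 - e / 3) * Im x)" for x
    define z where "z u = 2 * e * pu u + e\<^sup>2 * ((1 + 2 * pu u) / 3)" for u
    define g where "g u = \<alpha> / 8 * (z u)\<^sup>2 + b * (z u) ^ 3 + C * (z u) ^ 4" for u
    have pu: "\<bar>pu u\<bar> \<le> 1" if "u \<in> bond_dirs" for u
      using that abs_p_le by (auto simp: bond_dirs_def pu_eq)
    have zb: "\<bar>z u\<bar> \<le> 3 * e" and gb: "g u \<le> \<alpha> / 2 * e\<^sup>2 * (pu u)\<^sup>2 + \<alpha> / 2 * e ^ 3 * (pu u * ((1 + 2 * pu u) / 3))
         + 8 * b * e ^ 3 * pu u ^ 3 + D * e ^ 4" if u: "u \<in> bond_dirs" for u
    proof -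
      have q: "\<bar>(1 + 2 * pu u) / 3\<bar> \<le> 1" using pu[OF u] by auto
      show "\<bar>z u\<bar> \<le> 3 * e" "g u \<le> \<alpha> / 2 * e\<^sup>2 * (pu u)\<^sup>2 + \<alpha> / 2 * e ^ 3 * (pu u * ((1 + 2 * pu u) / 3))
         + 8 * b * e ^ 3 * pu u ^ 3 + D * e ^ 4"
        unfolding g_def D_def
        by (rule cubic_expansion_upper[OF less_imp_le[OF \<alpha>] C e(1) e1(1) pu[OF u] q z_def])+
    qed
    have len: "(cmod (y (pt eps p) - y (pt eps q)) / eps)\<^sup>2 = 1 + z (q - p)" if "q - p \<in> bond_dirs" for p q
    proof -
      define u where "u = q - p"
      have q: "q = p + u" by (simp add: u_def)
      have "y (pt eps p) - y (pt eps q) = Complex (- ((1 + e) * (eps * X (fst u) (snd u)))) (- ((1 - e / 3) * (eps * Z (fst u) (snd u))))"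
        unfolding y_def Re_pt Im_pt q X_Z_add by (simp add: complex_eq_iff algebra_simps)
      then have "(cmod (y (pt eps p) - y (pt eps q)))\<^sup>2
        = eps\<^sup>2 * ((1 + e)\<^sup>2 * (X (fst u) (snd u))\<^sup>2 + (1 - e / 3)\<^sup>2 * (Z (fst u) (snd u))\<^sup>2)"
      proof -
        have "(- (g * (eps * x)))\<^sup>2 + (- (h * (eps * x')))\<^sup>2 = eps\<^sup>2 * (g\<^sup>2 * x\<^sup>2 + h\<^sup>2 * x'\<^sup>2)" for g h x x' :: real
          by (simp add: power2_eq_square algebra_simps)
        moreover assume "y (pt eps p) - y (pt eps q) = Complex (- ((1 + e) * (eps * X (fst u) (snd u)))) (- ((1 - e / 3) * (eps * Z (fst u) (snd u))))"
        ultimately show ?thesis unfolding cmod_power2 by (simp only: complex.sel)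
      qed
      moreover have "(Z (fst u) (snd u))\<^sup>2 = 1 - (X (fst u) (snd u))\<^sup>2"
        using X_Z_unit[of u] that by (simp add: u_def)
      moreover have "(1 + e)\<^sup>2 * x + (1 - e / 3)\<^sup>2 * (1 - x) = 1 + (2 * e * ((4 * x - 1) / 3) + e\<^sup>2 * ((1 + 2 * ((4 * x - 1) / 3)) / 3))" for x
        by (simp add: power2_eq_square field_simps)
      ultimately have "(cmod (y (pt eps p) - y (pt eps q)))\<^sup>2 = eps\<^sup>2 * (1 + z u)" unfolding z_def pu_def by (simp only:)
      then show ?thesis using eps unfolding power_divide u_def[symmetric] by simp
    qed
    have r: "cmod (y (pt eps p) - y (pt eps q)) \<le> R0 * eps" if "q - p \<in> bond_dirs" for p q
    proof -
      have "(cmod (y (pt eps p) - y (pt eps q)) / eps)\<^sup>2 \<le> 1 + 3 * e" using len[OF that] zb[OF that] by auto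
      also have "\<dots> \<le> R0" using e1 by simp
      also have "\<dots> \<le> R0\<^sup>2" using R0 by (simp add: power2_eq_square)
      finally have "cmod (y (pt eps p) - y (pt eps q)) / eps \<le> R0" by (rule power2_le_imp_le) (use R0 in simp)
      then show ?thesis using eps by (simp add: field_simps)
    qed
    have adm: "y \<in> admissible \<phi> l R0 \<psi> eps (sqrt eps * a)"
    proof -
      have "cmod (y x - y x') \<le> R0 * eps" if x: "x \<in> sites \<phi> l eps" "x' \<in> sites \<phi> l eps" "cmod (x - x') = eps" for x x'
      proof -
        obtain p q where pq: "x = pt eps p" "x' = pt eps q" using x eps by (auto simp: sites_eq)
        have "q - p \<in> bond_dirs \<union> uminus ` bond_dirs" using x(3) eps by (simp add: pq pt_neighbours)
        then have "q - p \<in> bond_dirs \<or> p - q \<in> bond_dirs" by (metis UnE imageE minus_diff_eq minus_minus)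
        then show ?thesis using r[of q p] r[of p q] unfolding pq by (auto simp: norm_minus_commute)
      qed
      then show ?thesis unfolding admissible_def by (simp add: y_def e_def)
    qed
    define B where "B = box (l / eps) (1 / eps)"
    have Wg: "W (cmod (y (pt eps p) - y (pt eps q)) / eps) \<le> ereal (g (q - p))" if "q - p \<in> bond_dirs" for p q
    proof -
      let ?r = "cmod (y (pt eps p) - y (pt eps q)) / eps"
      have "?r\<^sup>2 - 1 = z (q - p)" using len[OF that] by simp
      then show ?thesis using near[of ?r] zb[OF that] e1 eps unfolding g_def by simp
    qed
    \<comment> \<open>Nonnegativity allows counting three full bonds at every site, including bonds
      that leave the domain.\<close>
    have g0: "0 \<le> g u" if "u \<in> bond_dirs" for u
    proof -
      have "0 \<le> W (cmod (y (pt eps 0) - y (pt eps u)) / eps)" using W_nonneg eps by simp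
      also have "\<dots> \<le> ereal (g (u - 0))" using that by (intro Wg) simp
      finally show ?thesis by simp
    qed
    have "energy W \<phi> l eps y \<le> ereal (bond_sum (l / eps) (1 / eps) (\<lambda>p q. g (q - p)))"
      using eps W_nonneg Wg by (intro energy_le) auto
    also have "bond_sum (l / eps) (1 / eps) (\<lambda>p q. g (q - p)) \<le> real (card B) * (\<Sum>u\<in>bond_dirs. g u)"
    proof -
      have "bond_sum (l / eps) (1 / eps) (\<lambda>p q. g (q - p)) \<le> (\<Sum>p\<in>B. \<Sum>u\<in>bond_dirs. g u)"
        unfolding bond_sum_def B_def using g0 by (intro sum_mono) auto
      then show ?thesis by simp
    qed
    finally have E: "energy W \<phi> l eps y \<le> ereal (real (card B) * (\<Sum>u\<in>bond_dirs. g u))" by simp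
    have S: "(\<Sum>u\<in>bond_dirs. g u) \<le> \<alpha> / 2 * (sqrt eps * a)\<^sup>2 + cubic \<alpha> b * (sqrt eps * a) ^ 3 + 3 * D * (sqrt eps * a) ^ 4"
    proof -
      have "(\<Sum>u\<in>bond_dirs. g u) \<le> (\<Sum>u\<in>bond_dirs. \<alpha> / 2 * e\<^sup>2 * (pu u)\<^sup>2 + \<alpha> / 2 * e ^ 3 * (pu u * ((1 + 2 * pu u) / 3))
         + 8 * b * e ^ 3 * pu u ^ 3 + D * e ^ 4)" using gb by (rule sum_mono)
      also have "\<dots> = \<alpha> / 2 * e\<^sup>2 * (p1\<^sup>2 + p2\<^sup>2 + p3\<^sup>2) + \<alpha> / 2 * e ^ 3 * ((p1 + p2 + p3 + 2 * (p1\<^sup>2 + p2\<^sup>2 + p3\<^sup>2)) / 3)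
         + 8 * b * e ^ 3 * cube + 3 * D * e ^ 4"
      proof -
        have "(c1 * x\<^sup>2 + c2 * (x * ((1 + 2 * x) / 3)) + c3 * x ^ 3 + c4) + ((c1 * y\<^sup>2 + c2 * (y * ((1 + 2 * y) / 3)) + c3 * y ^ 3 + c4)
            + (c1 * z\<^sup>2 + c2 * (z * ((1 + 2 * z) / 3)) + c3 * z ^ 3 + c4))
          = c1 * (x\<^sup>2 + y\<^sup>2 + z\<^sup>2) + c2 * ((x + y + z + 2 * (x\<^sup>2 + y\<^sup>2 + z\<^sup>2)) / 3) + c3 * (x ^ 3 + y ^ 3 + z ^ 3) + 3 * c4"
          for c1 c2 c3 c4 x y z :: real
          by (simp add: power2_eq_square field_simps)
        moreover have "(\<Sum>u\<in>bond_dirs. h u) = h (1, 0) + (h (0, 1) + h (-1, 1))" for h :: "int \<times> int \<Rightarrow> real"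
          by (simp add: bond_dirs_def)
        ultimately show ?thesis by (simp only: pu_eq cube_def mult.assoc[of 3 D])
      qed
      \<comment> \<open>Both \<open>sum_p\<close> and \<open>sum_p_sq\<close> equal 1, so the middle
        bracket is (1 + 2)/3 = 1.\<close>
      also have "\<dots> = \<alpha> / 2 * e\<^sup>2 + cubic \<alpha> b * e ^ 3 + 3 * D * e ^ 4"
        unfolding sum_p sum_p_sq by (simp add: algebra_simps)
      finally show ?thesis unfolding e_def .
    qed
    have N: "real (card B) \<le> ((1 / eps) / \<gamma> + 1) * ((l / eps + 1) / \<kappa> + 1)"
      unfolding B_def using l eps by (intro card_box_le) auto
    have "eps * (real (card B) * (\<Sum>u\<in>bond_dirs. g u)) \<le> elastic l \<alpha> b a eps + K * eps"
    proof (rule K[THEN spec, THEN spec, THEN spec, THEN mp, THEN mp, THEN mp, THEN mp, THEN mp, THEN mp, OF eps(1) _ _ N _ S])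
      show "eps \<le> 1" using eps by (simp add: eps0_def)
      show "0 \<le> sum g bond_dirs" using g0 by (rule sum_nonneg)
    qed simp
    then have "ereal eps * ereal (real (card B) * (\<Sum>u\<in>bond_dirs. g u)) \<le> ereal (elastic l \<alpha> b a eps + K * eps)"
      by simp
    moreover have "scaled_energy W \<phi> l eps y \<le> ereal eps * ereal (real (card B) * (\<Sum>u\<in>bond_dirs. g u))"
      unfolding scaled_energy_def using E eps by (intro ereal_mult_left_mono) auto
    ultimately have "scaled_energy W \<phi> l eps y
      \<le> ereal (elastic l \<alpha> b a eps + K * eps)"
      by (rule order_trans[rotated])
    then show "\<exists>y\<in>admissible \<phi> l R0 \<psi> eps (sqrt eps * a). scaled_energy W \<phi> l eps y
      \<le> ereal (elastic l \<alpha> b a eps + K * eps)"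
      by (rule bexI[OF _ adm])
  qed
qed

end

section \<open>Cleavage upper bound\<close>

lemma small_strain:
  fixes x x' v v' :: complex
  assumes "cmod (x - x') = eps" "eps > 0" "Re v = Re x + d" "Im v = Im x" "Re v' = Re x' + d'" "Im v' = Im x'"
    and d: "\<bar>d - d'\<bar> \<le> e * \<bar>Re x - Re x'\<bar>" and e: "0 \<le> e" "e \<le> 1"
  shows "\<bar>(cmod (v - v') / eps)\<^sup>2 - 1\<bar> \<le> 3 * e" "d = d' \<Longrightarrow> cmod (v - v') / eps = 1"
proof -
  define X Y D where "X = Re x - Re x'" and "Y = Im x - Im x'" and "D = d - d'"
  have xy: "X\<^sup>2 + Y\<^sup>2 = eps\<^sup>2" using assms(1) cmod_power2[of "x - x'"] by (simp add: X_def Y_def)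
  have "Re v - Re v' = X + D" "Im v - Im v' = Y" using assms by (auto simp: X_def Y_def D_def)
  then have "(cmod (v - v'))\<^sup>2 = (X + D)\<^sup>2 + Y\<^sup>2" unfolding cmod_power2 by simp
  also have "\<dots> = eps\<^sup>2 + D * (2 * X + D)" using xy by (simp add: power2_eq_square algebra_simps)
  finally have c: "(cmod (v - v'))\<^sup>2 = eps\<^sup>2 + D * (2 * X + D)" .
  have X: "\<bar>X\<bar> \<le> eps" using assms(1) abs_Re_le_cmod[of "x - x'"] by (simp add: X_def)
  have "\<bar>D\<bar> \<le> e * \<bar>X\<bar>" using d by (simp add: D_def X_def)
  also have "\<dots> \<le> e * eps" using X e by (intro mult_left_mono) auto
  finally have D: "\<bar>D\<bar> \<le> e * eps" .
  have "e * eps \<le> 1 * eps" using e assms(2) by (intro mult_right_mono) auto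
  then have "\<bar>2 * X + D\<bar> \<le> 3 * eps" using X D by linarith
  then have "\<bar>D * (2 * X + D)\<bar> \<le> (e * eps) * (3 * eps)" unfolding abs_mult using D e assms(2) by (intro mult_mono) auto
  then have "\<bar>D * (2 * X + D) / eps\<^sup>2\<bar> \<le> 3 * e" using assms(2) by (simp add: power2_eq_square field_simps)
  moreover have "(cmod (v - v') / eps)\<^sup>2 - 1 = D * (2 * X + D) / eps\<^sup>2"
    unfolding power_divide c using assms(2) by (simp add: field_simps)
  ultimately show "\<bar>(cmod (v - v') / eps)\<^sup>2 - 1\<bar> \<le> 3 * e" by simp
  assume "d = d'"
  then have "(cmod (v - v'))\<^sup>2 = eps\<^sup>2" using c by (simp add: D_def)
  then have "cmod (v - v') = eps" using assms(2) by (simp add: power2_eq_iff_nonneg)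
  then show "cmod (v - v') / eps = 1" using assms(2) by simp
qed

section \<open>The competitor cleaved along a line parallel to \<open>v\<^sub>2\<close>\<close>

context lattice_angle
begin

text \<open>The dividing line passes through the centre (l/2, 1/2) of the domain in direction
  \<open>v\<^sub>2\<close>.\<close>

definition side :: "real \<Rightarrow> complex \<Rightarrow> bool" where
  "side l x \<longleftrightarrow> Re x - \<nu> / \<gamma> * Im x \<le> (l - \<nu> / \<gamma>) / 2"

text \<open>Horizontal displacement. It equals \<open>e * Re x\<close> in the strips of width
  \<open>eps\<close> at the lateral sides, as the boundary condition demands, and is constant on the
  rest of either part, so that bonds there keep their length exactly.\<close>

definition crack_opening :: "real \<Rightarrow> real \<Rightarrow> real \<Rightarrow> complex \<Rightarrow> real" where
  "crack_opening l eps e x = (if side l x then e * min (Re x) eps else e * (l - min (l - Re x) eps))"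

definition cleaved :: "real \<Rightarrow> real \<Rightarrow> real \<Rightarrow> complex \<Rightarrow> complex" where
  "cleaved l eps e x = Complex (Re x + crack_opening l eps e x) (Im x)"

text \<open>Within the height 1 the dividing line deviates from its midpoint by at most |\<nu>| / (2
  \<gamma>), so it keeps the distance (l - |\<nu>| / \<gamma>) / 2 from the lateral sides.\<close>

lemma side_margin:
  assumes "0 < Im x" "Im x < 1"
  shows "Re x < (l - \<bar>\<nu>\<bar> / \<gamma>) / 2 \<Longrightarrow> side l x" "Re x > l - (l - \<bar>\<nu>\<bar> / \<gamma>) / 2 \<Longrightarrow> \<not> side l x"
proof -
  have "\<bar>\<nu> / \<gamma> * (Im x - 1 / 2)\<bar> \<le> \<bar>\<nu>\<bar> / \<gamma> * (1 / 2)"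
  proof -
    have "\<bar>Im x - 1 / 2\<bar> \<le> 1 / 2" using assms by linarith
    then show ?thesis unfolding abs_mult using gamma_pos by (intro mult_mono) auto
  qed
  then have "\<bar>\<nu> / \<gamma> * Im x - \<nu> / \<gamma> / 2\<bar> \<le> \<bar>\<nu>\<bar> / \<gamma> / 2" by (simp add: algebra_simps)
  then show "Re x < (l - \<bar>\<nu>\<bar> / \<gamma>) / 2 \<Longrightarrow> side l x" "Re x > l - (l - \<bar>\<nu>\<bar> / \<gamma>) / 2 \<Longrightarrow> \<not> side l x"
    unfolding side_def diff_divide_distrib[of l] by linarith+
qed

text \<open>The line is parallel to \<open>v\<^sub>2\<close>, so the side depends on the
  \<open>v\<^sub>1\<close>-index alone and the crack runs between two adjacent lattice
  lines.\<close>

lemma side_pt: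
  assumes "eps > 0"
  shows "side l (pt eps p) \<longleftrightarrow> fst p \<le> \<lfloor>(l - \<nu> / \<gamma>) / 2 / (eps * \<kappa>)\<rfloor>"
proof -
  have "\<nu> / \<gamma> * Z (fst p) (snd p) = \<nu> * (of_int (fst p) * \<mu> + of_int (snd p))"
    using gamma_pos by (simp add: Z_def)
  then have "X (fst p) (snd p) - \<nu> / \<gamma> * Z (fst p) (snd p) = of_int (fst p) * \<kappa>"
    unfolding X_def cos_phi_eq by (simp add: algebra_simps)
  then have "eps * X (fst p) (snd p) - \<nu> / \<gamma> * (eps * Z (fst p) (snd p)) = of_int (fst p) * (eps * \<kappa>)"
    by (metis mult.commute mult.left_commute right_diff_distrib)
  then have "side l (pt eps p) \<longleftrightarrow> of_int (fst p) * (eps * \<kappa>) \<le> (l - \<nu> / \<gamma>) / 2"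
    unfolding side_def Re_pt Im_pt by (simp only:)
  also have "\<dots> \<longleftrightarrow> of_int (fst p) \<le> (l - \<nu> / \<gamma>) / 2 / (eps * \<kappa>)"
    using assms kappa_pos by (simp only: pos_le_divide_eq mult_pos_pos)
  finally show ?thesis by (simp add: le_floor_iff)
qed

lemma opening_same_side:
  assumes "side l x = side l x'" "0 \<le> e"
  shows "\<bar>crack_opening l eps e x - crack_opening l eps e x'\<bar> \<le> e * \<bar>Re x - Re x'\<bar>"
proof (cases "side l x")
  case True
  then have "crack_opening l eps e x - crack_opening l eps e x' = e * (min (Re x) eps - min (Re x') eps)"
    using assms by (simp add: crack_opening_def algebra_simps)
  moreover have "\<bar>min (Re x) eps - min (Re x') eps\<bar> \<le> \<bar>Re x - Re x'\<bar>" by linarith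
  ultimately show ?thesis using assms by (simp add: abs_mult mult_left_mono)
next
  case False
  then have "crack_opening l eps e x - crack_opening l eps e x' = e * (min (l - Re x') eps - min (l - Re x) eps)"
    using assms by (simp add: crack_opening_def algebra_simps)
  moreover have "\<bar>min (l - Re x') eps - min (l - Re x) eps\<bar> \<le> \<bar>Re x - Re x'\<bar>" by linarith
  ultimately show ?thesis using assms by (simp add: abs_mult mult_left_mono)
qed

lemma card_row_le:
  assumes "H \<ge> 0"
  shows "real (card {p \<in> box L H. fst p = n}) \<le> H / \<gamma> + 1"
proof -
  define u where "u = - (of_int n * \<mu>)"
  have "snd ` {p \<in> box L H. fst p = n} \<subseteq> {\<lceil>u\<rceil>..\<lfloor>u + H / \<gamma>\<rfloor>}"
  proof
    fix k assume "k \<in> snd ` {p \<in> box L H. fst p = n}"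
    then have "0 < \<gamma> * (of_int n * \<mu> + of_int k)" "\<gamma> * (of_int n * \<mu> + of_int k) < H"
      by (auto simp: box_def Z_def)
    then have "0 < of_int n * \<mu> + of_int k" "of_int n * \<mu> + of_int k < H / \<gamma>"
      using gamma_pos by (auto simp: zero_less_mult_iff pos_less_divide_eq mult.commute)
    then have "u \<le> of_int k" "of_int k \<le> u + H / \<gamma>" by (auto simp: u_def)
    then show "k \<in> {\<lceil>u\<rceil>..\<lfloor>u + H / \<gamma>\<rfloor>}" by (auto simp: ceiling_le_iff le_floor_iff)
  qed
  then have "card (snd ` {p \<in> box L H. fst p = n}) \<le> card {\<lceil>u\<rceil>..\<lfloor>u + H / \<gamma>\<rfloor>}" by (intro card_mono) auto
  moreover have "card (snd ` {p \<in> box L H. fst p = n}) = card {p \<in> box L H. fst p = n}"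
    by (intro card_image inj_onI) (auto simp: prod_eq_iff)
  ultimately have "real (card {p \<in> box L H. fst p = n}) \<le> real (nat (\<lfloor>u + H / \<gamma>\<rfloor> + 1 - \<lceil>u\<rceil>))" by simp
  also have "\<dots> \<le> H / \<gamma> + 1"
  proof -
    have "0 \<le> H / \<gamma>" using assms gamma_pos by simp
    then show ?thesis by linarith
  qed
  finally show ?thesis .
qed

lemma card_margin_le:
  assumes "H \<ge> 0"
  shows "real (card {p \<in> box L H. X (fst p) (snd p) \<le> 2 \<or> X (fst p) (snd p) \<ge> L - 2}) \<le> 2 * ((H / \<gamma> + 1) * (3 / \<kappa> + 1))"
proof -
  let ?A = "{p \<in> box L H. X (fst p) (snd p) \<le> 2}" and ?B = "{p \<in> box L H. X (fst p) (snd p) \<ge> L - 2}"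
  have "real (card ?A) \<le> (H / \<gamma> + 1) * ((2 - 0 + 1) / \<kappa> + 1)"
    using assms by (intro card_strip_le; (simp; fail)?) (auto simp: box_def)
  moreover have "real (card ?B) \<le> (H / \<gamma> + 1) * ((L - (L - 2) + 1) / \<kappa> + 1)"
    using assms by (intro card_strip_le; (simp; fail)?) (auto simp: box_def)
  moreover have "card {p \<in> box L H. X (fst p) (snd p) \<le> 2 \<or> X (fst p) (snd p) \<ge> L - 2} \<le> card ?A + card ?B"
    by (rule order_trans[OF _ card_Un_le]) (auto intro!: card_mono)
  ultimately show ?thesis by simp
qed

text \<open>Only the directions (1, 0) from index \<open>n\<close> and (-1, 1) from index
  \<open>n + 1\<close> cross the crack: two bonds per site of a lattice line, of which the domain
  holds about H / \<gamma>. This is the source of 2 \<beta> / \<gamma>. The factor 6 counts three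
  bonds at sites in two margins.\<close>

lemma cleaved_bond_sum:
  assumes "H \<ge> 0" "c \<ge> 0" "d \<ge> 0"
  shows "bond_sum L H (\<lambda>p q. (if (fst p \<le> n) \<noteq> (fst q \<le> n) then c else 0)
      + (if X (fst p) (snd p) \<le> 2 \<or> X (fst p) (snd p) \<ge> L - 2 then d else 0))
    \<le> (H / \<gamma> + 1) * (2 * c + 6 * (3 / \<kappa> + 1) * d)"
proof -
  let ?m = "\<lambda>p. X (fst p) (snd p) \<le> 2 \<or> X (fst p) (snd p) \<ge> L - 2"
  have "bond_sum L H (\<lambda>p q. (if (fst p \<le> n) \<noteq> (fst q \<le> n) then c else 0) + (if ?m p then d else 0))
    \<le> (\<Sum>p\<in>box L H. (if fst p = n then c else 0) + (if fst p = n + 1 then c else 0) + 3 * (if ?m p then d else 0))"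
    unfolding bond_sum_def
  proof (rule sum_mono)
    fix p assume "p \<in> box L H"
    have "(\<Sum>u\<in>bond_dirs. if p + u \<in> box L H then (if (fst p \<le> n) \<noteq> (fst (p + u) \<le> n) then c else 0) + (if ?m p then d else 0) else 0)
      \<le> (\<Sum>u\<in>bond_dirs. (if (fst p \<le> n) \<noteq> (fst (p + u) \<le> n) then c else 0) + (if ?m p then d else 0))"
      using assms by (intro sum_mono) auto
    also have "\<dots> \<le> (if fst p = n then c else 0) + (if fst p = n + 1 then c else 0) + 3 * (if ?m p then d else 0)"
      using assms unfolding bond_dirs_def by auto
    finally show "(\<Sum>u\<in>bond_dirs. if p + u \<in> box L H then (if (fst p \<le> n) \<noteq> (fst (p + u) \<le> n) then c else 0) + (if ?m p then d else 0) else 0)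
      \<le> (if fst p = n then c else 0) + (if fst p = n + 1 then c else 0) + 3 * (if ?m p then d else 0)" .
  qed
  also have "\<dots> = real (card {p \<in> box L H. fst p = n}) * c + real (card {p \<in> box L H. fst p = n + 1}) * c
      + 3 * (real (card {p \<in> box L H. ?m p}) * d)"
  proof -
    have "(\<Sum>p\<in>box L H. if P p then x else 0) = real (card {p \<in> box L H. P p}) * x" for P :: "int \<times> int \<Rightarrow> bool" and x :: real
      by (simp add: sum.If_cases Int_def)
    then show ?thesis unfolding sum.distrib sum_distrib_left[symmetric] by (simp only:)
  qed
  also have "\<dots> \<le> (H / \<gamma> + 1) * c + (H / \<gamma> + 1) * c + 3 * (2 * ((H / \<gamma> + 1) * (3 / \<kappa> + 1)) * d)"
    using assms card_row_le[OF assms(1), of L] card_margin_le[OF assms(1), of L]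
    by (intro add_mono mult_right_mono mult_left_mono) auto
  also have "\<dots> = (H / \<gamma> + 1) * (2 * c + 6 * (3 / \<kappa> + 1) * d)" by (simp add: algebra_simps)
  finally show ?thesis .
qed

text \<open>The gap is at least e (l - 2 eps) - eps, where e = s a dominates eps = s^2. Half of e l
  remains after the layers and a quarter after the bond itself; division by s^2 gives the
  claim.\<close>

lemma crossing_bond_long:
  assumes x: "side l x" "\<not> side l x'" "cmod (x - x') = eps"
    and s: "s > 0" "eps = s\<^sup>2" "e = s * a" "s \<le> a * l / 4" and a: "a > 0" and l: "eps \<le> l / 4"
  shows "cmod (cleaved l eps e x' - cleaved l eps e x) / eps \<ge> a * l / 4 / s"
proof -
  have e: "eps > 0" "e > 0" using s a by auto
  have "crack_opening l eps e x \<le> e * eps" "e * (l - eps) \<le> crack_opening l eps e x'"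
    using x e by (auto simp: crack_opening_def)
  moreover have "\<bar>Re x - Re x'\<bar> \<le> eps" using x(3) abs_Re_le_cmod[of "x - x'"] by simp
  ultimately have "e * (l - 2 * eps) - eps \<le> Re (cleaved l eps e x' - cleaved l eps e x)"
    unfolding cleaved_def by (simp add: algebra_simps)
  also have "\<dots> \<le> cmod (cleaved l eps e x' - cleaved l eps e x)" by (rule complex_Re_le_cmod)
  finally have 1: "e * (l - 2 * eps) - eps \<le> cmod (cleaved l eps e x' - cleaved l eps e x)" .
  have "e * (l / 2) \<le> e * (l - 2 * eps)" using l e by (intro mult_left_mono) auto
  moreover have "s * s \<le> s * (a * l / 4)" using s by (intro mult_left_mono) auto
  ultimately have "s * (a * l / 4) \<le> e * (l - 2 * eps) - eps"
    unfolding s power2_eq_square by (simp add: field_simps)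
  then have "s * (a * l / 4) \<le> cmod (cleaved l eps e x' - cleaved l eps e x)" using 1 by linarith
  then have "s * (a * l / 4) / eps \<le> cmod (cleaved l eps e x' - cleaved l eps e x) / eps"
    using e by (intro divide_right_mono) auto
  moreover have "s * (a * l / 4) / eps = a * l / 4 / s" using s by (simp add: power2_eq_square)
  ultimately show ?thesis by simp
qed

text \<open>The strips of widths \<open>eps\<close> and \<open>\<psi> eps\<close> lie within the
  margins of \<open>side_margin\<close>, so no bond in them crosses the crack, and the small strain
  elsewhere stays below \<open>R0\<close>.\<close>

lemma cleaved_admissible:
  assumes eps: "0 < eps" and m: "eps < (l - \<bar>\<nu>\<bar> / \<gamma>) / 2" "\<psi> eps < (l - \<bar>\<nu>\<bar> / \<gamma>) / 2"
    and e: "0 \<le> e" "e \<le> 1" "3 * e \<le> R0 - 1"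
  shows "cleaved l eps e \<in> admissible \<phi> l R0 \<psi> eps e"
proof -
  let ?y = "cleaved l eps e"
  have S: "0 < Re x" "Re x < l" "0 < Im x" "Im x < 1" if "x \<in> sites \<phi> l eps" for x
    using that by (auto simp: sites_def)
  have "Re (?y x) = (1 + e) * Re x" if x: "x \<in> sites \<phi> l eps" "Re x \<le> eps \<or> Re x \<ge> l - eps" for x
    using x(2)
  proof
    assume h: "Re x \<le> eps"
    then have "side l x" using S[OF x(1)] m by (intro side_margin) auto
    then show ?thesis using h by (simp add: cleaved_def crack_opening_def algebra_simps)
  next
    assume h: "Re x \<ge> l - eps"
    then have "Re x > l - (l - \<bar>\<nu>\<bar> / \<gamma>) / 2" using m(1) by linarith
    then have "\<not> side l x" using S[OF x(1)] by (intro side_margin)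
    then show ?thesis using h by (simp add: cleaved_def crack_opening_def algebra_simps)
  qed
  moreover have "cmod (?y x - ?y x') \<le> R0 * eps"
    if x: "x \<in> sites \<phi> l eps" "x' \<in> sites \<phi> l eps" "cmod (x - x') = eps"
      and h: "(Re x \<le> \<psi> eps \<and> Re x' \<le> \<psi> eps) \<or> (Re x \<ge> l - \<psi> eps \<and> Re x' \<ge> l - \<psi> eps)" for x x'
  proof -
    have same: "side l x = side l x'"
      using h
    proof
      assume "Re x \<le> \<psi> eps \<and> Re x' \<le> \<psi> eps"
      then have "side l x" "side l x'" using S[OF x(1)] S[OF x(2)] m by (auto intro!: side_margin)
      then show ?thesis by simp
    next
      assume "Re x \<ge> l - \<psi> eps \<and> Re x' \<ge> l - \<psi> eps"
      then have "Re x > l - (l - \<bar>\<nu>\<bar> / \<gamma>) / 2" "Re x' > l - (l - \<bar>\<nu>\<bar> / \<gamma>) / 2" using m(2) by linarith+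
      then have "\<not> side l x" "\<not> side l x'"
        using side_margin(2)[of x l] side_margin(2)[of x' l] S[OF x(1)] S[OF x(2)] by blast+
      then show ?thesis by simp
    qed
    let ?r = "cmod (?y x - ?y x') / eps"
    have "\<bar>?r\<^sup>2 - 1\<bar> \<le> 3 * e"
      by (rule small_strain(1)[OF x(3) eps _ _ _ _ opening_same_side[OF same e(1), of eps] e(1,2)]) (simp_all add: cleaved_def)
    then have "?r\<^sup>2 \<le> R0" using e by linarith
    also have "R0 * 1 \<le> R0 * R0" using e by (intro mult_left_mono) auto
    finally have "?r\<^sup>2 \<le> R0\<^sup>2" by (simp add: power2_eq_square)
    then have "?r \<le> R0" by (rule power2_le_imp_le) (use e in auto)
    then show ?thesis using eps by (simp add: field_simps)
  qed
  ultimately show ?thesis unfolding admissible_def by blast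
qed

text \<open>Besides the cleaved bonds only those near the lateral sides are strained. There are
  O(1/eps) of them with energy O(e^2) = O(eps) each, which contributes O(eps) after scaling.\<close>

lemma crack_upper_bound:
  fixes W :: "real \<Rightarrow> ereal"
  assumes a: "a > 0" and l: "l > 1 / sqrt 3" and \<alpha>: "\<alpha> > 0" and C: "C \<ge> 0" and R0: "R0 > 1" and \<beta>: "\<beta> \<ge> 0"
    and W_nonneg: "\<forall>r\<ge>0. W r \<ge> 0" and W1: "W 1 = 0"
    and near: "\<And>r. 0 \<le> r \<Longrightarrow> \<bar>r\<^sup>2 - 1\<bar> \<le> \<eta>0 \<Longrightarrow>
       W r \<le> ereal (\<alpha> / 8 * (r\<^sup>2 - 1)\<^sup>2 + b * (r\<^sup>2 - 1) ^ 3 + C * (r\<^sup>2 - 1) ^ 4)" and \<eta>0: "\<eta>0 > 0"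
    and far: "\<And>r. r \<ge> M \<Longrightarrow> W r \<le> ereal (\<beta> + C1 / r\<^sup>2)" and C1: "C1 \<ge> 0"
    and psi: "(\<psi> \<longlongrightarrow> 0) (at_right 0)"
  shows "\<exists>C eps0. eps0 > 0 \<and> (\<forall>eps. 0 < eps \<longrightarrow> eps < eps0 \<longrightarrow> (\<exists>y\<in>admissible \<phi> l R0 \<psi> eps (sqrt eps * a).
    scaled_energy W \<phi> l eps y \<le> ereal (2 * \<beta> / \<gamma> + C * eps)))"
proof -
  define m where "m = (l - \<bar>\<nu>\<bar> / \<gamma>) / 2"
  have m: "m > 0" using nu_over_gamma l by (simp add: m_def)
  have l0: "l > 0" using l by (smt (verit) divide_nonneg_nonneg real_sqrt_ge_zero)
  obtain eps1 where eps1: "eps1 > 0" "\<And>eps. 0 < eps \<Longrightarrow> eps < eps1 \<Longrightarrow> \<psi> eps < m"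
    using order_tendstoD(2)[OF psi m] unfolding eventually_at_right_field by blast
  define c where "c = min 1 (min \<eta>0 (R0 - 1))"
  have c: "c > 0" "c \<le> 1" "c \<le> \<eta>0" "c \<le> R0 - 1" using \<eta>0 R0 by (auto simp: c_def)
  define M' where "M' = max M 1"
  have M': "M' \<ge> 1" "M' \<ge> M" by (auto simp: M'_def)
  \<comment> \<open>The entries ensure \<open>3 * e \<le> c\<close>, the gap estimate, cleaved bonds
    of length at least \<open>M'\<close>, and that eps, being at most \<open>s\<close>, fits into
    the margin \<open>m\<close> and below l / 4.\<close>
  define s0 where "s0 = Min {1, c / (3 * a), a * l / 4, a * l / 4 / M', m / 2, l / 4}"
  have s0: "s0 > 0" using c a l0 M' m by (simp add: s0_def)
  define K where "K = 9 * a\<^sup>2 * (\<alpha> / 8 + \<bar>b\<bar> + C)"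
  have K: "K \<ge> 0" using \<alpha> C by (simp add: K_def)
  \<comment> \<open>From the tail at bond length a l / (4 s): its error there is C1 * 16 * s^2 / (a
    l)^2.\<close>
  define C2 where "C2 = C1 * 16 / (a * l)\<^sup>2"
  have C2: "C2 \<ge> 0" using C1 by (simp add: C2_def)
  define D where "D = 2 * C2 / \<gamma> + 6 * (3 / \<kappa> + 1) * K / \<gamma> + 2 * \<beta> + 2 * C2 + 6 * (3 / \<kappa> + 1) * K"
  define eps0 where "eps0 = min eps1 (s0\<^sup>2)"
  show ?thesis
  proof (rule exI[of _ D], rule exI[of _ eps0], intro conjI allI impI)
    show "eps0 > 0" using eps1 s0 by (simp add: eps0_def)
    fix eps assume eps: "0 < eps" "eps < eps0"
    define s where "s = sqrt eps"
    have "s \<le> s0" unfolding s_def using eps s0 by (intro real_le_lsqrt) (auto simp: eps0_def)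
    then have s: "s > 0" "s\<^sup>2 = eps" "s \<le> 1" "s \<le> c / (3 * a)" "s \<le> a * l / 4" "s \<le> a * l / 4 / M'" "s \<le> m / 2" "s \<le> l / 4"
      using eps by (auto simp: s_def s0_def)
    have "eps \<le> s" using s unfolding s(2)[symmetric] power2_eq_square by (simp add: mult_left_le)
    then have es: "eps \<le> 1" "eps < m" "eps \<le> l / 4" using s m by auto
    define e where "e = s * a"
    have e: "0 \<le> e" "3 * e \<le> c" using s a by (auto simp: e_def field_simps)
    then have e1: "e \<le> 1" "3 * e \<le> \<eta>0" "3 * e \<le> R0 - 1" "3 * e \<le> 1" using c by auto
    have psi: "\<psi> eps < m" using eps1 eps by (simp add: eps0_def)
    let ?y = "cleaved l eps e"
    have adm: "?y \<in> admissible \<phi> l R0 \<psi> eps (sqrt eps * a)"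
      using cleaved_admissible[of eps l \<psi> e R0] eps es psi e e1 unfolding m_def e_def s_def by simp
    define L H where "L = l / eps" and "H = 1 / eps"
    define n where "n = \<lfloor>(l - \<nu> / \<gamma>) / 2 / (eps * \<kappa>)\<rfloor>"
    let ?mg = "\<lambda>p. X (fst p) (snd p) \<le> 2 \<or> X (fst p) (snd p) \<ge> L - 2"
    define f where "f p q = (if (fst p \<le> n) \<noteq> (fst q \<le> n) then \<beta> + C2 * eps else 0) + (if ?mg p then K * eps else 0)"
      for p q :: "int \<times> int"
    have side: "side l (pt eps p) \<longleftrightarrow> fst p \<le> n" for p using side_pt[OF eps(1)] by (simp add: n_def)
    have Wf: "W (cmod (?y (pt eps p) - ?y (pt eps q)) / eps) \<le> ereal (f p q)"
      if pq: "p \<in> box L H" "q \<in> box L H" "q - p \<in> bond_dirs" for p q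
    proof -
      define x x' where "x = pt eps p" and "x' = pt eps q"
      have d: "cmod (x - x') = eps" unfolding x_def x'_def using pq(3) eps by (simp add: pt_neighbours)
      let ?r = "cmod (?y x - ?y x') / eps"
      have r0: "?r \<ge> 0" using eps by simp
      show ?thesis
      proof (cases "side l x = side l x'")
        case False
        have "?r \<ge> a * l / 4 / s"
        proof (cases "side l x")
          case True
          then have "\<not> side l x'" using False by simp
          from crossing_bond_long[OF True this d s(1) s(2)[symmetric] e_def s(5) a es(3)]
          show ?thesis by (simp add: norm_minus_commute)
        next
          case nx: False
          then have "side l x'" using False by simp
          moreover have "cmod (x' - x) = eps" using d by (simp add: norm_minus_commute)
          ultimately show ?thesis
            using nx by (intro crossing_bond_long[OF _ _ _ s(1) s(2)[symmetric] e_def s(5) a es(3)])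
        qed
        moreover have "a * l / 4 / s \<ge> M'" using s(1,6) M' by (simp add: field_simps)
        ultimately have rM: "?r \<ge> M" "?r > 0" using M' by linarith+
        have sq: "(a * l / 4 / s)\<^sup>2 \<le> ?r\<^sup>2" using \<open>?r \<ge> a * l / 4 / s\<close> a l0 s by (intro power_mono) auto
        have pos: "0 < (a * l / 4 / s)\<^sup>2" using a l0 s by simp
        have "C1 / ?r\<^sup>2 \<le> C1 / (a * l / 4 / s)\<^sup>2"
          by (rule divide_left_mono[OF sq C1 mult_pos_pos[OF less_le_trans[OF pos sq] pos]])
        also have "\<dots> = C2 * eps" unfolding C2_def s(2)[symmetric] using a l0 s
          by (simp add: power_divide)
        finally have "W ?r \<le> ereal (\<beta> + C2 * eps)" using far[OF rM(1)] by (meson add_left_mono ereal_less_eq(3) order_trans)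
        also have "\<dots> \<le> ereal (f p q)" using False K eps unfolding x_def x'_def side f_def by auto
        finally show ?thesis unfolding x_def x'_def .
      next
        case same: True
        note sm = small_strain[OF d eps(1) _ _ _ _ opening_same_side[OF same e(1), of eps] e(1) e1(1),
            of "?y x" "?y x'"]
        have f: "f p q = (if ?mg p then K * eps else 0)" using same unfolding x_def x'_def side f_def by auto
        show ?thesis
        proof (cases "?mg p")
          case True
          define z where "z = ?r\<^sup>2 - 1"
          have z: "\<bar>z\<bar> \<le> 3 * e" unfolding z_def using sm(1) by (simp add: cleaved_def)
          have z1: "\<bar>z\<bar> \<le> 1" "\<bar>z\<bar> \<le> \<eta>0" using z e1 by auto
          have "b * z ^ 3 \<le> \<bar>b\<bar> * z\<^sup>2"
          proof -
            have "b * z ^ 3 \<le> \<bar>b * z ^ 3\<bar>" by simp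
            also have "\<dots> = \<bar>b\<bar> * (z\<^sup>2 * \<bar>z\<bar>)" by (simp add: abs_mult power2_eq_square power3_eq_cube)
            also have "\<dots> \<le> \<bar>b\<bar> * (z\<^sup>2 * 1)" using z1 by (intro mult_left_mono) auto
            finally show ?thesis by simp
          qed
          moreover have "C * z ^ 4 \<le> C * z\<^sup>2"
          proof -
            have "z ^ 4 = z\<^sup>2 * z\<^sup>2" by (simp add: power2_eq_square power4_eq_xxxx)
            also have "\<dots> \<le> z\<^sup>2 * 1" using z1 by (intro mult_left_mono) (auto simp: abs_square_le_1)
            finally show ?thesis using C by (simp add: mult_left_mono)
          qed
          ultimately have "\<alpha> / 8 * z\<^sup>2 + b * z ^ 3 + C * z ^ 4 \<le> (\<alpha> / 8 + \<bar>b\<bar> + C) * z\<^sup>2"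
            unfolding distrib_right by linarith
          also have "\<dots> \<le> (\<alpha> / 8 + \<bar>b\<bar> + C) * (3 * e)\<^sup>2"
            using power_mono[OF z, of 2] \<alpha> C by (intro mult_left_mono) auto
          also have "\<dots> = K * eps" unfolding K_def e_def s(2)[symmetric] by (simp add: power_mult_distrib)
          finally have "ereal (\<alpha> / 8 * z\<^sup>2 + b * z ^ 3 + C * z ^ 4) \<le> ereal (K * eps)" by simp
          moreover have "W ?r \<le> ereal (\<alpha> / 8 * z\<^sup>2 + b * z ^ 3 + C * z ^ 4)"
            unfolding z_def using r0 z1(2) by (intro near) (auto simp: z_def)
          ultimately have "W ?r \<le> ereal (f p q)" using True unfolding f by (auto intro: order_trans)
          then show ?thesis unfolding x_def x'_def .
        next
          case nm: False
          have Rx: "Re x = eps * X (fst p) (snd p)" by (simp add: x_def Re_pt)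
          have "eps * 2 \<le> eps * X (fst p) (snd p)" "eps * X (fst p) (snd p) \<le> eps * (L - 2)"
            using nm eps by (auto intro!: mult_left_mono)
          then have "2 * eps \<le> Re x" "Re x \<le> l - 2 * eps" using eps unfolding Rx by (auto simp: L_def algebra_simps)
          moreover have "\<bar>Re x - Re x'\<bar> \<le> eps" using d abs_Re_le_cmod[of "x - x'"] by simp
          ultimately have "min (Re x) eps = eps" "min (Re x') eps = eps" "min (l - Re x) eps = eps" "min (l - Re x') eps = eps"
            using eps by linarith+
          then have "crack_opening l eps e x = crack_opening l eps e x'" using same by (simp add: crack_opening_def)
          then have "?r = 1" using sm(2) by (simp add: cleaved_def)
          then have "W ?r = 0" using W1 by (simp only:)
          then have "W ?r \<le> ereal (f p q)" using nm unfolding f by (simp add: zero_ereal_def)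
          then show ?thesis unfolding x_def x'_def .
        qed
      qed
    qed
    have "energy W \<phi> l eps (?y) \<le> ereal (bond_sum L H f)"
      unfolding L_def H_def using Wf[unfolded L_def H_def] by (intro energy_le[OF eps(1) W_nonneg])
    also have "bond_sum L H f \<le> (H / \<gamma> + 1) * (2 * (\<beta> + C2 * eps) + 6 * (3 / \<kappa> + 1) * (K * eps))"
      unfolding f_def using eps \<beta> C2 K by (intro cleaved_bond_sum) (auto simp: H_def)
    finally have E: "energy W \<phi> l eps (?y) \<le> ereal ((H / \<gamma> + 1) * (2 * (\<beta> + C2 * eps) + 6 * (3 / \<kappa> + 1) * (K * eps)))"
      by simp
    have "scaled_energy W \<phi> l eps (?y) \<le> ereal eps * ereal ((H / \<gamma> + 1) * (2 * (\<beta> + C2 * eps) + 6 * (3 / \<kappa> + 1) * (K * eps)))"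
      unfolding scaled_energy_def using E eps by (intro ereal_mult_left_mono) auto
    also have "\<dots> \<le> ereal (2 * \<beta> / \<gamma> + D * eps)"
    proof -
      define P where "P = 6 * (3 / \<kappa> + 1) * K"
      have P: "P \<ge> 0" using K kappa_pos by (simp add: P_def)
      have "eps * ((H / \<gamma> + 1) * (2 * (\<beta> + C2 * eps) + P * eps)) = (1 / \<gamma> + eps) * (2 * \<beta> + 2 * C2 * eps + P * eps)"
        using eps gamma_pos by (simp add: H_def field_simps)
      also have "\<dots> = 2 * \<beta> / \<gamma> + (2 * C2 / \<gamma> + P / \<gamma> + 2 * \<beta>) * eps + (2 * C2 + P) * (eps * eps)"
        by (simp add: algebra_simps)
      also have "\<dots> \<le> 2 * \<beta> / \<gamma> + (2 * C2 / \<gamma> + P / \<gamma> + 2 * \<beta>) * eps + (2 * C2 + P) * (eps * 1)"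
        using C2 P eps es by (intro add_left_mono mult_left_mono) auto
      also have "\<dots> = 2 * \<beta> / \<gamma> + D * eps" unfolding D_def P_def[symmetric] by (simp add: algebra_simps)
      finally show ?thesis unfolding P_def by (simp add: mult.assoc)
    qed
    finally show "\<exists>y\<in>admissible \<phi> l R0 \<psi> eps (sqrt eps * a). scaled_energy W \<phi> l eps y \<le> ereal (2 * \<beta> / \<gamma> + D * eps)"
      by (rule bexI[OF _ adm])
  qed
qed

end

section \<open>The limiting energy\<close>

theorem theorem2p2:
  fixes W :: "real \<Rightarrow> ereal" and w :: "real \<Rightarrow> real"
    and \<delta> \<alpha> \<alpha>' \<beta> l \<phi> a R0 :: real and \<psi> :: "real \<Rightarrow> real"
  assumes phi: "0 \<le> \<phi>" "\<phi> < pi / 3"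
    and l: "l > 1 / sqrt 3"
    and a: "a \<ge> 0"
    and W_nonneg: "\<forall>r\<ge>0. W r \<ge> 0"
    and W_zero: "\<forall>r\<ge>0. W r = 0 \<longleftrightarrow> r = 1"
    and W_cont: "continuous_on {0..} W"
    and \<delta>: "\<delta> > 0"
    and W_loc: "\<forall>r\<in>ball 1 \<delta>. W r = ereal (w r)"
    and w_C4: "C4_on (ball 1 \<delta>) w"
    and alpha: "\<alpha> = (deriv ^^ 2) w 1" "\<alpha> > 0"
    and alpha': "\<alpha>' = (deriv ^^ 3) w 1"
    and W_inf: "\<exists>C M. \<forall>r\<ge>M. W r \<noteq> \<infinity> \<and> \<bar>real_of_ereal (W r) - \<beta>\<bar> \<le> C / r\<^sup>2"
    and R0: "R0 > 1"
    and psi: "(\<psi> \<longlongrightarrow> 0) (at_right 0)" "filterlim (\<lambda>e. \<psi> e / e) at_top (at_right 0)"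
  shows "\<exists>C \<epsilon>0. \<epsilon>0 > 0 \<and> (\<forall>\<epsilon>. 0 < \<epsilon> \<and> \<epsilon> < \<epsilon>0 \<longrightarrow>
     \<bar>(INF y\<in>admissible \<phi> l R0 \<psi> \<epsilon> (sqrt \<epsilon> * a). scaled_energy W \<phi> l \<epsilon> y)
       - ereal (min (\<alpha> * l / sqrt 3 * a\<^sup>2
                    + (6 * \<alpha> + 7 * \<alpha>' - 2 * (3 * \<alpha> - \<alpha>') * cos (6 * \<phi>)) * l
                        / (27 * sqrt 3) * sqrt \<epsilon> * a ^ 3)
                    (2 * \<beta> / sin (\<phi> + pi / 3)))\<bar> \<le> ereal (C * \<epsilon>))"
proof -
  interpret lattice_angle \<phi> by unfold_locales (use phi in auto)
  define b where "b = \<alpha>' / 48 - \<alpha> / 16"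
  define V where "V eps = min (elastic l \<alpha> b a eps) (2 * \<beta> / \<gamma>)" for eps
  have V: "min (\<alpha> * l / sqrt 3 * a\<^sup>2 + (6 * \<alpha> + 7 * \<alpha>' - 2 * (3 * \<alpha> - \<alpha>') * cos (6 * \<phi>)) * l / (27 * sqrt 3) * sqrt eps * a ^ 3)
      (2 * \<beta> / sin (\<phi> + pi / 3)) = V eps" for eps
  proof -
    have k: "cubic \<alpha> b = (6 * \<alpha> + 7 * \<alpha>' - 2 * (3 * \<alpha> - \<alpha>') * cos (6 * \<phi>)) / 54"
      unfolding b_def cube_def sum_p_cube by (simp add: field_simps)
    have "l / (q / 2) * (\<alpha> / 2 * a\<^sup>2 + u / 54 * t * a ^ 3) = \<alpha> * l / q * a\<^sup>2 + u * l / (27 * q) * t * a ^ 3"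
      if "q > 0" for q t u :: real using that by (simp add: field_simps)
    from this[of "sqrt 3"] show ?thesis unfolding V_def k gamma_kappa by (simp add: \<gamma>_def)
  qed
  have l0: "l > 0" using l by (smt (verit) divide_nonneg_nonneg real_sqrt_ge_zero)
  \<comment> \<open>A radius of at most 1 keeps the ball inside r > 0, where \<open>W\<close> is
    known to be nonnegative.\<close>
  define \<delta>' where "\<delta>' = min \<delta> 1"
  have \<delta>': "\<delta>' > 0" "\<delta>' \<le> 1" and sub: "ball 1 \<delta>' \<subseteq> ball (1::real) \<delta>" using \<delta> by (auto simp: \<delta>'_def)
  have C4: "C4_on (ball 1 \<delta>') w"
    using w_C4 sub unfolding C4_on_def by (meson continuous_on_subset subset_iff)
  have W1: "W 1 = 0" using W_zero by simp
  have w1: "w 1 = 0" using W1 W_loc \<delta> by simp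
  have w_nonneg: "w r \<ge> 0" if r: "r \<in> ball 1 \<delta>'" for r
  proof -
    have "r \<ge> 0" using r \<delta>' by (auto simp: dist_real_def)
    then show ?thesis using W_nonneg W_loc r sub by (metis ereal_less_eq(5) subsetD)
  qed
  define \<eta> where "\<eta> = min 1 (\<delta>' / 2)"
  have \<eta>: "0 < \<eta>" "\<eta> \<le> 1" using \<delta>' by (auto simp: \<eta>_def)
  obtain C where C: "C \<ge> 0" and expand: "\<And>r. r \<ge> 0 \<Longrightarrow> \<bar>r\<^sup>2 - 1\<bar> \<le> \<eta> \<Longrightarrow> r \<in> ball 1 \<delta>' \<and>
      \<bar>w r - (\<alpha> / 8 * (r\<^sup>2 - 1)\<^sup>2 + b * (r\<^sup>2 - 1) ^ 3)\<bar> \<le> C * (r\<^sup>2 - 1) ^ 4"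
    using expansion_in_squared_length[OF C4 \<delta>'(1) w1 w_nonneg alpha(1) alpha'] unfolding b_def \<eta>_def by blast
  have near_le: "W r \<le> ereal (\<alpha> / 8 * (r\<^sup>2 - 1)\<^sup>2 + b * (r\<^sup>2 - 1) ^ 3 + C * (r\<^sup>2 - 1) ^ 4)"
    and near_ge: "ereal (\<alpha> / 8 * (r\<^sup>2 - 1)\<^sup>2 + b * (r\<^sup>2 - 1) ^ 3 - C * (r\<^sup>2 - 1) ^ 4) \<le> W r"
    if r: "0 \<le> r" "\<bar>r\<^sup>2 - 1\<bar> \<le> \<eta>" for r
  proof -
    have "W r = ereal (w r)" using expand[OF r] W_loc sub by blast
    moreover have "w r \<le> \<alpha> / 8 * (r\<^sup>2 - 1)\<^sup>2 + b * (r\<^sup>2 - 1) ^ 3 + C * (r\<^sup>2 - 1) ^ 4"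
      "\<alpha> / 8 * (r\<^sup>2 - 1)\<^sup>2 + b * (r\<^sup>2 - 1) ^ 3 - C * (r\<^sup>2 - 1) ^ 4 \<le> w r"
      using conjunct2[OF expand[OF r]] by linarith+
    ultimately show "W r \<le> ereal (\<alpha> / 8 * (r\<^sup>2 - 1)\<^sup>2 + b * (r\<^sup>2 - 1) ^ 3 + C * (r\<^sup>2 - 1) ^ 4)"
      "ereal (\<alpha> / 8 * (r\<^sup>2 - 1)\<^sup>2 + b * (r\<^sup>2 - 1) ^ 3 - C * (r\<^sup>2 - 1) ^ 4) \<le> W r" by simp_all
  qed
  obtain C1 M0 where W_inf': "\<And>r. r \<ge> M0 \<Longrightarrow> W r \<noteq> \<infinity> \<and> \<bar>real_of_ereal (W r) - \<beta>\<bar> \<le> C1 / r\<^sup>2"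
    using W_inf by blast
  define M where "M = max M0 1"
  have M: "M \<ge> 1" "M \<ge> M0" by (auto simp: M_def)
  have far_eq: "W r = ereal (real_of_ereal (W r))" "0 \<le> real_of_ereal (W r)" "\<bar>real_of_ereal (W r) - \<beta>\<bar> \<le> C1 / r\<^sup>2"
    if "r \<ge> M" for r
  proof -
    have "0 \<le> W r" "W r \<noteq> \<infinity>" using W_inf'[of r] W_nonneg M that by auto
    then show "W r = ereal (real_of_ereal (W r))" "0 \<le> real_of_ereal (W r)"
      by (cases "W r"; simp)+
    show "\<bar>real_of_ereal (W r) - \<beta>\<bar> \<le> C1 / r\<^sup>2" using W_inf'[of r] M that by auto
  qed
  have C1: "C1 \<ge> 0"
  proof -
    have "0 \<le> C1 / M\<^sup>2" using far_eq(3)[of M] by linarith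
    then show ?thesis using M by (simp add: zero_le_divide_iff)
  qed
  \<comment> \<open>A negative \<beta> would contradict \<open>W \<ge> 0\<close> at a radius where
    the tail error is below -\<beta>.\<close>
  have \<beta>: "\<beta> \<ge> 0"
  proof (rule ccontr)
    assume neg: "\<not> \<beta> \<ge> 0"
    define r where "r = max M (C1 / (- \<beta>) + 1)"
    have r: "r \<ge> M" "r > C1 / (- \<beta>)" "r \<ge> 1" using M by (auto simp: r_def)
    have "- \<beta> \<le> C1 / r\<^sup>2" using far_eq[OF r(1)] by linarith
    also have "\<dots> \<le> C1 / r" using r C1 by (intro divide_left_mono) (auto simp: power2_eq_square)
    also have "\<dots> < - \<beta>" using r neg by (simp add: field_simps)
    finally show False by simp
  qed
  have far_le: "W r \<le> ereal (\<beta> + C1 / r\<^sup>2)" and far_ge: "ereal (\<beta> - C1 / r\<^sup>2) \<le> W r" if "r \<ge> M" for r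
  proof -
    have "real_of_ereal (W r) \<le> \<beta> + C1 / r\<^sup>2" "\<beta> - C1 / r\<^sup>2 \<le> real_of_ereal (W r)"
      using far_eq(3)[OF that] by linarith+
    then show "W r \<le> ereal (\<beta> + C1 / r\<^sup>2)" "ereal (\<beta> - C1 / r\<^sup>2) \<le> W r"
      by (subst far_eq(1)[OF that], simp)+
  qed
  let ?I = "\<lambda>eps. INF y\<in>admissible \<phi> l R0 \<psi> eps (sqrt eps * a). scaled_energy W \<phi> l eps y"
  have B0: "0 \<le> 2 * \<beta> / \<gamma>" using \<beta> gamma_pos by simp
  have upper: "\<exists>K eps0. eps0 > 0 \<and> (\<forall>eps. 0 < eps \<longrightarrow> eps < eps0 \<longrightarrow> ?I eps \<le> ereal (V eps + K * eps))"
  proof -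
    obtain K1 eps1 where 1: "eps1 > 0" "\<And>eps. 0 < eps \<Longrightarrow> eps < eps1 \<Longrightarrow> \<exists>y\<in>admissible \<phi> l R0 \<psi> eps (sqrt eps * a).
      scaled_energy W \<phi> l eps y
        \<le> ereal (elastic l \<alpha> b a eps + K1 * eps)"
      using elastic_upper_bound[OF a l0 alpha(2) C R0 W_nonneg near_le \<eta>(1)] by blast
    have I1: "?I eps \<le> ereal (elastic l \<alpha> b a eps + K1 * eps)"
      if "0 < eps" "eps < eps1" for eps
      using 1(2)[OF that] by (meson INF_lower2)
    show ?thesis
    \<comment> \<open>For a = 0 the cleaved competitor does not open; but then the minimum is 0 and
      the affine competitor attains it up to O(eps).\<close>
    proof (cases "a = 0")
      case True
      then have "V eps = 0" for eps using B0 by (simp add: V_def)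
      then show ?thesis using 1(1) I1 True by - (rule exI[of _ K1], rule exI[of _ eps1], auto)
    next
      case False
      then have "a > 0" using a by simp
      obtain K2 eps2 where 2: "eps2 > 0" "\<And>eps. 0 < eps \<Longrightarrow> eps < eps2 \<Longrightarrow> \<exists>y\<in>admissible \<phi> l R0 \<psi> eps (sqrt eps * a).
        scaled_energy W \<phi> l eps y \<le> ereal (2 * \<beta> / \<gamma> + K2 * eps)"
        using crack_upper_bound[OF \<open>a > 0\<close> l alpha(2) C R0 \<beta> W_nonneg W1 near_le \<eta>(1) far_le C1 psi(1)] by blast
      have I2: "?I eps \<le> ereal (2 * \<beta> / \<gamma> + K2 * eps)" if "0 < eps" "eps < eps2" for eps
        using 2(2)[OF that] by (meson INF_lower2)
      have "?I eps \<le> ereal (V eps + max K1 K2 * eps)" if e: "0 < eps" "eps < min eps1 eps2" for eps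
      proof -
        have K: "K1 * eps \<le> max K1 K2 * eps" "K2 * eps \<le> max K1 K2 * eps" using e by (auto intro!: mult_right_mono)
        show ?thesis
        proof (cases "elastic l \<alpha> b a eps \<le> 2 * \<beta> / \<gamma>")
          case True
          then have "V eps = elastic l \<alpha> b a eps"
            unfolding V_def by (rule min_absorb1)
          then show ?thesis using I1[of eps] e K by (intro order_trans[OF I1[of eps]]) auto
        next
          case False
          then have "V eps = 2 * \<beta> / \<gamma>" unfolding V_def by (intro min_absorb2) simp
          then show ?thesis using e K by (intro order_trans[OF I2[of eps]]) auto
        qed
      qed
      moreover have "min eps1 eps2 > 0" using 1 2 by simp
      ultimately show ?thesis by blast
    qed
  qed
  have nonneg: "0 \<le> ?I eps" if "0 < eps" for eps
  proof (rule INF_greatest)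
    fix y
    have "ereal 0 \<le> energy W \<phi> l eps y"
      using energy_ge[OF that, of "\<lambda>_. 0" W l y] W_nonneg by (simp add: bond_sum_def zero_ereal_def)
    then show "0 \<le> scaled_energy W \<phi> l eps y"
      using that unfolding scaled_energy_def zero_ereal_def[symmetric] by (intro ereal_0_le_mult) auto
  qed
  have lower: "\<exists>K eps0. eps0 > 0 \<and> (\<forall>eps. 0 < eps \<longrightarrow> eps < eps0 \<longrightarrow> ereal (V eps - K * eps) \<le> ?I eps)"
  \<comment> \<open>If a or \<beta> vanishes, \<open>V\<close> is at most 0 and nonnegativity of the
    energy suffices.\<close>
  proof (cases "a > 0 \<and> \<beta> > 0")
    case True
    then have ab: "a > 0" "\<beta> > 0" by auto
    obtain K eps0 where K: "eps0 > 0" "\<And>eps y. 0 < eps \<Longrightarrow> eps < eps0 \<Longrightarrow>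
      \<forall>x\<in>sites \<phi> l eps. Re x \<le> eps \<or> Re x \<ge> l - eps \<longrightarrow> Re (y x) = (1 + sqrt eps * a) * Re x \<Longrightarrow>
      ereal (V eps - K * eps) \<le> scaled_energy W \<phi> l eps y"
      using energy_lower_bound[OF ab(1) l0 ab(2) W_nonneg W_zero W_cont near_ge \<eta> C alpha(2) far_ge C1]
      unfolding V_def by blast
    have "ereal (V eps - K * eps) \<le> ?I eps" if "0 < eps" "eps < eps0" for eps
      by (rule INF_greatest, rule K(2)[OF that]) (auto simp: admissible_def)
    then show ?thesis using K(1) by blast
  next
    case False
    then have "V eps \<le> 0" for eps using a \<beta> B0 by (auto simp: V_def)
    then have "ereal (V eps - 0 * eps) \<le> ?I eps" if "0 < eps" for eps
      by (intro order_trans[OF _ nonneg[OF that]]) (simp add: zero_ereal_def)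
    then show ?thesis by - (rule exI[of _ 0], rule exI[of _ 1], auto)
  qed
  obtain K1 eps1 where 1: "eps1 > 0" "\<And>eps. 0 < eps \<Longrightarrow> eps < eps1 \<Longrightarrow> ?I eps \<le> ereal (V eps + K1 * eps)"
    using upper by blast
  obtain K2 eps2 where 2: "eps2 > 0" "\<And>eps. 0 < eps \<Longrightarrow> eps < eps2 \<Longrightarrow> ereal (V eps - K2 * eps) \<le> ?I eps"
    using lower by blast
  have "\<bar>?I eps - ereal (V eps)\<bar> \<le> ereal (max K1 K2 * eps)" if e: "0 < eps \<and> eps < min eps1 eps2" for eps
  proof -
    have K: "K1 * eps \<le> max K1 K2 * eps" "K2 * eps \<le> max K1 K2 * eps" using e by (auto intro!: mult_right_mono)
    have u: "?I eps \<le> ereal (V eps + K1 * eps)" and v: "ereal (V eps - K2 * eps) \<le> ?I eps" using 1 2 e by auto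
    obtain i where i: "?I eps = ereal i" using u v by (cases "?I eps") auto
    have "i \<le> V eps + K1 * eps" "V eps - K2 * eps \<le> i" using u v unfolding i by auto
    then have "\<bar>i - V eps\<bar> \<le> max K1 K2 * eps" using K by linarith
    then show ?thesis unfolding i by simp
  qed
  moreover have "min eps1 eps2 > 0" using 1 2 by simp
  ultimately show ?thesis unfolding V by blast
qed

end
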